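(* Let $\bar G=PSL_2(\mathbb{Q})$ and let $\bar G\curvearrowright Y$ be the action on the quotient $Y$ of $\widehat{\mathbb{Q}^2}$ by the relation identifying each $\phi\in\widehat{\mathbb{Q}^2}$ with $\phi'$, $\phi'(x,y):=\phi(-x,-y)$. Let $P$ be an intermediate von Neumann subalgebra between $L(\bar{G})$ and $L^{\infty}(Y)\rtimes \bar{G}$. Then $P=L(\bar{G})$ or $P=L^{\infty}(Y)\rtimes \bar{G}$. In other words, $L(\bar{G})$ is a maximal von Neumann subalgebra in $L^{\infty}(Y)\rtimes \bar{G}$.
   Context: Let $G=SL_2(\mathbb{Q})$, acting on the discrete group $\mathbb{Q}^2$ by matrix multiplication from the left. Let $G\curvearrowright \widehat{\mathbb{Q}^2}$ be the induced algebraic action on the Pontryagin dual (a compact metrizable abelian group with Haar probability measure), given by $(g\phi)(v)=\phi(g^{-1}v)$. $Y$ is the quotient of $\widehat{\mathbb{Q}^2}$ by the relation $\phi\sim\phi'$ where $\phi'(x,y):=\phi(-x,-y)$ for all $(x,y)\in\mathbb{Q}^2$, with the pushed-forward measure and the induced $G$-action. Since $-id$ acts trivially on $Y$, this descends to a probability-measure-preserving action $\bar G=PSL_2(\mathbb{Q})\curvearrowright Y$. Equivalently, $L^\infty(Y)$ is identified with the von Neumann subalgebra of $L(\mathbb{Q}^2)$ of all elements $\sum_{x,y}c_{x,y}u_{x,y}$ with $c_{x,y}=c_{-x,-y}$ for all $(x,y)\in\mathbb{Q}^2$. $L(\bar G)$ denotes the group von Neumann algebra, viewed inside the crossed product $L^\infty(Y)\rtimes\bar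 G$ in the canonical way. *)

theory Defs
  imports "HOL-Probability.Probability" "HOL-Algebra.Coset"
begin

section \<open>Operators on a complex Hilbert space with explicit carrier\<close>

record 'h hilbert = "'h partial_object" +
  hadd :: "'h \<Rightarrow> 'h \<Rightarrow> 'h"
  hscale :: "complex \<Rightarrow> 'h \<Rightarrow> 'h"
  hinner :: "'h \<Rightarrow> 'h \<Rightarrow> complex"

definition hnorm :: "'h hilbert \<Rightarrow> 'h \<Rightarrow> real" where
  "hnorm H \<xi> = sqrt (Re (hinner H \<xi> \<xi>))"

text \<open>Operators are extensional (\<open>undefined\<close> off the carrier), so that equality of HOL functions
  is equality of operators.\<close>

definition bounded_ops :: "'h hilbert \<Rightarrow> ('h \<Rightarrow> 'h) set" where
  "bounded_ops H = {T \<in> carrier H \<rightarrow>\<^sub>E carrier H.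
     (\<forall>\<xi>\<in>carrier H. \<forall>\<eta>\<in>carrier H. T (hadd H \<xi> \<eta>) = hadd H (T \<xi>) (T \<eta>)) \<and>
     (\<forall>c. \<forall>\<xi>\<in>carrier H. T (hscale H c \<xi>) = hscale H c (T \<xi>)) \<and>
     (\<exists>C. \<forall>\<xi>\<in>carrier H. hnorm H (T \<xi>) \<le> C * hnorm H \<xi>)}"

definition is_adjoint :: "'h hilbert \<Rightarrow> ('h \<Rightarrow> 'h) \<Rightarrow> ('h \<Rightarrow> 'h) \<Rightarrow> bool" where
  "is_adjoint H T S \<longleftrightarrow>
     (\<forall>\<xi>\<in>carrier H. \<forall>\<eta>\<in>carrier H. hinner H (T \<xi>) \<eta> = hinner H \<xi> (S \<eta>))"

definition commutant :: "'h hilbert \<Rightarrow> ('h \<Rightarrow> 'h) set \<Rightarrow> ('h \<Rightarrow> 'h) set" where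
  "commutant H A = {T \<in> bounded_ops H.
     \<forall>S\<in>A. compose (carrier H) T S = compose (carrier H) S T}"

text \<open>A von Neumann algebra on \<open>H\<close> is a set of bounded operators that is closed under adjoints and
  equal to its bicommutant; being a commutant, it is then automatically a unital subalgebra.\<close>

definition von_neumann_algebra :: "'h hilbert \<Rightarrow> ('h \<Rightarrow> 'h) set \<Rightarrow> bool" where
  "von_neumann_algebra H A \<longleftrightarrow>
     A \<subseteq> bounded_ops H \<and>
     (\<forall>T\<in>A. \<exists>S\<in>A. is_adjoint H T S) \<and>
     commutant H (commutant H A) = A"

definition vN_generated :: "'h hilbert \<Rightarrow> ('h \<Rightarrow> 'h) set \<Rightarrow> ('h \<Rightarrow> 'h) set" where
  "vN_generated H S = \<Inter> {A. von_neumann_algebra H A \<and> S \<subseteq> A}"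

definition maximal_vN_subalgebra :: "'h hilbert \<Rightarrow> ('h \<Rightarrow> 'h) set \<Rightarrow> ('h \<Rightarrow> 'h) set \<Rightarrow> bool" where
  "maximal_vN_subalgebra H N M \<longleftrightarrow>
     von_neumann_algebra H N \<and> von_neumann_algebra H M \<and> N \<subset> M \<and>
     (\<forall>P. von_neumann_algebra H P \<and> N \<subseteq> P \<and> P \<subseteq> M \<longrightarrow> P = N \<or> P = M)"


section \<open>The Hilbert space of square-integrable functions modulo null sets\<close>

definition square_integrable :: "'a measure \<Rightarrow> ('a \<Rightarrow> complex) set" where
  "square_integrable M =
     {f \<in> borel_measurable M. integrable M (\<lambda>x. (cmod (f x))\<^sup>2)}"

definition ae_eq_rel :: "'a measure \<Rightarrow> (('a \<Rightarrow> complex) \<times> ('a \<Rightarrow> complex)) set" where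
  "ae_eq_rel M =
     {(f, g). f \<in> square_integrable M \<and> g \<in> square_integrable M \<and> (AE x in M. f x = g x)}"

definition L2_class :: "'a measure \<Rightarrow> ('a \<Rightarrow> complex) \<Rightarrow> ('a \<Rightarrow> complex) set" where
  "L2_class M f = ae_eq_rel M `` {f}"

definition L2_rep :: "('a \<Rightarrow> complex) set \<Rightarrow> 'a \<Rightarrow> complex" where
  "L2_rep \<xi> = (SOME f. f \<in> \<xi>)"

definition L2 :: "'a measure \<Rightarrow> ('a \<Rightarrow> complex) set hilbert" where
  "L2 M = \<lparr>carrier = square_integrable M // ae_eq_rel M,
           hadd = (\<lambda>\<xi> \<eta>. L2_class M (\<lambda>x. L2_rep \<xi> x + L2_rep \<eta> x)),
           hscale = (\<lambda>c \<xi>. L2_class M (\<lambda>x. c * L2_rep \<xi> x)),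
           hinner = (\<lambda>\<xi> \<eta>. LINT x|M. L2_rep \<xi> x * cnj (L2_rep \<eta> x))\<rparr>"

text \<open>Essentially bounded functions; representatives of the elements of \<open>L\<^sup>\<infinity>\<close>.\<close>

definition ess_bounded :: "'a measure \<Rightarrow> ('a \<Rightarrow> complex) set" where
  "ess_bounded M = {f \<in> borel_measurable M. \<exists>C. AE x in M. cmod (f x) \<le> C}"


section \<open>Crossed product by a measure-preserving action of a countable discrete group\<close>

text \<open>The crossed product is represented on \<open>L\<^sup>2(N) \<otimes> \<ell>\<^sup>2(G) = L\<^sup>2(N \<times> G)\<close>, with counting measure on
  \<open>G\<close>, by \<open>(\<pi>(f)\<xi>)(s) = \<sigma>(s\<inverse>)(f) \<xi>(s)\<close> and \<open>(\<lambda>(t)\<xi>)(s) = \<xi>(t\<inverse>s)\<close>, where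
  \<open>\<sigma>(s)(f)(y) = f(s\<inverse>y)\<close>. Hence \<open>\<sigma>(s\<inverse>)(f)(y) = f(sy)\<close>.\<close>

definition crossed_space ::
  "('g, 'm) monoid_scheme \<Rightarrow> 'y measure \<Rightarrow> ('y \<times> 'g \<Rightarrow> complex) set hilbert" where
  "crossed_space G N = L2 (N \<Otimes>\<^sub>M count_space (carrier G))"

definition crossed_mult ::
  "('g, 'm) monoid_scheme \<Rightarrow> ('g \<Rightarrow> 'y \<Rightarrow> 'y) \<Rightarrow> 'y measure \<Rightarrow> ('y \<Rightarrow> complex) \<Rightarrow>
     ('y \<times> 'g \<Rightarrow> complex) set \<Rightarrow> ('y \<times> 'g \<Rightarrow> complex) set" where
  "crossed_mult G act N f = (\<lambda>\<xi>\<in>carrier (crossed_space G N).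
     L2_class (N \<Otimes>\<^sub>M count_space (carrier G)) (\<lambda>(y, s). f (act s y) * L2_rep \<xi> (y, s)))"

definition crossed_translation ::
  "('g, 'm) monoid_scheme \<Rightarrow> 'y measure \<Rightarrow> 'g \<Rightarrow>
     ('y \<times> 'g \<Rightarrow> complex) set \<Rightarrow> ('y \<times> 'g \<Rightarrow> complex) set" where
  "crossed_translation G N t = (\<lambda>\<xi>\<in>carrier (crossed_space G N).
     L2_class (N \<Otimes>\<^sub>M count_space (carrier G)) (\<lambda>(y, s). L2_rep \<xi> (y, m_inv G t \<otimes>\<^bsub>G\<^esub> s)))"

definition crossed_product ::
  "('g, 'm) monoid_scheme \<Rightarrow> ('g \<Rightarrow> 'y \<Rightarrow> 'y) \<Rightarrow> 'y measure \<Rightarrow>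
     (('y \<times> 'g \<Rightarrow> complex) set \<Rightarrow> ('y \<times> 'g \<Rightarrow> complex) set) set" where
  "crossed_product G act N = vN_generated (crossed_space G N)
     (crossed_mult G act N ` ess_bounded N \<union> crossed_translation G N ` carrier G)"

text \<open>The canonical copy \<open>1 \<otimes> L(G)\<close> of the group von Neumann algebra in the crossed product.\<close>

definition group_vN ::
  "('g, 'm) monoid_scheme \<Rightarrow> 'y measure \<Rightarrow>
     (('y \<times> 'g \<Rightarrow> complex) set \<Rightarrow> ('y \<times> 'g \<Rightarrow> complex) set) set" where
  "group_vN G N = vN_generated (crossed_space G N) (crossed_translation G N ` carrier G)"


section \<open>The groups and the action\<close>

definition SL2Q :: "(rat^2^2) monoid" where
  "SL2Q = \<lparr>carrier = {A. det A = 1}, mult = (**), one = mat 1\<rparr>"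

definition PSL2Q :: "(rat^2^2) set monoid" where
  "PSL2Q = SL2Q Mod {mat 1, - mat 1}"

text \<open>The Pontryagin dual of the discrete group \<open>\<rat>\<^sup>2\<close>. Its compact topology, the one of pointwise
  convergence, is induced by the product topology on the function type.\<close>

definition dual_Q2 :: "(rat^2 \<Rightarrow> complex) set" where
  "dual_Q2 = {\<phi>. (\<forall>v w. \<phi> (v + w) = \<phi> v * \<phi> w) \<and> (\<forall>v. cmod (\<phi> v) = 1)}"

definition haar_probability :: "(rat^2 \<Rightarrow> complex) measure \<Rightarrow> bool" where
  "haar_probability \<mu> \<longleftrightarrow>
     prob_space \<mu> \<and> sets \<mu> = sets (restrict_space borel dual_Q2) \<and>
     (\<forall>\<psi>\<in>dual_Q2. distr \<mu> \<mu> (\<lambda>\<phi> v. \<psi> v * \<phi> v) = \<mu>)"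

definition flip_rel :: "((rat^2 \<Rightarrow> complex) \<times> (rat^2 \<Rightarrow> complex)) set" where
  "flip_rel = {(\<phi>, \<phi>'). \<phi> \<in> dual_Q2 \<and> (\<phi>' = \<phi> \<or> \<phi>' = (\<lambda>v. \<phi> (- v)))}"

definition Y_space :: "(rat^2 \<Rightarrow> complex) set set" where
  "Y_space = dual_Q2 // flip_rel"

definition Y_proj :: "(rat^2 \<Rightarrow> complex) \<Rightarrow> (rat^2 \<Rightarrow> complex) set" where
  "Y_proj \<phi> = flip_rel `` {\<phi>}"

text \<open>The push-forward of \<open>\<mu>\<close> to \<open>Y\<close>, on the quotient \<open>\<sigma>\<close>-algebra.\<close>

definition Y_measure ::
  "(rat^2 \<Rightarrow> complex) measure \<Rightarrow> (rat^2 \<Rightarrow> complex) set measure" where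
  "Y_measure \<mu> =
     distr \<mu> (sigma Y_space {B. B \<subseteq> Y_space \<and> Y_proj -` B \<inter> space \<mu> \<in> sets \<mu>}) Y_proj"

definition dual_act :: "rat^2^2 \<Rightarrow> (rat^2 \<Rightarrow> complex) \<Rightarrow> (rat^2 \<Rightarrow> complex)" where
  "dual_act g \<phi> = (\<lambda>v. \<phi> (m_inv SL2Q g *v v))"

text \<open>For \<open>\<gamma> = {g, -g}\<close> and \<open>y = {\<phi>, \<phi>'}\<close> this set is the class \<open>{g\<phi>, (g\<phi>)'}\<close> of \<open>g\<phi>\<close>.\<close>

definition Y_act :: "(rat^2^2) set \<Rightarrow> (rat^2 \<Rightarrow> complex) set \<Rightarrow> (rat^2 \<Rightarrow> complex) set" where
  "Y_act \<gamma> y = {dual_act g \<phi> | g \<phi>. g \<in> \<gamma> \<and> \<phi> \<in> y}"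

end

theory Submission
  imports Defs
begin

text \<open>For \<open>v\<close> in the rational plane put \<open>U v = u\<^sub>v + u\<^sub>-\<^sub>v\<close>, and let \<open>P\<close> lie between \<open>L(G)\<close> and the crossed
  product \<open>M\<close>.  Let \<open>eta v\<close> be the projection of \<open>U v Om\<close> to the closure of \<open>P Om\<close>, where \<open>Om\<close> is the trace
  vector.  It is invariant under conjugation by the stabiliser of \<open>v\<close>, so its Fourier coefficients are constant
  on the orbits of a unipotent group; being square-summable they vanish on the infinite orbits.  Hence
  \<open>eta e1\<close> has coefficients \<open>C y s\<close> only at \<open>y e1\<close> and the upper unipotent matrix with entry \<open>s\<close>.

  For \<open>a\<close> in \<open>P\<close> the projection of \<open>a U v Om\<close> is \<open>a eta v\<close>.  Letting \<open>a Om\<close> tend to \<open>eta e2\<close> with \<open>v = e1\<close> and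
  comparing coefficients shows that \<open>C x r \<noteq> 0\<close> excludes \<open>C y s \<noteq> 0\<close> for \<open>s \<noteq> 0\<close>, and that
  \<open>|C(x/y)| |C(1/y)| = |C y| |C x|\<close> for the coefficients with \<open>s = 0\<close>.  The latter forces \<open>|C|\<close> to be constant on
  a subgroup of the nonzero rationals and zero elsewhere, so by square-summability only \<open>y = 1\<close> and
  \<open>y = -1\<close> survive.  Therefore \<open>eta e1\<close> is either zero or a nonzero multiple of \<open>U e1 Om\<close>.  As \<open>G\<close> is transitive on
  nonzero vectors, \<open>P Om\<close> is contained in the closure of \<open>L(G) Om\<close> in the first case and dense in the second,
  and an element of \<open>M\<close> whose value at \<open>Om\<close> is in the closure of \<open>P Om\<close> belongs to \<open>P\<close>.\<close>

section \<open>Hilbert spaces and von Neumann algebras\<close>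

text \<open>The natural object is the conditional expectation of \<open>U v\<close> onto
  \<open>P\<close>, and one would like to multiply such elements. Only its image at
  \<open>Om\<close> is at hand, a vector not known to come from a bounded operator, so products are
  never formed. \<open>exchange\<close> replaces them: an element of \<open>P\<close> is moved back
  and forth across one inner product, trading \<open>U v Om\<close> for \<open>eta v\<close> and
  \<open>eta w\<close> for \<open>U w Om\<close>, and the limit involves vectors only. The right
  translation \<open>k\<close> and the index \<open>w\<close> in it are free; beyond the supports,
  all information on the coefficients comes from choosing them so that two supports meet in one
  frame vector or in none. The same obstacle shapes the final step. Operators \<open>a n\<close>
  with \<open>a n Om\<close> convergent have no known common norm bound and are controlled on frame
  vectors only, so membership in \<open>P\<close> is tested on matrix coefficients against the
  commutant of \<open>P\<close>, with \<open>J\<close> controlling the adjoints. Haar measure enters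
  only when the abstract frame is realised, through the vanishing of the integrals of nontrivial
  characters and the uniqueness of Fourier coefficients.\<close>

definition hsub :: "'h hilbert \<Rightarrow> 'h \<Rightarrow> 'h \<Rightarrow> 'h" where
  "hsub H x y = hadd H x (hscale H (-1) y)"

definition hnsq :: "'h hilbert \<Rightarrow> 'h \<Rightarrow> real" where
  "hnsq H x = Re (hinner H x x)"

definition hlim :: "'h hilbert \<Rightarrow> (nat \<Rightarrow> 'h) \<Rightarrow> 'h \<Rightarrow> bool" where
  "hlim H X x \<longleftrightarrow> (\<lambda>n. hnsq H (hsub H (X n) x)) \<longlonglongrightarrow> 0"

text \<open>Extensionality through inner products (\<open>inner_ext\<close>) stands in for the
  vector space axioms: a linear identity is proved by pairing both sides with an arbitrary vector.
  Convergence is phrased with the squared norm, so estimates stay polynomial, and the factor 2 in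
  \<open>nsq_add_le\<close> replaces Minkowski's inequality.\<close>

locale hilbert_space =
  fixes H :: "'h hilbert"
  assumes carrier_nonempty: "carrier H \<noteq> {}"
    and add_closed [simp, intro]: "x \<in> carrier H \<Longrightarrow> y \<in> carrier H \<Longrightarrow> hadd H x y \<in> carrier H"
    and scale_closed [simp, intro]: "x \<in> carrier H \<Longrightarrow> hscale H c x \<in> carrier H"
    and inner_add_left [simp]: "x \<in> carrier H \<Longrightarrow> y \<in> carrier H \<Longrightarrow> z \<in> carrier H \<Longrightarrow>
      hinner H (hadd H x y) z = hinner H x z + hinner H y z"
    and inner_scale_left [simp]: "x \<in> carrier H \<Longrightarrow> y \<in> carrier H \<Longrightarrow>
      hinner H (hscale H c x) y = c * hinner H x y"
    and inner_commute: "x \<in> carrier H \<Longrightarrow> y \<in> carrier H \<Longrightarrow> hinner H y x = cnj (hinner H x y)"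
    and nsq_nonneg: "x \<in> carrier H \<Longrightarrow> 0 \<le> hnsq H x"
    and inner_ext: "x \<in> carrier H \<Longrightarrow> y \<in> carrier H \<Longrightarrow>
      (\<And>z. z \<in> carrier H \<Longrightarrow> hinner H x z = hinner H y z) \<Longrightarrow> x = y"
    and complete: "(\<And>n. X n \<in> carrier H) \<Longrightarrow>
      (\<And>e. 0 < e \<Longrightarrow> \<exists>N. \<forall>m\<ge>N. \<forall>n\<ge>N. hnsq H (hsub H (X m) (X n)) < e) \<Longrightarrow>
      \<exists>x\<in>carrier H. hlim H X x"
begin

lemma inner_add_right [simp]:
  assumes "x \<in> carrier H" "y \<in> carrier H" "z \<in> carrier H"
  shows "hinner H z (hadd H x y) = hinner H z x + hinner H z y"
  using assms inner_commute[of z "hadd H x y"] inner_commute[of x z] inner_commute[of y z]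
    inner_commute[of "hadd H x y" z] by simp

lemma inner_scale_right [simp]:
  assumes "x \<in> carrier H" "y \<in> carrier H"
  shows "hinner H y (hscale H c x) = cnj c * hinner H y x"
  using assms inner_commute[of "hscale H c x" y] inner_commute[of x y] by simp

lemma sub_closed [simp, intro]: "x \<in> carrier H \<Longrightarrow> y \<in> carrier H \<Longrightarrow> hsub H x y \<in> carrier H"
  by (simp add: hsub_def)

lemma inner_sub_left [simp]:
  "x \<in> carrier H \<Longrightarrow> y \<in> carrier H \<Longrightarrow> z \<in> carrier H \<Longrightarrow>
   hinner H (hsub H x y) z = hinner H x z - hinner H y z"
  by (simp add: hsub_def)

lemma inner_sub_right [simp]:
  "x \<in> carrier H \<Longrightarrow> y \<in> carrier H \<Longrightarrow> z \<in> carrier H \<Longrightarrow>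
   hinner H z (hsub H x y) = hinner H z x - hinner H z y"
  by (simp add: hsub_def)

lemma inner_self: "x \<in> carrier H \<Longrightarrow> hinner H x x = of_real (hnsq H x)"
  using inner_commute[of x x] by (simp add: hnsq_def complex_eq_iff)

lemma Re_inner_commute: "x \<in> carrier H \<Longrightarrow> y \<in> carrier H \<Longrightarrow> Re (hinner H y x) = Re (hinner H x y)"
  using inner_commute[of x y] by simp

lemma cmod_inner_commute: "x \<in> carrier H \<Longrightarrow> y \<in> carrier H \<Longrightarrow> cmod (hinner H y x) = cmod (hinner H x y)"
  using inner_commute[of x y] by simp

lemma nsq_add:
  "x \<in> carrier H \<Longrightarrow> y \<in> carrier H \<Longrightarrow>
   hnsq H (hadd H x y) = hnsq H x + hnsq H y + 2 * Re (hinner H x y)"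
  using Re_inner_commute[of x y] by (simp add: hnsq_def)

lemma nsq_scale: "x \<in> carrier H \<Longrightarrow> hnsq H (hscale H c x) = (cmod c)\<^sup>2 * hnsq H x"
  using inner_self[of x]
  by (simp add: hnsq_def cmod_power2) (simp add: power2_eq_square algebra_simps)

lemma nsq_sub:
  "x \<in> carrier H \<Longrightarrow> y \<in> carrier H \<Longrightarrow>
   hnsq H (hsub H x y) = hnsq H x + hnsq H y - 2 * Re (hinner H x y)"
  by (simp add: hsub_def nsq_add nsq_scale)

lemma Cauchy_Schwarz:
  assumes x: "x \<in> carrier H" and y: "y \<in> carrier H"
  shows "(cmod (hinner H x y))\<^sup>2 \<le> hnsq H x * hnsq H y"
proof -
  define c where "c = hinner H x y"
  have quad: "0 \<le> hnsq H x * s\<^sup>2 * (cmod c)\<^sup>2 + hnsq H y - 2 * s * (cmod c)\<^sup>2" for s :: real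
  proof -
    let ?t = "- of_real s * cnj c"
    have "Re (?t * c) = - s * (cmod c)\<^sup>2"
      unfolding cmod_power2 by (simp add: power2_eq_square algebra_simps)
    moreover have "0 \<le> hnsq H (hadd H (hscale H ?t x) y)"
      using x y by (intro nsq_nonneg) auto
    moreover have "(cmod ?t)\<^sup>2 = s\<^sup>2 * (cmod c)\<^sup>2"
      by (simp add: norm_mult power_mult_distrib)
    ultimately show ?thesis
      using x y by (simp add: nsq_add nsq_scale c_def[symmetric] algebra_simps)
  qed
  show ?thesis
  proof (cases "hnsq H x = 0")
    case True
    have "c = 0"
    proof (rule ccontr)
      assume "c \<noteq> 0"
      then have "(cmod c)\<^sup>2 > 0" by simp
      \<comment> \<open>With \<open>hnsq H x = 0\<close> the quadratic is linear in
        \<open>s\<close>; this \<open>s\<close> gives it the value -1.\<close>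
      then show False
        using quad[of "(hnsq H y + 1) / (2 * (cmod c)\<^sup>2)"] True by simp
    qed
    then show ?thesis using True by (simp add: c_def)
  next
    case False
    then have pos: "hnsq H x > 0" using nsq_nonneg[OF x] by simp
    have "0 \<le> hnsq H x * (1 / hnsq H x)\<^sup>2 * (cmod c)\<^sup>2 + hnsq H y - 2 * (1 / hnsq H x) * (cmod c)\<^sup>2"
      by (rule quad)
    also have "\<dots> = hnsq H y - (cmod c)\<^sup>2 / hnsq H x"
      using pos by (simp add: power2_eq_square field_simps)
    finally show ?thesis using pos by (simp add: c_def field_simps)
  qed
qed

lemma cmod_inner_le:
  assumes "x \<in> carrier H" "y \<in> carrier H"
  shows "cmod (hinner H x y) \<le> sqrt (hnsq H x) * sqrt (hnsq H y)"
  using Cauchy_Schwarz[OF assms] by (metis real_le_rsqrt real_sqrt_mult)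

lemma nsq_zero_inner:
  assumes "x \<in> carrier H" "y \<in> carrier H" "hnsq H x = 0"
  shows "hinner H x y = 0"
  using Cauchy_Schwarz[of x y] assms by simp

lemma nsq_add_le:
  assumes "x \<in> carrier H" "y \<in> carrier H"
  shows "hnsq H (hadd H x y) \<le> 2 * hnsq H x + 2 * hnsq H y"
proof -
  have "0 \<le> hnsq H (hsub H x y)" using assms by (intro nsq_nonneg) auto
  then show ?thesis using assms by (simp add: nsq_add nsq_sub)
qed

lemma nsq_sub_eq_0:
  assumes x: "x \<in> carrier H" and y: "y \<in> carrier H" and 0: "hnsq H (hsub H x y) = 0"
  shows "x = y"
proof (rule inner_ext[OF x y])
  fix z assume "z \<in> carrier H"
  then show "hinner H x z = hinner H y z"
    using nsq_zero_inner[of "hsub H x y" z] x y 0 by simp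
qed

lemma nsq_sub_triangle:
  assumes "x \<in> carrier H" "y \<in> carrier H" "z \<in> carrier H"
  shows "hnsq H (hsub H x z) \<le> 2 * hnsq H (hsub H x y) + 2 * hnsq H (hsub H y z)"
proof -
  have "hsub H x z = hadd H (hsub H x y) (hsub H y z)"
    using assms by (intro inner_ext) auto
  then show ?thesis using nsq_add_le[of "hsub H x y" "hsub H y z"] assms by simp
qed

lemma hlim_const: "x \<in> carrier H \<Longrightarrow> hlim H (\<lambda>n. x) x"
  by (simp add: hlim_def nsq_sub) (simp add: hnsq_def)

lemma hlim_inner:
  assumes x: "x \<in> carrier H" and y: "y \<in> carrier H" and X: "\<And>n. X n \<in> carrier H"
    and lim: "hlim H X x"
  shows "(\<lambda>n. hinner H (X n) y) \<longlonglongrightarrow> hinner H x y"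
proof -
  have "(\<lambda>n. sqrt (hnsq H (hsub H (X n) x)) * sqrt (hnsq H y)) \<longlonglongrightarrow> sqrt 0 * sqrt (hnsq H y)"
    using lim unfolding hlim_def by (intro tendsto_intros)
  then have "(\<lambda>n. sqrt (hnsq H (hsub H (X n) x)) * sqrt (hnsq H y)) \<longlonglongrightarrow> 0"
    by simp
  then have "(\<lambda>n. hinner H (X n) y - hinner H x y) \<longlonglongrightarrow> 0"
  proof (rule Lim_null_comparison[rotated], intro always_eventually allI)
    fix n
    show "norm (hinner H (X n) y - hinner H x y) \<le> sqrt (hnsq H (hsub H (X n) x)) * sqrt (hnsq H y)"
      using cmod_inner_le[of "hsub H (X n) x" y] x y X by simp
  qed
  then show ?thesis by (simp add: LIM_zero_iff)
qed

lemma hlim_inner_right: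
  assumes x: "x \<in> carrier H" and y: "y \<in> carrier H" and X: "\<And>n. X n \<in> carrier H"
    and lim: "hlim H X x"
  shows "(\<lambda>n. hinner H y (X n)) \<longlonglongrightarrow> hinner H y x"
proof -
  have "(\<lambda>n. cnj (hinner H (X n) y)) \<longlonglongrightarrow> cnj (hinner H x y)"
    using hlim_inner[OF assms] by (rule tendsto_cnj)
  then show ?thesis using inner_commute[OF _ y] x X by simp
qed

lemma hlim_nsq:
  assumes x: "x \<in> carrier H" and X: "\<And>n. X n \<in> carrier H" and lim: "hlim H X x"
  shows "(\<lambda>n. hnsq H (X n)) \<longlonglongrightarrow> hnsq H x"
proof -
  have "(\<lambda>n. hnsq H (hsub H (X n) x) - hnsq H x + 2 * Re (hinner H (X n) x))
     \<longlonglongrightarrow> 0 - hnsq H x + 2 * Re (hinner H x x)"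
    using lim hlim_inner[OF x x X lim] unfolding hlim_def by (intro tendsto_intros)
  then show ?thesis using x X by (simp add: nsq_sub hnsq_def[of H x])
qed

lemma hlim_add:
  assumes "x \<in> carrier H" "y \<in> carrier H" "\<And>n. X n \<in> carrier H" "\<And>n. Y n \<in> carrier H"
    and "hlim H X x" "hlim H Y y"
  shows "hlim H (\<lambda>n. hadd H (X n) (Y n)) (hadd H x y)"
  unfolding hlim_def
proof (rule Lim_null_comparison)
  show "(\<lambda>n. 2 * hnsq H (hsub H (X n) x) + 2 * hnsq H (hsub H (Y n) y)) \<longlonglongrightarrow> 0"
    using tendsto_add[OF tendsto_mult_left[of _ 0 _ 2] tendsto_mult_left[of _ 0 _ 2]] assms(5,6)
    unfolding hlim_def by fastforce
  have "hnsq H (hsub H (hadd H (X n) (Y n)) (hadd H x y)) \<le> 2 * hnsq H (hsub H (X n) x) + 2 * hnsq H (hsub H (Y n) y)" for n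
  proof -
    have "hsub H (hadd H (X n) (Y n)) (hadd H x y) = hadd H (hsub H (X n) x) (hsub H (Y n) y)"
      using assms by (intro inner_ext) auto
    then show ?thesis using nsq_add_le assms by simp
  qed
  then show "\<forall>\<^sub>F n in sequentially. norm (hnsq H (hsub H (hadd H (X n) (Y n)) (hadd H x y)))
      \<le> 2 * hnsq H (hsub H (X n) x) + 2 * hnsq H (hsub H (Y n) y)"
    using nsq_nonneg assms by (intro always_eventually) (simp add: abs_of_nonneg)
qed

lemma hlim_scale:
  assumes "x \<in> carrier H" "\<And>n. X n \<in> carrier H" and "hlim H X x"
  shows "hlim H (\<lambda>n. hscale H c (X n)) (hscale H c x)"
proof -
  have "hsub H (hscale H c (X n)) (hscale H c x) = hscale H c (hsub H (X n) x)" for n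
    using assms by (intro inner_ext) (auto simp: algebra_simps)
  then have "hnsq H (hsub H (hscale H c (X n)) (hscale H c x)) = (cmod c)\<^sup>2 * hnsq H (hsub H (X n) x)" for n
    using assms by (simp add: nsq_scale)
  then show ?thesis
    using assms(3) tendsto_mult_left[of _ 0 _ "(cmod c)\<^sup>2"] unfolding hlim_def by simp
qed

subsection \<open>Closed subspaces and projections\<close>

definition subspc :: "'h set \<Rightarrow> bool" where
  "subspc K \<longleftrightarrow> K \<noteq> {} \<and> K \<subseteq> carrier H \<and> (\<forall>x\<in>K. \<forall>y\<in>K. hadd H x y \<in> K) \<and> (\<forall>c. \<forall>x\<in>K. hscale H c x \<in> K)"

definition hclosed :: "'h set \<Rightarrow> bool" where
  "hclosed K \<longleftrightarrow> (\<forall>X x. (\<forall>n. X n \<in> K) \<longrightarrow> x \<in> carrier H \<longrightarrow> hlim H X x \<longrightarrow> x \<in> K)"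

definition hcl :: "'h set \<Rightarrow> 'h set" where
  "hcl V = {x \<in> carrier H. \<exists>X. (\<forall>n. X n \<in> V) \<and> hlim H X x}"

lemma subspc_sub: "subspc K \<Longrightarrow> x \<in> K \<Longrightarrow> y \<in> K \<Longrightarrow> hsub H x y \<in> K"
  unfolding subspc_def hsub_def by blast

lemma subset_hcl: "V \<subseteq> carrier H \<Longrightarrow> V \<subseteq> hcl V"
proof
  fix x assume "V \<subseteq> carrier H" "x \<in> V"
  then show "x \<in> hcl V"
    unfolding hcl_def mem_Collect_eq by (intro conjI exI[of _ "\<lambda>n. x"] allI hlim_const) blast+
qed

text \<open>Diagonal choice: \<open>X n\<close> is a limit of members of \<open>V\<close>, so one of
  them lies within squared distance \<open>1 / Suc n\<close> of it, and these members converge to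
  \<open>x\<close>.\<close>

lemma hclosed_hcl:
  assumes V: "V \<subseteq> carrier H"
  shows "hclosed (hcl V)"
  unfolding hclosed_def
proof (intro allI impI)
  fix X x assume X: "\<forall>n. X n \<in> hcl V" and x: "x \<in> carrier H" and lim: "hlim H X x"
  have "\<exists>v\<in>V. hnsq H (hsub H v (X n)) < 1 / Suc n" for n
  proof -
    obtain Y where Y: "\<forall>k. Y k \<in> V" "hlim H Y (X n)" using X unfolding hcl_def by blast
    have "\<forall>\<^sub>F k in sequentially. hnsq H (hsub H (Y k) (X n)) < 1 / Suc n"
      using Y(2)[unfolded hlim_def] by (rule order_tendstoD) simp
    then show ?thesis using Y(1) unfolding eventually_sequentially by blast
  qed
  then obtain v where v: "\<And>n. v n \<in> V" "\<And>n. hnsq H (hsub H (v n) (X n)) < 1 / Suc n"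
    by metis
  have Xc: "X n \<in> carrier H" "v n \<in> carrier H" for n using X v V unfolding hcl_def by auto
  have "hlim H v x"
    unfolding hlim_def
  proof (rule Lim_null_comparison)
    have "(\<lambda>n. 2 * (1 / real (Suc n)) + 2 * hnsq H (hsub H (X n) x)) \<longlonglongrightarrow> 2 * 0 + 2 * 0"
      using lim unfolding hlim_def by (intro tendsto_intros LIMSEQ_Suc[OF lim_1_over_n])
    then show "(\<lambda>n. 2 * (1 / real (Suc n)) + 2 * hnsq H (hsub H (X n) x)) \<longlonglongrightarrow> 0" by simp
    have "hnsq H (hsub H (v n) x) \<le> 2 * (1 / real (Suc n)) + 2 * hnsq H (hsub H (X n) x)" for n
      using nsq_sub_triangle[of "v n" "X n" x] v(2)[of n] Xc x by fastforce
    then show "\<forall>\<^sub>F n in sequentially. norm (hnsq H (hsub H (v n) x)) \<le> 2 * (1 / real (Suc n)) + 2 * hnsq H (hsub H (X n) x)"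
      using nsq_nonneg Xc x by (intro always_eventually) (simp add: abs_of_nonneg)
  qed
  then show "x \<in> hcl V" using v(1) x unfolding hcl_def by blast
qed

lemma subspc_hcl:
  assumes V: "subspc V"
  shows "subspc (hcl V)"
proof -
  have sub: "V \<subseteq> carrier H" using V unfolding subspc_def by blast
  have Vadd: "hadd H u v \<in> V" if "u \<in> V" "v \<in> V" for u v using V that unfolding subspc_def by blast
  have Vscale: "hscale H c u \<in> V" if "u \<in> V" for u c using V that unfolding subspc_def by blast
  have Vc: "v \<in> carrier H" if "v \<in> V" for v using sub that by blast
  show ?thesis
    unfolding subspc_def
  proof (intro conjI ballI allI)
    obtain v where "v \<in> V" using V unfolding subspc_def by blast
    then show "hcl V \<noteq> {}" using subset_hcl[OF sub] by blast
    show "hcl V \<subseteq> carrier H" unfolding hcl_def by blast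
  next
    fix x y assume xy: "x \<in> hcl V" "y \<in> hcl V"
    obtain X where X: "\<forall>n. X n \<in> V" "hlim H X x" using xy(1) unfolding hcl_def by auto
    obtain Y where Y: "\<forall>n. Y n \<in> V" "hlim H Y y" using xy(2) unfolding hcl_def by auto
    have c: "x \<in> carrier H" "y \<in> carrier H" using xy unfolding hcl_def by auto
    have "hlim H (\<lambda>n. hadd H (X n) (Y n)) (hadd H x y)"
      using X Y Vc c by (intro hlim_add) blast+
    moreover have "\<forall>n. hadd H (X n) (Y n) \<in> V" using X Y Vadd by blast
    ultimately show "hadd H x y \<in> hcl V"
      using c unfolding hcl_def mem_Collect_eq by (intro conjI exI[of _ "\<lambda>n. hadd H (X n) (Y n)"]) simp_all
  next
    fix c x assume x: "x \<in> hcl V"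
    obtain X where X: "\<forall>n. X n \<in> V" "hlim H X x" using x unfolding hcl_def by auto
    have xc: "x \<in> carrier H" using x unfolding hcl_def by auto
    have "hlim H (\<lambda>n. hscale H c (X n)) (hscale H c x)"
      using X Vc xc by (intro hlim_scale) blast+
    moreover have "\<forall>n. hscale H c (X n) \<in> V" using X Vscale by blast
    ultimately show "hscale H c x \<in> hcl V"
      using xc unfolding hcl_def mem_Collect_eq by (intro conjI exI[of _ "\<lambda>n. hscale H c (X n)"]) simp_all
  qed
qed

lemma inner_hcl_zero:
  assumes "V \<subseteq> carrier H" "y \<in> carrier H" "\<And>v. v \<in> V \<Longrightarrow> hinner H y v = 0" "x \<in> hcl V"
  shows "hinner H y x = 0"
proof -
  obtain X where X: "\<forall>n. X n \<in> V" "hlim H X x" and x: "x \<in> carrier H"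
    using assms(4) unfolding hcl_def by auto
  have "(\<lambda>n. hinner H y (X n)) \<longlonglongrightarrow> hinner H y x"
    using X x assms(1,2) by (intro hlim_inner_right) blast+
  moreover have "hinner H y (X n) = 0" for n using X assms(3) by blast
  ultimately show ?thesis by (simp add: LIMSEQ_const_iff)
qed

text \<open>The representing vector is the minimiser of \<open>hnsq H x - 2 * Re (f x)\<close> over
  \<open>K\<close>. Working on a closed subspace yields orthogonal projections as well as, on the
  whole carrier, adjoints.\<close>

theorem Riesz_representation:
  assumes K: "subspc K" "hclosed K"
    and add: "\<And>x y. x \<in> K \<Longrightarrow> y \<in> K \<Longrightarrow> f (hadd H x y) = f x + f y"
    and scale: "\<And>c x. x \<in> K \<Longrightarrow> f (hscale H c x) = c * f x"
    and bdd: "\<And>x. x \<in> K \<Longrightarrow> cmod (f x) \<le> B * sqrt (hnsq H x)"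
  shows "\<exists>y\<in>K. \<forall>x\<in>K. f x = hinner H x y"
proof -
  have Kc: "x \<in> K \<Longrightarrow> x \<in> carrier H" for x using K by (auto simp: subspc_def)
  have Kadd: "x \<in> K \<Longrightarrow> y \<in> K \<Longrightarrow> hadd H x y \<in> K" and Kscale: "x \<in> K \<Longrightarrow> hscale H c x \<in> K" for x y c
    using K by (auto simp: subspc_def)
  define F where "F x = hnsq H x - 2 * Re (f x)" for x
  have F_lower: "- B\<^sup>2 \<le> F x" if "x \<in> K" for x
  proof -
    have "Re (f x) \<le> B * sqrt (hnsq H x)" using bdd[OF that] complex_Re_le_cmod[of "f x"] by linarith
    moreover have "(sqrt (hnsq H x))\<^sup>2 = hnsq H x" using nsq_nonneg Kc that by simp
    moreover have "0 \<le> (sqrt (hnsq H x) - B)\<^sup>2" by simp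
    ultimately show ?thesis unfolding F_def power2_diff by (simp add: algebra_simps)
  qed
  define m where "m = Inf (F ` K)"
  have bb: "bdd_below (F ` K)" using F_lower by (auto simp: bdd_below_def)
  have m_le: "m \<le> F x" if "x \<in> K" for x
    unfolding m_def using that bb by (intro cInf_lower) auto
  have "\<exists>x\<in>K. F x < m + 1 / Suc n" for n
  proof -
    have "Inf (F ` K) < m + 1 / Suc n" by (simp add: m_def)
    then show ?thesis using cInf_less_iff[of "F ` K"] bb K(1) by (auto simp: subspc_def)
  qed
  then obtain X where X: "\<And>n. X n \<in> K" "\<And>n. F (X n) < m + 1 / Suc n" by metis
  \<comment> \<open>Parallelogram argument: the midpoint of \<open>X i\<close> and
    \<open>X j\<close> also has \<open>F\<close> at least \<open>m\<close>, while both ends are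
    nearly minimal.\<close>
  have par: "hnsq H (hsub H (X i) (X j)) \<le> 2 / Suc i + 2 / Suc j" for i j
  proof -
    let ?h = "hscale H (1/2) (hadd H (X i) (X j))"
    have "?h \<in> K" using X Kadd Kscale by blast
    then have "m \<le> F ?h" by (rule m_le)
    also have "F ?h = (hnsq H (X i) + hnsq H (X j) + 2 * Re (hinner H (X i) (X j))) / 4 - Re (f (X i)) - Re (f (X j))"
      using X Kadd Kc add scale by (simp add: F_def nsq_scale nsq_add power2_eq_square diff_divide_distrib add_divide_distrib)
    finally have le: "m \<le> (hnsq H (X i) + hnsq H (X j) + 2 * Re (hinner H (X i) (X j))) / 4 - Re (f (X i)) - Re (f (X j))" .
    have "4 * m \<le> u + v + 2 * w - 4 * r - 4 * s" if "m \<le> (u + v + 2 * w) / 4 - r - s" for u v w r s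
      using that by (simp add: field_simps)
    from this[OF le] have "4 * m \<le> hnsq H (X i) + hnsq H (X j) + 2 * Re (hinner H (X i) (X j)) - 4 * Re (f (X i)) - 4 * Re (f (X j))" .
    moreover have "hnsq H (X i) - 2 * Re (f (X i)) < m + (1 / 2) * (2 / Suc i)"
      "hnsq H (X j) - 2 * Re (f (X j)) < m + (1 / 2) * (2 / Suc j)"
      using X(2)[of i] X(2)[of j] by (simp_all add: F_def)
    moreover have "hnsq H (hsub H (X i) (X j)) = hnsq H (X i) + hnsq H (X j) - 2 * Re (hinner H (X i) (X j))"
      using X(1) Kc by (simp add: nsq_sub)
    ultimately show ?thesis by linarith
  qed
  have "\<exists>N. \<forall>i\<ge>N. \<forall>j\<ge>N. hnsq H (hsub H (X i) (X j)) < e" if e: "0 < e" for e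
  proof -
    obtain N :: nat where N: "4 / e < real N" using reals_Archimedean2 by blast
    have N0: "real N > 0" using N e by (smt (verit) divide_pos_pos)
    have "hnsq H (hsub H (X i) (X j)) < e" if "i \<ge> N" "j \<ge> N" for i j
    proof -
      have "2 / real (Suc i) \<le> 2 / real (Suc N)" "2 / real (Suc j) \<le> 2 / real (Suc N)"
        using that by (auto intro!: divide_left_mono)
      moreover have "2 / real (Suc N) < e / 2" using N e N0 by (simp add: field_simps)
      ultimately show ?thesis using par[of i j] by linarith
    qed
    then show ?thesis by blast
  qed
  then obtain y where y: "y \<in> carrier H" "hlim H X y" using complete[of X] X Kc by blast
  have yK: "y \<in> K" using K(2) X(1) y unfolding hclosed_def by blast
  have sub: "f (hsub H u v) = f u - f v" if "u \<in> K" "v \<in> K" for u v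
    using that add scale Kscale by (simp add: hsub_def)
  have f_lim: "(\<lambda>n. f (X n)) \<longlonglongrightarrow> f y"
  proof -
    have "(\<lambda>n. B * sqrt (hnsq H (hsub H (X n) y))) \<longlonglongrightarrow> B * sqrt 0"
      using y(2) unfolding hlim_def by (intro tendsto_intros)
    then have "(\<lambda>n. B * sqrt (hnsq H (hsub H (X n) y))) \<longlonglongrightarrow> 0" by simp
    then have "(\<lambda>n. f (X n) - f y) \<longlonglongrightarrow> 0"
    proof (rule Lim_null_comparison[rotated], intro always_eventually allI)
      fix n show "norm (f (X n) - f y) \<le> B * sqrt (hnsq H (hsub H (X n) y))"
        using bdd[of "hsub H (X n) y"] sub[of "X n" y] X(1) yK subspc_sub[OF K(1)] by simp
    qed
    then show ?thesis by (simp add: LIM_zero_iff)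
  qed
  have "(\<lambda>n. F (X n)) \<longlonglongrightarrow> F y"
    unfolding F_def using hlim_nsq[OF y(1) _ y(2)] X Kc f_lim by (intro tendsto_intros) auto
  moreover have "(\<lambda>n. m + 1 / real (Suc n)) \<longlonglongrightarrow> m + 0"
    by (intro tendsto_intros LIMSEQ_Suc[OF lim_1_over_n])
  ultimately have "F y \<le> m + 0"
    using X(2) by (intro LIMSEQ_le[of "\<lambda>n. F (X n)" _ "\<lambda>n. m + 1 / real (Suc n)"]) (auto intro: less_imp_le)
  then have Fy: "F y \<le> F z" if "z \<in> K" for z using m_le[OF that] by simp
  have "f x = hinner H x y" if x: "x \<in> K" for x
  proof -
    \<comment> \<open>Moving \<open>y\<close> along \<open>x\<close> by \<open>t\<close> changes
      \<open>F\<close> to first order by \<open>-2 s |d|^2\<close>; this \<open>s\<close> keeps the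
      second-order term at most half of that, so minimality forces \<open>d = 0\<close>.\<close>
    define d where "d = hinner H x y - f x"
    define s where "s = 1 / (hnsq H x + 1)"
    let ?t = "- of_real s * cnj d"
    have n0: "0 \<le> hnsq H x" using x Kc nsq_nonneg by blast
    have s: "0 < s" "s * hnsq H x \<le> 1" using n0 by (auto simp: s_def field_simps)
    have "F y \<le> F (hadd H y (hscale H ?t x))" using x yK Kadd Kscale by (intro Fy) auto
    also have "\<dots> = F y + (cmod ?t)\<^sup>2 * hnsq H x + 2 * Re (?t * d)"
    proof -
      have "Re (hinner H y (hscale H ?t x)) = Re (?t * hinner H x y)"
        using x Kc y Re_inner_commute[of y "hscale H ?t x"] by simp
      then show ?thesis
        using x Kc y yK add scale Kscale by (simp add: F_def nsq_add nsq_scale d_def algebra_simps)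
    qed
    also have "(cmod ?t)\<^sup>2 = s\<^sup>2 * (cmod d)\<^sup>2" by (simp add: norm_mult power_mult_distrib)
    also have "Re (?t * d) = - s * (cmod d)\<^sup>2"
      unfolding cmod_power2 by (simp add: power2_eq_square algebra_simps)
    finally have "0 \<le> s * (cmod d)\<^sup>2 * (s * hnsq H x - 2)" by (simp add: power2_eq_square algebra_simps)
    then have "(cmod d)\<^sup>2 \<le> 0" using s by (smt (verit) mult_pos_neg zero_less_mult_iff)
    then show ?thesis by (simp add: d_def)
  qed
  then show ?thesis using yK by blast
qed

text \<open>The value \<open>undefined\<close> off the carrier makes a projection extensional, as
  membership in \<open>bounded_ops\<close> demands.\<close>

definition proj :: "'h set \<Rightarrow> 'h \<Rightarrow> 'h" where
  "proj K x = (if x \<in> carrier H then SOME y. y \<in> K \<and> (\<forall>z\<in>K. hinner H z y = hinner H z x) else undefined)"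

lemma proj_exists:
  assumes K: "subspc K" "hclosed K" and x: "x \<in> carrier H"
  shows "\<exists>y\<in>K. \<forall>z\<in>K. hinner H z x = hinner H z y"
proof (rule Riesz_representation[OF K, where B = "sqrt (hnsq H x)"])
  have Kc: "z \<in> K \<Longrightarrow> z \<in> carrier H" for z using K by (auto simp: subspc_def)
  show "cmod (hinner H z x) \<le> sqrt (hnsq H x) * sqrt (hnsq H z)" if "z \<in> K" for z
    using cmod_inner_le[of z x] that Kc x by (simp add: mult.commute)
qed (use K x in \<open>auto simp: subspc_def subset_iff\<close>)

lemma proj_in: "subspc K \<Longrightarrow> hclosed K \<Longrightarrow> x \<in> carrier H \<Longrightarrow> proj K x \<in> K"
  and proj_inner: "subspc K \<Longrightarrow> hclosed K \<Longrightarrow> x \<in> carrier H \<Longrightarrow> z \<in> K \<Longrightarrow> hinner H z (proj K x) = hinner H z x"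
proof -
  have *: "proj K x \<in> K \<and> (\<forall>z\<in>K. hinner H z (proj K x) = hinner H z x)"
    if "subspc K" "hclosed K" "x \<in> carrier H"
  proof -
    have "\<exists>y. y \<in> K \<and> (\<forall>z\<in>K. hinner H z y = hinner H z x)"
      using proj_exists[OF that] by force
    from someI_ex[OF this] show ?thesis using that(3) by (simp add: proj_def)
  qed
  show "subspc K \<Longrightarrow> hclosed K \<Longrightarrow> x \<in> carrier H \<Longrightarrow> proj K x \<in> K" using * by blast
  show "subspc K \<Longrightarrow> hclosed K \<Longrightarrow> x \<in> carrier H \<Longrightarrow> z \<in> K \<Longrightarrow> hinner H z (proj K x) = hinner H z x"
    using * by blast
qed

lemma proj_carrier: "subspc K \<Longrightarrow> hclosed K \<Longrightarrow> x \<in> carrier H \<Longrightarrow> proj K x \<in> carrier H"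
  using proj_in[of K x] by (auto simp: subspc_def)

lemma proj_inner': 
  assumes "subspc K" "hclosed K" "x \<in> carrier H" "z \<in> K"
  shows "hinner H (proj K x) z = hinner H x z"
  using proj_inner[OF assms] inner_commute[of z "proj K x"] inner_commute[of z x] proj_carrier assms
  by (auto simp: subspc_def)

lemma proj_unique:
  assumes K: "subspc K" "hclosed K" and x: "x \<in> carrier H" and y: "y \<in> K"
    and eq: "\<And>z. z \<in> K \<Longrightarrow> hinner H z y = hinner H z x"
  shows "proj K x = y"
proof (rule nsq_sub_eq_0)
  let ?d = "hsub H (proj K x) y"
  have d: "?d \<in> K" using subspc_sub[OF K(1)] proj_in[OF K x] y by blast
  have c: "proj K x \<in> carrier H" "y \<in> carrier H" using proj_carrier[OF K x] y K by (auto simp: subspc_def)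
  show "hnsq H ?d = 0"
    unfolding hnsq_def using d c inner_sub_right[of "proj K x" y ?d] eq[OF d] proj_inner[OF K x d] by simp
  show "proj K x \<in> carrier H" "y \<in> carrier H" using c by auto
qed

lemma proj_id: "subspc K \<Longrightarrow> hclosed K \<Longrightarrow> x \<in> K \<Longrightarrow> proj K x = x"
  using proj_unique[of K x x] by (auto simp: subspc_def)

lemma nsq_proj_le:
  assumes K: "subspc K" "hclosed K" and x: "x \<in> carrier H"
  shows "hnsq H (proj K x) \<le> hnsq H x"
proof -
  let ?p = "proj K x"
  have c: "?p \<in> carrier H" using proj_carrier[OF K x] .
  have 2: "hinner H x ?p = hinner H ?p ?p" by (rule proj_inner'[OF K x proj_in[OF K x], symmetric])
  have "0 \<le> hnsq H (hsub H x ?p)" using x c by (intro nsq_nonneg) auto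
  then show ?thesis using x c 2 by (simp add: nsq_sub) (simp add: hnsq_def)
qed

subsection \<open>Bounded operators\<close>

lemma bounded_opsI:
  assumes "T \<in> carrier H \<rightarrow>\<^sub>E carrier H"
    and "\<And>x y. x \<in> carrier H \<Longrightarrow> y \<in> carrier H \<Longrightarrow> T (hadd H x y) = hadd H (T x) (T y)"
    and "\<And>c x. x \<in> carrier H \<Longrightarrow> T (hscale H c x) = hscale H c (T x)"
    and "\<And>x. x \<in> carrier H \<Longrightarrow> hnsq H (T x) \<le> B\<^sup>2 * hnsq H x"
  shows "T \<in> bounded_ops H"
proof -
  have "hnorm H (T x) \<le> \<bar>B\<bar> * hnorm H x" if "x \<in> carrier H" for x
    using assms(4)[OF that] unfolding hnorm_def hnsq_def
    by (metis real_sqrt_abs real_sqrt_le_mono real_sqrt_mult)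
  then show ?thesis using assms unfolding bounded_ops_def by blast
qed

lemma bounded_ops_carrier [simp]: "T \<in> bounded_ops H \<Longrightarrow> x \<in> carrier H \<Longrightarrow> T x \<in> carrier H"
  unfolding bounded_ops_def by auto

lemma bounded_ops_add: "T \<in> bounded_ops H \<Longrightarrow> x \<in> carrier H \<Longrightarrow> y \<in> carrier H \<Longrightarrow> T (hadd H x y) = hadd H (T x) (T y)"
  and bounded_ops_scale: "T \<in> bounded_ops H \<Longrightarrow> x \<in> carrier H \<Longrightarrow> T (hscale H c x) = hscale H c (T x)"
  unfolding bounded_ops_def by auto

lemma bounded_ops_sub:
  "T \<in> bounded_ops H \<Longrightarrow> x \<in> carrier H \<Longrightarrow> y \<in> carrier H \<Longrightarrow> T (hsub H x y) = hsub H (T x) (T y)"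
  unfolding hsub_def by (simp add: bounded_ops_add bounded_ops_scale)

lemma bounded_ops_bound:
  assumes "T \<in> bounded_ops H"
  obtains B where "B \<ge> 0" "\<And>x. x \<in> carrier H \<Longrightarrow> hnsq H (T x) \<le> B\<^sup>2 * hnsq H x"
proof -
  obtain C where C: "\<And>x. x \<in> carrier H \<Longrightarrow> hnorm H (T x) \<le> C * hnorm H x"
    using assms unfolding bounded_ops_def by blast
  have "hnsq H (T x) \<le> \<bar>C\<bar>\<^sup>2 * hnsq H x" if x: "x \<in> carrier H" for x
  proof -
    have "0 \<le> hnsq H x" "0 \<le> hnsq H (T x)" using x assms nsq_nonneg by auto
    moreover have "hnorm H (T x) \<le> \<bar>C\<bar> * hnorm H x"
      using C[OF x] \<open>0 \<le> hnsq H x\<close> unfolding hnorm_def hnsq_def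
      by (smt (verit) mult_right_mono real_sqrt_ge_zero)
    then have "(hnorm H (T x))\<^sup>2 \<le> (\<bar>C\<bar> * hnorm H x)\<^sup>2"
      by (intro power_mono) (use \<open>0 \<le> hnsq H (T x)\<close> in \<open>auto simp: hnorm_def hnsq_def\<close>)
    ultimately show ?thesis unfolding hnorm_def hnsq_def power_mult_distrib by simp
  qed
  then show ?thesis using that[of "\<bar>C\<bar>"] by simp
qed

lemma hlim_op:
  assumes T: "T \<in> bounded_ops H" and x: "x \<in> carrier H" and X: "\<And>n. X n \<in> carrier H" and lim: "hlim H X x"
  shows "hlim H (\<lambda>n. T (X n)) (T x)"
  unfolding hlim_def
proof -
  obtain B where B: "\<And>x. x \<in> carrier H \<Longrightarrow> hnsq H (T x) \<le> B\<^sup>2 * hnsq H x"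
    using bounded_ops_bound[OF T] by blast
  show "(\<lambda>n. hnsq H (hsub H (T (X n)) (T x))) \<longlonglongrightarrow> 0"
  proof (rule Lim_null_comparison)
  show "(\<lambda>n. B\<^sup>2 * hnsq H (hsub H (X n) x)) \<longlonglongrightarrow> 0"
    using lim tendsto_mult_left[of _ 0 _ "B\<^sup>2"] unfolding hlim_def by simp
  have "hnsq H (hsub H (T (X n)) (T x)) \<le> B\<^sup>2 * hnsq H (hsub H (X n) x)" for n
    using B[of "hsub H (X n) x"] T x X by (simp add: bounded_ops_sub)
  then show "\<forall>\<^sub>F n in sequentially. norm (hnsq H (hsub H (T (X n)) (T x))) \<le> B\<^sup>2 * hnsq H (hsub H (X n) x)"
    using nsq_nonneg T x X by (intro always_eventually) (simp add: abs_of_nonneg)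
  qed
qed

lemma bounded_ops_ext:
  assumes "T \<in> bounded_ops H" "S \<in> bounded_ops H" "\<And>x. x \<in> carrier H \<Longrightarrow> T x = S x"
  shows "T = S"
proof -
  have "T \<in> extensional (carrier H)" "S \<in> extensional (carrier H)"
    using assms(1,2) unfolding bounded_ops_def by (auto simp: PiE_def)
  then show ?thesis using assms(3) by (rule extensionalityI)
qed

lemma subspc_carrier: "subspc (carrier H)"
  using carrier_nonempty by (auto simp: subspc_def)

lemma hclosed_carrier: "hclosed (carrier H)"
  by (auto simp: hclosed_def)

lemma is_adjointD: "is_adjoint H T S \<Longrightarrow> x \<in> carrier H \<Longrightarrow> y \<in> carrier H \<Longrightarrow> hinner H (T x) y = hinner H x (S y)"
  unfolding is_adjoint_def by blast

lemma is_adjoint_sym: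
  assumes "T \<in> bounded_ops H" "S \<in> bounded_ops H" "is_adjoint H T S"
  shows "is_adjoint H S T"
  unfolding is_adjoint_def
proof (intro ballI)
  fix x y assume xy: "x \<in> carrier H" "y \<in> carrier H"
  show "hinner H (S x) y = hinner H x (T y)"
    using is_adjointD[OF assms(3) xy(2,1)] inner_commute[of "T y" x] inner_commute[of y "S x"] xy assms by simp
qed

lemma adjoint_unique:
  assumes "S \<in> bounded_ops H" "S' \<in> bounded_ops H" "is_adjoint H T S" "is_adjoint H T S'" "T \<in> bounded_ops H"
  shows "S = S'"
proof (rule bounded_ops_ext)
  fix x assume x: "x \<in> carrier H"
  show "S x = S' x"
  proof (rule inner_ext)
    fix z assume z: "z \<in> carrier H"
    show "hinner H (S x) z = hinner H (S' x) z"
      using is_adjointD[OF is_adjoint_sym[OF assms(5,1,3)] x z]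
        is_adjointD[OF is_adjoint_sym[OF assms(5,2,4)] x z] by simp
  qed (use assms x in auto)
qed (use assms in auto)

text \<open>\<open>S y\<close> is the Riesz vector of pairing \<open>T x\<close> with
  \<open>y\<close>. For its boundedness, pairing \<open>T (S y)\<close> with \<open>y\<close> gives
  the squared norm of \<open>S y\<close>, and Cauchy-Schwarz lets one factor
  \<open>sqrt (hnsq H (S y))\<close> cancel.\<close>

theorem adjoint_exists:
  assumes T: "T \<in> bounded_ops H"
  shows "\<exists>S\<in>bounded_ops H. is_adjoint H T S"
proof -
  obtain B where B: "B \<ge> 0" "\<And>x. x \<in> carrier H \<Longrightarrow> hnsq H (T x) \<le> B\<^sup>2 * hnsq H x"
    using bounded_ops_bound[OF T] by blast
  have B': "sqrt (hnsq H (T x)) \<le> B * sqrt (hnsq H x)" if "x \<in> carrier H" for x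
    using real_sqrt_le_mono[OF B(2)[OF that]] B(1) by (simp add: real_sqrt_mult)
  have ex: "\<exists>z\<in>carrier H. \<forall>x\<in>carrier H. hinner H (T x) y = hinner H x z" if y: "y \<in> carrier H" for y
  proof (rule Riesz_representation[OF subspc_carrier hclosed_carrier, where B = "B * sqrt (hnsq H y)"])
    fix x assume x: "x \<in> carrier H"
    have "cmod (hinner H (T x) y) \<le> sqrt (hnsq H (T x)) * sqrt (hnsq H y)"
      using x y T by (intro cmod_inner_le) auto
    also have "\<dots> \<le> (B * sqrt (hnsq H x)) * sqrt (hnsq H y)"
      using B'[OF x] nsq_nonneg[OF y] by (intro mult_right_mono) auto
    finally show "cmod (hinner H (T x) y) \<le> B * sqrt (hnsq H y) * sqrt (hnsq H x)"
      by (simp add: algebra_simps)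
  next
    fix u v assume "u \<in> carrier H" "v \<in> carrier H"
    then show "hinner H (T (hadd H u v)) y = hinner H (T u) y + hinner H (T v) y"
      using T y by (simp add: bounded_ops_add)
  next
    fix c u assume "u \<in> carrier H"
    then show "hinner H (T (hscale H c u)) y = c * hinner H (T u) y"
      using T y by (simp add: bounded_ops_scale)
  qed
  define S where "S = (\<lambda>y\<in>carrier H. SOME z. z \<in> carrier H \<and> (\<forall>x\<in>carrier H. hinner H (T x) y = hinner H x z))"
  have S: "S y \<in> carrier H" "\<And>x. x \<in> carrier H \<Longrightarrow> hinner H (T x) y = hinner H x (S y)" if y: "y \<in> carrier H" for y
  proof -
    have eq: "S y = (SOME z. z \<in> carrier H \<and> (\<forall>x\<in>carrier H. hinner H (T x) y = hinner H x z))"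
      using y by (simp only: S_def restrict_apply if_True)
    have "S y \<in> carrier H \<and> (\<forall>x\<in>carrier H. hinner H (T x) y = hinner H x (S y))"
      unfolding eq by (rule someI_ex) (use ex[OF y] in blast)
    then show "S y \<in> carrier H" "\<And>x. x \<in> carrier H \<Longrightarrow> hinner H (T x) y = hinner H x (S y)" by blast+
  qed
  have S': "hinner H (S y) x = hinner H y (T x)" if "x \<in> carrier H" "y \<in> carrier H" for x y
    using S(2)[OF that(2,1)] S(1)[OF that(2)] that T inner_commute[of "T x" y] inner_commute[of x "S y"] by simp
  have "S \<in> bounded_ops H"
  proof (rule bounded_opsI[where B = B])
    show "S \<in> carrier H \<rightarrow>\<^sub>E carrier H" using S(1) by (simp add: S_def)
    show "S (hadd H x y) = hadd H (S x) (S y)" if "x \<in> carrier H" "y \<in> carrier H" for x y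
      using that S(1) S' T by (intro inner_ext) simp_all
    show "S (hscale H c x) = hscale H c (S x)" if "x \<in> carrier H" for x c
      using that S(1) S' T by (intro inner_ext) simp_all
    show "hnsq H (S y) \<le> B\<^sup>2 * hnsq H y" if y: "y \<in> carrier H" for y
    proof -
      have "hnsq H (S y) \<le> cmod (hinner H (T (S y)) y)"
        unfolding hnsq_def S(2)[OF y S(1)[OF y], symmetric] by (rule complex_Re_le_cmod)
      also have "\<dots> \<le> sqrt (hnsq H (T (S y))) * sqrt (hnsq H y)"
        using S(1)[OF y] y T by (intro cmod_inner_le) simp_all
      also have "\<dots> \<le> (B * sqrt (hnsq H (S y))) * sqrt (hnsq H y)"
        using B'[OF S(1)[OF y]] nsq_nonneg[OF y] by (intro mult_right_mono) auto
      finally have le: "hnsq H (S y) \<le> B * sqrt (hnsq H (S y)) * sqrt (hnsq H y)" .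
      define a where "a = sqrt (hnsq H (S y))"
      have a: "a \<ge> 0" "hnsq H (S y) = a\<^sup>2" using nsq_nonneg[OF S(1)[OF y]] by (auto simp: a_def)
      have "a * a \<le> a * (B * sqrt (hnsq H y))"
        using le a(1) unfolding a_def[symmetric] a(2) by (simp add: power2_eq_square algebra_simps)
      then have "a \<le> B * sqrt (hnsq H y)"
        using a(1) B(1) nsq_nonneg[OF y] by (cases "a = 0") auto
      then have "a\<^sup>2 \<le> (B * sqrt (hnsq H y))\<^sup>2" using a(1) by (intro power_mono)
      then show ?thesis using a(2) nsq_nonneg[OF y] by (simp add: power_mult_distrib)
    qed
  qed
  then show ?thesis using S(2) unfolding is_adjoint_def by blast
qed

lemma proj_bounded:
  assumes K: "subspc K" "hclosed K"
  shows "proj K \<in> bounded_ops H"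
proof (rule bounded_opsI[where B = 1])
  have Kc: "z \<in> K \<Longrightarrow> z \<in> carrier H" for z using K by (auto simp: subspc_def)
  show "proj K \<in> carrier H \<rightarrow>\<^sub>E carrier H"
    using proj_carrier[OF K] by (auto simp: proj_def[of K] PiE_def extensional_def)
  show "proj K (hadd H x y) = hadd H (proj K x) (proj K y)" if "x \<in> carrier H" "y \<in> carrier H" for x y
    using that proj_in[OF K] proj_inner[OF K] proj_carrier[OF K] Kc K(1)
    by (intro proj_unique[OF K]) (auto simp: subspc_def)
  show "proj K (hscale H c x) = hscale H c (proj K x)" if "x \<in> carrier H" for x c
    using that proj_in[OF K] proj_inner[OF K] proj_carrier[OF K] Kc K(1)
    by (intro proj_unique[OF K]) (auto simp: subspc_def)
  show "hnsq H (proj K x) \<le> 1\<^sup>2 * hnsq H x" if "x \<in> carrier H" for x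
    using nsq_proj_le[OF K that] by simp
qed

subsection \<open>Von Neumann algebras\<close>

lemma commutant_iff:
  "T \<in> commutant H A \<longleftrightarrow> T \<in> bounded_ops H \<and> (\<forall>S\<in>A. \<forall>x\<in>carrier H. T (S x) = S (T x))"
  unfolding commutant_def compose_def by (auto simp: fun_eq_iff restrict_def)

lemma commutantI:
  "T \<in> bounded_ops H \<Longrightarrow> (\<And>S x. S \<in> A \<Longrightarrow> x \<in> carrier H \<Longrightarrow> T (S x) = S (T x)) \<Longrightarrow> T \<in> commutant H A"
  by (simp add: commutant_iff)

lemma commutantD: "T \<in> commutant H A \<Longrightarrow> S \<in> A \<Longrightarrow> x \<in> carrier H \<Longrightarrow> T (S x) = S (T x)"
  unfolding commutant_iff by blast

lemma commutantD_bounded: "T \<in> commutant H A \<Longrightarrow> T \<in> bounded_ops H"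
  unfolding commutant_iff by blast

lemma commutant_bounded: "commutant H A \<subseteq> bounded_ops H"
  by (auto simp: commutant_iff)

lemma commutant_antimono: "A \<subseteq> B \<Longrightarrow> commutant H B \<subseteq> commutant H A"
  unfolding commutant_iff subset_iff by blast

lemma bicommutant_superset: "A \<subseteq> bounded_ops H \<Longrightarrow> A \<subseteq> commutant H (commutant H A)"
proof
  fix T assume "A \<subseteq> bounded_ops H" "T \<in> A"
  then show "T \<in> commutant H (commutant H A)"
    by (intro commutantI) (auto dest: commutantD)
qed

lemma commutant_adjoint:
  assumes A: "A \<subseteq> bounded_ops H" "\<And>T. T \<in> A \<Longrightarrow> \<exists>S\<in>A. is_adjoint H T S"
    and T: "T \<in> commutant H A" and S: "S \<in> bounded_ops H" "is_adjoint H T S"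
  shows "S \<in> commutant H A"
proof -
  have "S (a x) = a (S x)" if a: "a \<in> A" and x: "x \<in> carrier H" for a x
  proof (rule inner_ext)
    obtain a' where a': "a' \<in> A" "is_adjoint H a a'" using A(2)[OF a] by blast
    have b: "a \<in> bounded_ops H" "a' \<in> bounded_ops H" "T \<in> bounded_ops H" using a a' A T by (auto simp: commutant_iff)
    fix z assume z: "z \<in> carrier H"
    have "hinner H (S (a x)) z = hinner H x (a' (T z))"
      using is_adjointD[OF is_adjoint_sym[OF b(3) S]] is_adjointD[OF a'(2)] b z x by simp
    also have "\<dots> = hinner H x (T (a' z))" using T a'(1) z by (simp add: commutant_iff)
    also have "\<dots> = hinner H (a (S x)) z"
      using is_adjointD[OF is_adjoint_sym[OF b(3) S]] is_adjointD[OF a'(2)] b z x S by simp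
    finally show "hinner H (S (a x)) z = hinner H (a (S x)) z" .
  qed (use a x S A in auto)
  then show ?thesis using S by (auto simp: commutant_iff)
qed

text \<open>The triple commutant collapses to the commutant. Upper bounds for generated algebras
  arise in this way: \<open>M\<close> is caught in the commutant of the right multiplications,
  \<open>N\<close> in that of a projection.\<close>

lemma vN_commutant:
  assumes A: "A \<subseteq> bounded_ops H" "\<And>T. T \<in> A \<Longrightarrow> \<exists>S\<in>A. is_adjoint H T S"
  shows "von_neumann_algebra H (commutant H A)"
  unfolding von_neumann_algebra_def
proof (intro conjI ballI)
  show "\<exists>S\<in>commutant H A. is_adjoint H T S" if T: "T \<in> commutant H A" for T
  proof -
    obtain S where S: "S \<in> bounded_ops H" "is_adjoint H T S"
      using adjoint_exists T commutant_bounded by blast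
    then show ?thesis using commutant_adjoint[OF A T] by blast
  qed
  show "commutant H (commutant H (commutant H A)) = commutant H A"
    using bicommutant_superset[OF A(1)] bicommutant_superset[OF commutant_bounded[of A]] commutant_antimono by blast
qed (rule commutant_bounded)

lemma vN_bounded_ops: "von_neumann_algebra H (bounded_ops H)"
  unfolding von_neumann_algebra_def
  using adjoint_exists commutant_bounded bicommutant_superset[of "bounded_ops H"] by fastforce

text \<open>Uniqueness of adjoints reconciles the members of \<open>F\<close>: each contains some
  adjoint of \<open>T\<close>, and these are all the same operator.\<close>

lemma vN_Inter:
  assumes ne: "F \<noteq> {}" and F: "\<And>A. A \<in> F \<Longrightarrow> von_neumann_algebra H A"
  shows "von_neumann_algebra H (\<Inter>F)"
  unfolding von_neumann_algebra_def
proof (intro conjI ballI)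
  show sub: "\<Inter>F \<subseteq> bounded_ops H" using ne F unfolding von_neumann_algebra_def by blast
  show "\<exists>S\<in>\<Inter>F. is_adjoint H T S" if T: "T \<in> \<Inter>F" for T
  proof -
    have Tb: "T \<in> bounded_ops H" using T sub by blast
    obtain S where S: "S \<in> bounded_ops H" "is_adjoint H T S" using adjoint_exists[OF Tb] by blast
    have "S \<in> A" if "A \<in> F" for A
    proof -
      obtain S' where S': "S' \<in> A" "is_adjoint H T S'" using F[OF \<open>A \<in> F\<close>] T \<open>A \<in> F\<close> unfolding von_neumann_algebra_def by blast
      moreover have "S' \<in> bounded_ops H" using S' F[OF that] unfolding von_neumann_algebra_def by blast
      ultimately show ?thesis using adjoint_unique[OF S(1) _ S(2) _ Tb] by blast
    qed
    then show ?thesis using S by blast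
  qed
  have "commutant H (commutant H (\<Inter>F)) \<subseteq> A" if "A \<in> F" for A
    using commutant_antimono[OF commutant_antimono[of "\<Inter>F" A]] F[OF that] that
    unfolding von_neumann_algebra_def by auto
  then show "commutant H (commutant H (\<Inter>F)) = \<Inter>F"
    using bicommutant_superset[OF sub] by blast
qed

lemma vN_vN_generated: "S \<subseteq> bounded_ops H \<Longrightarrow> von_neumann_algebra H (vN_generated H S)"
  unfolding vN_generated_def using vN_bounded_ops by (intro vN_Inter) auto

end

lemma vN_generated_superset: "S \<subseteq> vN_generated H S"
  unfolding vN_generated_def by blast

lemma vN_generated_least: "von_neumann_algebra H A \<Longrightarrow> S \<subseteq> A \<Longrightarrow> vN_generated H S \<subseteq> A"
  unfolding vN_generated_def by blast

context hilbert_space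
begin

text \<open>Each combination commutes with the commutant of \<open>A\<close>, hence lies in the
  bicommutant, which is \<open>A\<close>. Most of the work is boundedness, which belongs to
  membership in a commutant.\<close>

lemma vN_closed:
  assumes A: "von_neumann_algebra H A" and T: "T \<in> A" and S: "S \<in> A"
  shows "(\<lambda>x\<in>carrier H. hadd H (T x) (S x)) \<in> A" (is "?add \<in> A")
    and "(\<lambda>x\<in>carrier H. hscale H c (T x)) \<in> A" (is "?sc \<in> A")
    and "(\<lambda>x\<in>carrier H. T (S x)) \<in> A" (is "?co \<in> A")
proof -
  have A': "A = commutant H (commutant H A)" "A \<subseteq> bounded_ops H"
    using A unfolding von_neumann_algebra_def by auto
  have b: "T \<in> bounded_ops H" "S \<in> bounded_ops H" using A' T S by auto
  obtain B where B: "\<And>x. x \<in> carrier H \<Longrightarrow> hnsq H (T x) \<le> B\<^sup>2 * hnsq H x" using bounded_ops_bound[OF b(1)] by blast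
  obtain B' where B': "\<And>x. x \<in> carrier H \<Longrightarrow> hnsq H (S x) \<le> B'\<^sup>2 * hnsq H x" using bounded_ops_bound[OF b(2)] by blast
  have c: "T (R x) = R (T x)" "S (R x) = R (S x)" if "R \<in> commutant H A" "x \<in> carrier H" for R x
    using commutantD[OF that(1) T that(2)] commutantD[OF that(1) S that(2)] by simp_all
  have Rb: "R \<in> bounded_ops H" if "R \<in> commutant H A" for R
    using that by (rule commutantD_bounded)
  have "?add \<in> bounded_ops H"
  proof (rule bounded_opsI[where B = "sqrt (2 * B\<^sup>2 + 2 * B'\<^sup>2)"])
    fix x assume x: "x \<in> carrier H"
    have "hnsq H (hadd H (T x) (S x)) \<le> 2 * (B\<^sup>2 * hnsq H x) + 2 * (B'\<^sup>2 * hnsq H x)"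
      using nsq_add_le[of "T x" "S x"] b x B[OF x] B'[OF x] by simp
    then show "hnsq H (?add x) \<le> (sqrt (2 * B\<^sup>2 + 2 * B'\<^sup>2))\<^sup>2 * hnsq H x"
      using x by (simp add: algebra_simps)
  next
    fix x y assume "x \<in> carrier H" "y \<in> carrier H"
    then show "?add (hadd H x y) = hadd H (?add x) (?add y)"
      using b by (intro inner_ext) (simp_all add: bounded_ops_add)
  next
    fix x k assume "x \<in> carrier H"
    then show "?add (hscale H k x) = hscale H k (?add x)"
      using b by (intro inner_ext) (simp_all add: bounded_ops_scale algebra_simps)
  qed (use b in simp)
  then show "?add \<in> A"
  proof (subst A'(1), rule commutantI)
    fix R x assume R: "R \<in> commutant H A" and x: "x \<in> carrier H"
    have "T (S (R x)) = R (T (S x))"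
      using c[OF R x] c[OF R, of "S x"] b x by simp
    then show "?add (R x) = R (?add x)"
      using c[OF R x] Rb[OF R] b x by (simp add: bounded_ops_add)
  qed
  have "?sc \<in> bounded_ops H"
  proof (rule bounded_opsI[where B = "cmod c * B"])
    fix x assume x: "x \<in> carrier H"
    have "(cmod c)\<^sup>2 * hnsq H (T x) \<le> (cmod c)\<^sup>2 * (B\<^sup>2 * hnsq H x)"
      using B[OF x] by (intro mult_left_mono) auto
    then show "hnsq H (?sc x) \<le> (cmod c * B)\<^sup>2 * hnsq H x"
      using x b by (simp add: nsq_scale power_mult_distrib algebra_simps)
  next
    fix x y assume "x \<in> carrier H" "y \<in> carrier H"
    then show "?sc (hadd H x y) = hadd H (?sc x) (?sc y)"
      using b by (intro inner_ext) (simp_all add: bounded_ops_add algebra_simps)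
  next
    fix x k assume "x \<in> carrier H"
    then show "?sc (hscale H k x) = hscale H k (?sc x)"
      using b by (intro inner_ext) (simp_all add: bounded_ops_scale algebra_simps)
  qed (use b in simp)
  then show "?sc \<in> A"
  proof (subst A'(1), rule commutantI)
    fix R x assume R: "R \<in> commutant H A" and x: "x \<in> carrier H"
    have "T (S (R x)) = R (T (S x))"
      using c[OF R x] c[OF R, of "S x"] b x by simp
    then show "?sc (R x) = R (?sc x)"
      using c[OF R x] Rb[OF R] b x by (simp add: bounded_ops_scale)
  qed
  have "?co \<in> bounded_ops H"
  proof (rule bounded_opsI[where B = "B * B'"])
    fix x assume x: "x \<in> carrier H"
    have "hnsq H (T (S x)) \<le> B\<^sup>2 * (B'\<^sup>2 * hnsq H x)"
      using B[of "S x"] b x mult_left_mono[OF B'[OF x], of "B\<^sup>2"] by simp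
    then show "hnsq H (?co x) \<le> (B * B')\<^sup>2 * hnsq H x"
      using x by (simp add: power_mult_distrib algebra_simps)
  qed (use b in \<open>simp_all add: bounded_ops_add bounded_ops_scale\<close>)
  then show "?co \<in> A"
  proof (subst A'(1), rule commutantI)
    fix R x assume R: "R \<in> commutant H A" and x: "x \<in> carrier H"
    have "T (S (R x)) = R (T (S x))"
      using c[OF R x] c[OF R, of "S x"] b x by simp
    then show "?co (R x) = R (?co x)"
      using c[OF R x] Rb[OF R] b x by simp
  qed
qed

end

section \<open>Two by two matrices over the rationals\<close>

definition mx :: "rat \<Rightarrow> rat \<Rightarrow> rat \<Rightarrow> rat \<Rightarrow> rat^2^2" where
  "mx a b c d = vector [vector [a, b], vector [c, d]]"

definition vc :: "rat \<Rightarrow> rat \<Rightarrow> rat^2" where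
  "vc p q = vector [p, q]"

lemma mx_eq_iff [simp]: "mx a b c d = mx a' b' c' d' \<longleftrightarrow> a = a' \<and> b = b' \<and> c = c' \<and> d = d'"
  by (auto simp: mx_def vec_eq_iff forall_2)

lemma vc_eq_iff [simp]: "vc p q = vc p' q' \<longleftrightarrow> p = p' \<and> q = q'"
  by (auto simp: vc_def vec_eq_iff forall_2)

lemma mx_cases: obtains a b c d where "g = mx a b c d"
  using that[of "g$1$1" "g$1$2" "g$2$1" "g$2$2"] by (auto simp: mx_def vec_eq_iff forall_2)

lemma vc_cases: obtains p q where "v = vc p q"
  using that[of "v$1" "v$2"] by (auto simp: vc_def vec_eq_iff forall_2)

lemma mx_mult [simp]:
  "mx a b c d ** mx a' b' c' d' = mx (a * a' + b * c') (a * b' + b * d') (c * a' + d * c') (c * b' + d * d')"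
  by (auto simp: mx_def vec_eq_iff forall_2 matrix_matrix_mult_def sum_2)

lemma mx_vc [simp]: "mx a b c d *v vc p q = vc (a * p + b * q) (c * p + d * q)"
  by (auto simp: mx_def vc_def vec_eq_iff forall_2 matrix_vector_mult_def sum_2)

lemma det_mx [simp]: "det (mx a b c d) = a * d - b * c"
  by (simp add: det_2 mx_def)

lemma mat_1_mx: "mat 1 = mx 1 0 0 1"
  by (auto simp: mx_def vec_eq_iff forall_2 mat_def)

lemma minus_mx [simp]: "- mx a b c d = mx (- a) (- b) (- c) (- d)"
  by (auto simp: mx_def vec_eq_iff forall_2)

lemma vc_arith [simp]: "- vc p q = vc (- p) (- q)" "vc p q + vc p' q' = vc (p + p') (q + q')"
  "vc p q - vc p' q' = vc (p - p') (q - q')" "c *s vc p q = vc (c * p) (c * q)"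
  by (auto simp: vc_def vec_eq_iff forall_2)

lemma zero_vc: "0 = vc 0 0"
  by (auto simp: vc_def vec_eq_iff forall_2)

lemma vc_eq_0 [simp]: "vc p q = 0 \<longleftrightarrow> p = 0 \<and> q = 0"
  by (simp add: zero_vc)

lemma det_mult_1: "det g = 1 \<Longrightarrow> det h = 1 \<Longrightarrow> det (g ** h :: rat^2^2) = 1"
  by (simp add: det_mul)

lemma det_mat_1: "det (mat 1 :: rat^2^2) = 1"
  by simp

lemma neg_ne: "det g = 1 \<Longrightarrow> g \<noteq> - (g :: rat^2^2)"
  by (cases g rule: mx_cases) auto

lemma det_minus: "det (- g) = det (g :: rat^2^2)"
  by (cases g rule: mx_cases) auto

lemma minus_vec_eq: "v = - v \<longleftrightarrow> v = (0 :: rat^2)"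
  by (cases v rule: vc_cases) auto

text \<open>The adjugate: the inverse for determinant 1, but total, and involutive without any
  hypothesis on the determinant.\<close>

definition inv2 :: "rat^2^2 \<Rightarrow> rat^2^2" where
  "inv2 g = mx (g$2$2) (- g$1$2) (- g$2$1) (g$1$1)"

lemma inv2_mx [simp]: "inv2 (mx a b c d) = mx d (- b) (- c) a"
  by (simp add: inv2_def mx_def)

lemma inv2:
  assumes "det g = 1"
  shows "det (inv2 g) = 1" "g ** inv2 g = mat 1" "inv2 g ** g = mat 1"
  using assms by (cases g rule: mx_cases; simp add: mat_1_mx algebra_simps)+

lemma inv2_inv2 [simp]: "inv2 (inv2 g) = g"
  by (cases g rule: mx_cases) simp

lemma inv2_cancel:
  fixes v :: "rat^2" and h :: "rat^2^2"
  assumes "det g = 1"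
  shows "g *v (inv2 g *v v) = v" "inv2 g *v (g *v v) = v"
    "g ** (inv2 g ** h) = h" "inv2 g ** (g ** h) = h" "h ** g ** inv2 g = h" "h ** inv2 g ** g = h"
  using inv2[OF assms] by (simp_all add: matrix_vector_mul_assoc matrix_mul_assoc)
    (simp_all add: matrix_mul_assoc[symmetric])

lemma transitive_e1:
  assumes "w \<noteq> 0"
  obtains k where "det k = 1" "k *v vc 1 0 = w"
proof -
  obtain p q where w: "w = vc p q" by (rule vc_cases)
  show ?thesis
  \<comment> \<open>\<open>w\<close> has to be the first column of \<open>k\<close>; the second
    column is chosen to make the determinant 1.\<close>
  proof (cases "p = 0")
    case True
    then show ?thesis using that[of "mx p (- 1 / q) q 0"] assms w by simp
  next
    case False
    then show ?thesis using that[of "mx p 0 q (1 / p)"] w by simp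
  qed
qed

section \<open>A frame indexed by the rational plane and its special linear group\<close>

text \<open>In the application \<open>Om\<close> is the trace vector, \<open>b v g\<close> is \<open>U v\<close> times the left translation by \<open>g\<close>
  applied to \<open>Om\<close>, \<open>Rho g\<close> and \<open>R w\<close> are right multiplication by the inverse of \<open>g\<close> and by \<open>U w\<close>, and \<open>J\<close> is
  the modular conjugation.  Indexing by matrices instead of their classes makes \<open>b\<close> even in both arguments.\<close>

locale frame = hilbert_space H for H :: "'h hilbert" +
  fixes Om :: 'h
    and b :: "rat^2 \<Rightarrow> rat^2^2 \<Rightarrow> 'h"
    and Lam Rho :: "rat^2^2 \<Rightarrow> 'h \<Rightarrow> 'h"
    and R :: "rat^2 \<Rightarrow> 'h \<Rightarrow> 'h"
    and J :: "'h \<Rightarrow> 'h"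
    and Mul :: "('h \<Rightarrow> 'h) set"
  assumes Om_closed [simp, intro]: "Om \<in> carrier H"
    and b_closed [simp, intro]: "det g = 1 \<Longrightarrow> b v g \<in> carrier H"
    and b_inner: "det g = 1 \<Longrightarrow> det h = 1 \<Longrightarrow> hinner H (b v g) (b w h) =
      2 * (of_bool (v = w) + of_bool (v = - w)) * (of_bool (g = h) + of_bool (g = - h))"
    and b_total: "x \<in> carrier H \<Longrightarrow> (\<And>v g. det g = 1 \<Longrightarrow> hinner H x (b v g) = 0) \<Longrightarrow> hnsq H x = 0"
    and b_zero: "b 0 (mat 1) = hscale H 2 Om"
    and Lam_bounded [simp, intro]: "det g = 1 \<Longrightarrow> Lam g \<in> bounded_ops H"
    and Lam_adjoint: "det g = 1 \<Longrightarrow> is_adjoint H (Lam g) (Lam (inv2 g))"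
    and Lam_b: "det g = 1 \<Longrightarrow> det h = 1 \<Longrightarrow> Lam g (b v h) = b (g *v v) (g ** h)"
    and Rho_bounded [simp, intro]: "det g = 1 \<Longrightarrow> Rho g \<in> bounded_ops H"
    and Rho_adjoint: "det g = 1 \<Longrightarrow> is_adjoint H (Rho g) (Rho (inv2 g))"
    and Rho_b: "det g = 1 \<Longrightarrow> det h = 1 \<Longrightarrow> Rho g (b v h) = b v (h ** inv2 g)"
    and R_bounded [simp, intro]: "R w \<in> bounded_ops H"
    and R_adjoint: "is_adjoint H (R w) (R w)"
    and R_b: "det g = 1 \<Longrightarrow> R w (b v g) = hadd H (b (v + g *v w) g) (b (v - g *v w) g)"
    and R_Om: "R w Om = b w (mat 1)"
    and Lam_Om: "det g = 1 \<Longrightarrow> Lam g Om = Rho (inv2 g) Om"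
    and J_closed [simp, intro]: "x \<in> carrier H \<Longrightarrow> J x \<in> carrier H"
    and J_inner: "x \<in> carrier H \<Longrightarrow> y \<in> carrier H \<Longrightarrow> hinner H (J x) (J y) = hinner H y x"
    and J_b: "det g = 1 \<Longrightarrow> J (b v g) = b (inv2 g *v v) (inv2 g)"
    and Lam_Rho: "det g = 1 \<Longrightarrow> det h = 1 \<Longrightarrow> x \<in> carrier H \<Longrightarrow> Lam g (Rho h x) = Rho h (Lam g x)"
    and Lam_R: "det g = 1 \<Longrightarrow> x \<in> carrier H \<Longrightarrow> Lam g (R w x) = R w (Lam g x)"
    and Mul_bounded: "Mul \<subseteq> bounded_ops H"
    and Mul_Rho: "T \<in> Mul \<Longrightarrow> det h = 1 \<Longrightarrow> x \<in> carrier H \<Longrightarrow> T (Rho h x) = Rho h (T x)"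
    and Mul_R: "T \<in> Mul \<Longrightarrow> x \<in> carrier H \<Longrightarrow> T (R w x) = R w (T x)"
    and Mul_Om: "\<exists>T\<in>Mul. T Om = b w (mat 1)"
begin

section \<open>Coefficients in the frame and right multiplications\<close>

definition N where "N = vN_generated H (Lam ` {g. det g = 1})"
definition M where "M = vN_generated H (Mul \<union> Lam ` {g. det g = 1})"

abbreviation cf :: "'h \<Rightarrow> rat^2 \<Rightarrow> rat^2^2 \<Rightarrow> complex" where
  "cf x v g \<equiv> hinner H x (b v g)"

text \<open>The Gram values alone force evenness: they give the difference of the two vectors length
  zero.\<close>

lemma b_minus_v: "det g = 1 \<Longrightarrow> b (- v) g = b v g"
  by (rule nsq_sub_eq_0) (simp_all add: nsq_sub, simp add: hnsq_def b_inner of_bool_def)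

lemma b_minus_g: "det g = 1 \<Longrightarrow> b v (- g) = b v g"
  using neg_ne[of g]
  by (intro nsq_sub_eq_0) (simp_all add: nsq_sub det_minus, simp add: hnsq_def b_inner det_minus)

lemma b_ext:
  assumes "x \<in> carrier H" "y \<in> carrier H" "\<And>v g. det g = 1 \<Longrightarrow> cf x v g = cf y v g"
  shows "x = y"
  using assms by (intro nsq_sub_eq_0 b_total) auto

lemma J_J: "x \<in> carrier H \<Longrightarrow> J (J x) = x"
proof (rule b_ext)
  fix v :: "rat^2" and g :: "rat^2^2" assume x: "x \<in> carrier H" and g: "det g = 1"
  have "b v g = J (J (b v g))" using g inv2[OF g] by (simp add: J_b inv2_cancel)
  then have "cf (J (J x)) v g = hinner H (J (J x)) (J (J (b v g)))" by simp
  also have "\<dots> = cf x v g" using x g J_inner by simp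
  finally show "cf (J (J x)) v g = cf x v g" .
qed auto

lemma nsq_J_sub: "x \<in> carrier H \<Longrightarrow> y \<in> carrier H \<Longrightarrow> hnsq H (hsub H (J x) (J y)) = hnsq H (hsub H x y)"
  by (simp add: nsq_sub J_inner Re_inner_commute) (simp add: hnsq_def J_inner)

lemma hlim_J: "x \<in> carrier H \<Longrightarrow> (\<And>n. X n \<in> carrier H) \<Longrightarrow> hlim H X x \<Longrightarrow> hlim H (\<lambda>n. J (X n)) (J x)"
  unfolding hlim_def by (simp add: nsq_J_sub)

lemma Rho_inner: "det g = 1 \<Longrightarrow> x \<in> carrier H \<Longrightarrow> y \<in> carrier H \<Longrightarrow> hinner H (Rho g x) y = hinner H x (Rho (inv2 g) y)"
  using is_adjointD[OF Rho_adjoint] by blast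

lemma Lam_inner: "det g = 1 \<Longrightarrow> x \<in> carrier H \<Longrightarrow> y \<in> carrier H \<Longrightarrow> hinner H (Lam g x) y = hinner H x (Lam (inv2 g) y)"
  using is_adjointD[OF Lam_adjoint] by blast

lemma R_inner: "x \<in> carrier H \<Longrightarrow> y \<in> carrier H \<Longrightarrow> hinner H (R w x) y = hinner H x (R w y)"
  using is_adjointD[OF R_adjoint] by blast

lemma b_eq: "det g = 1 \<Longrightarrow> b v g = Rho (inv2 g) (b v (mat 1))"
  using inv2(1) by (simp add: Rho_b)

lemma cf_Rho: "det k = 1 \<Longrightarrow> x \<in> carrier H \<Longrightarrow> det h = 1 \<Longrightarrow> cf (Rho k x) v h = cf x v (h ** k)"
  using inv2(1)[of k] by (simp add: Rho_inner Rho_b)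

lemma cf_Lam: "det k = 1 \<Longrightarrow> x \<in> carrier H \<Longrightarrow> det h = 1 \<Longrightarrow> cf (Lam k x) v h = cf x (inv2 k *v v) (inv2 k ** h)"
  using inv2(1)[of k] by (simp add: Lam_inner Lam_b)

lemma cf_R: "x \<in> carrier H \<Longrightarrow> det h = 1 \<Longrightarrow> cf (R w x) v h = cf x (v + h *v w) h + cf x (v - h *v w) h"
  by (simp add: R_inner R_b)

definition Rgt where "Rgt = Rho ` {g. det g = 1} \<union> range R"

lemma Rgt_bounded: "Rgt \<subseteq> bounded_ops H"
  by (auto simp: Rgt_def)

lemma Rgt_adjoint: "T \<in> Rgt \<Longrightarrow> \<exists>S\<in>Rgt. is_adjoint H T S"
  unfolding Rgt_def using Rho_adjoint R_adjoint inv2(1) by blast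

lemma gens_bounded: "Lam ` {g. det g = 1} \<subseteq> bounded_ops H" "Mul \<union> Lam ` {g. det g = 1} \<subseteq> bounded_ops H"
  using Mul_bounded by auto

lemma vN_N: "von_neumann_algebra H N" and vN_M: "von_neumann_algebra H M"
  unfolding N_def M_def using gens_bounded by (auto intro!: vN_vN_generated)

lemma N_subset_M: "N \<subseteq> M"
  unfolding N_def
proof (rule vN_generated_least)
  show "Lam ` {g. det g = 1} \<subseteq> M"
    using vN_generated_superset[of "Mul \<union> Lam ` {g. det g = 1}" H] unfolding M_def by blast
qed (rule vN_M)

text \<open>Left and right multiplications commute. The consequence that matters is
  \<open>M_b\<close>: an element of \<open>M\<close> is determined by its value at
  \<open>Om\<close>, since right multiplications carry \<open>Om\<close> to every frame
  vector.\<close>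

lemma M_commutant: "M \<subseteq> commutant H Rgt"
  unfolding M_def
proof (rule vN_generated_least)
  show "von_neumann_algebra H (commutant H Rgt)"
    using Rgt_bounded Rgt_adjoint by (rule vN_commutant)
  show "Mul \<union> Lam ` {g. det g = 1} \<subseteq> commutant H Rgt"
    using gens_bounded(2) Lam_Rho Lam_R Mul_Rho Mul_R by (auto simp: commutant_iff Rgt_def)
qed

lemma M_bounded: "T \<in> M \<Longrightarrow> T \<in> bounded_ops H"
  using M_commutant commutant_bounded by blast

lemma M_Rho: "T \<in> M \<Longrightarrow> det h = 1 \<Longrightarrow> x \<in> carrier H \<Longrightarrow> T (Rho h x) = Rho h (T x)"
  and M_R: "T \<in> M \<Longrightarrow> x \<in> carrier H \<Longrightarrow> T (R w x) = R w (T x)"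
  using M_commutant by (auto simp: commutant_iff Rgt_def)

lemma M_b: "T \<in> M \<Longrightarrow> det g = 1 \<Longrightarrow> T (b v g) = Rho (inv2 g) (R v (T Om))"
  using inv2(1)[of g] by (simp add: b_eq[of g] R_Om[symmetric] M_Rho M_R)

text \<open>This identifies \<open>J\<close> as the modular conjugation. \<open>T\<close> is moved
  past the right multiplications that produce \<open>b v g\<close>, and at \<open>Om\<close> a right
  translation turns into a left translation, which commutes with \<open>R v\<close>.\<close>

lemma adjoint_Om:
  assumes T: "T \<in> M" and S: "S \<in> bounded_ops H" "is_adjoint H T S"
  shows "S Om = J (T Om)"
proof (rule b_ext)
  have Tb: "T \<in> bounded_ops H" using T by (rule M_bounded)
  show "S Om \<in> carrier H" "J (T Om) \<in> carrier H" using S Tb by simp_all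
  fix v :: "rat^2" and g :: "rat^2^2" assume g: "det g = 1"
  note g' = inv2[OF g]
  have "cf (S Om) v g = hinner H Om (T (b v g))"
    using is_adjointD[OF is_adjoint_sym[OF Tb S]] g by simp
  also have "\<dots> = hinner H Om (Rho (inv2 g) (R v (T Om)))"
    using M_b[OF T g] by simp
  also have "\<dots> = hinner H (R v (Rho g Om)) (T Om)"
    using g g' Tb by (simp add: Rho_inner[symmetric] R_inner)
  also have "R v (Rho g Om) = Lam (inv2 g) (R v Om)"
    using Lam_Om[OF g'(1)] Lam_R[OF g'(1)] by simp
  also have "\<dots> = b (inv2 g *v v) (inv2 g)"
    using g' by (simp add: R_Om Lam_b)
  also have "hinner H (b (inv2 g *v v) (inv2 g)) (T Om) = hinner H (J (T Om)) (J (b (inv2 g *v v) (inv2 g)))"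
    using Tb g' by (simp add: J_inner)
  also have "J (b (inv2 g *v v) (inv2 g)) = b v g"
    using g g' by (simp add: J_b inv2_cancel)
  finally show "cf (S Om) v g = cf (J (T Om)) v g" .
qed

subsection \<open>Expansions in the frame\<close>

lemma b_inner_zero:
  "det g = 1 \<Longrightarrow> det h = 1 \<Longrightarrow> \<not> ((v = w \<or> v = - w) \<and> (g = h \<or> g = - h)) \<Longrightarrow> hinner H (b v g) (b w h) = 0"
  by (auto simp: b_inner)

text \<open>The value 4 occurs exactly at \<open>v = 0\<close>, where both indicators in
  \<open>b_inner\<close> are 1; normalisations by 2 therefore go with nonzero indices.\<close>

lemma nsq_b: "det g = 1 \<Longrightarrow> hnsq H (b v g) = (if v = - v then 4 else 2)"
  using neg_ne[of g] by (simp add: hnsq_def b_inner)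

lemma cf_even:
  assumes "det g = 1" "v = w \<or> v = - w" "g = h \<or> g = - h"
  shows "b v g = b w h"
proof -
  have "det h = 1" using assms by (auto simp: det_minus)
  then show ?thesis using assms b_minus_v b_minus_g by (metis det_minus)
qed

text \<open>A substitute for Parseval's identity. The vectors whose coefficients vanish wherever
  those of \<open>y\<close> do form a closed subspace containing \<open>y\<close>, and the
  projection of \<open>x\<close> to it turns out to have no coefficients at all.\<close>

lemma disjoint_support_orthogonal:
  assumes x: "x \<in> carrier H" and y: "y \<in> carrier H"
    and disj: "\<And>v g. det g = 1 \<Longrightarrow> cf x v g = 0 \<or> cf y v g = 0"
  shows "hinner H x y = 0"
proof -
  define K where "K = {z \<in> carrier H. \<forall>v g. det g = 1 \<longrightarrow> cf y v g = 0 \<longrightarrow> cf z v g = 0}"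
  have sK: "subspc K" using y by (auto simp: subspc_def K_def)
  have cK: "hclosed K"
    unfolding hclosed_def
  proof (intro allI impI)
    fix X z assume X: "\<forall>n. X n \<in> K" and z: "z \<in> carrier H" "hlim H X z"
    have "cf z v g = 0" if "det g = 1" "cf y v g = 0" for v g
    proof -
      have "(\<lambda>n. cf (X n) v g) \<longlonglongrightarrow> cf z v g"
        using X z that by (intro hlim_inner) (auto simp: K_def)
      then show ?thesis using X that by (simp add: K_def LIMSEQ_const_iff)
    qed
    then show "z \<in> K" using z by (simp add: K_def)
  qed
  define p where "p = proj K x"
  have p: "p \<in> K" unfolding p_def by (rule proj_in[OF sK cK x])
  have pc: "p \<in> carrier H" using p by (simp add: K_def)
  have "hnsq H p = 0"
  proof (rule b_total[OF pc])
    fix v :: "rat^2" and g :: "rat^2^2" assume g: "det g = 1"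
    show "cf p v g = 0"
    proof (cases "cf y v g = 0")
      case True
      then show ?thesis using p g by (simp add: K_def)
    next
      case False
      \<comment> \<open>A frame vector that meets \<open>y\<close> lies in \<open>K\<close>, since
        frame vectors are equal or orthogonal; on it the projection keeps the coefficient of
        \<open>x\<close>, which is 0 by \<open>disj\<close>.\<close>
      have "cf (b v g) w h = 0" if "det h = 1" "cf y w h = 0" for w h
      proof (rule b_inner_zero[OF g that(1)], rule notI)
        assume "(v = w \<or> v = - w) \<and> (g = h \<or> g = - h)"
        then have "b v g = b w h" using cf_even[OF g] by blast
        then show False using that(2) False by simp
      qed
      then have "b v g \<in> K" using g by (simp add: K_def)
      then show ?thesis
        unfolding p_def using proj_inner'[OF sK cK x] disj[OF g, of v] False by simp
    qed
  qed
  then have "hinner H p y = 0" using nsq_zero_inner pc y by blast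
  moreover have "y \<in> K" using y by (simp add: K_def)
  ultimately show ?thesis unfolding p_def using proj_inner'[OF sK cK x] by simp
qed

text \<open>Removing from \<open>x\<close> its component along the one shared frame vector leaves a
  vector whose support is disjoint from that of \<open>y\<close>. The divisor 2 is the squared
  length of the shared vector.\<close>

lemma single_overlap_inner:
  assumes x: "x \<in> carrier H" and y: "y \<in> carrier H" and g0: "det g0 = 1" and v0: "v0 \<noteq> 0"
    and disj: "\<And>v g. det g = 1 \<Longrightarrow> cf x v g \<noteq> 0 \<Longrightarrow> cf y v g \<noteq> 0 \<Longrightarrow>
      (v = v0 \<or> v = - v0) \<and> (g = g0 \<or> g = - g0)"
  shows "hinner H x y = cf x v0 g0 * cnj (cf y v0 g0) / 2"
proof -
  let ?b = "b v0 g0"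
  define c where "c = cf x v0 g0 / 2"
  define x' where "x' = hsub H x (hscale H c ?b)"
  have bb: "hinner H ?b ?b = 2" using g0 v0 neg_ne[OF g0] minus_vec_eq[of v0] by (simp add: b_inner)
  have x'c: "x' \<in> carrier H" using x g0 by (simp add: x'_def)
  have "hinner H x' y = 0"
  proof (rule disjoint_support_orthogonal[OF x'c y])
    fix v :: "rat^2" and g :: "rat^2^2" assume g: "det g = 1"
    show "cf x' v g = 0 \<or> cf y v g = 0"
    proof (cases "(v = v0 \<or> v = - v0) \<and> (g = g0 \<or> g = - g0)")
      case True
      then have "b v g = ?b" using cf_even[OF g] by blast
      then show ?thesis using x g0 bb by (simp add: x'_def c_def)
    next
      case False
      then have "hinner H ?b (b v g) = 0"
        using g g0 by (intro b_inner_zero) auto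
      then show ?thesis using False disj[OF g, of v] x g g0 by (auto simp: x'_def)
    qed
  qed
  then have "hinner H x y = c * hinner H ?b y" using x y g0 by (simp add: x'_def)
  then show ?thesis using inner_commute[of y ?b] y g0 by (simp add: c_def)
qed

text \<open>The divisor 4 is a common upper bound for the squared lengths, so one inequality serves
  frame vectors of squared length 2 and 4 together.\<close>

lemma Bessel:
  fixes e :: "nat \<Rightarrow> 'h"
  assumes e: "\<And>i. e i \<in> carrier H" "\<And>i j. i \<noteq> j \<Longrightarrow> hinner H (e i) (e j) = 0"
    "\<And>i. hnsq H (e i) \<noteq> 0" "\<And>i. hnsq H (e i) \<le> 4" and x: "x \<in> carrier H"
  shows "(\<Sum>i<n. (cmod (hinner H x (e i)))\<^sup>2 / 4) \<le> hnsq H x"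
  using x
proof (induction n arbitrary: x)
  case 0
  then show ?case using nsq_nonneg by simp
next
  case (Suc n)
  let ?s = "hnsq H (e n)" and ?a = "hinner H x (e n)"
  have s: "0 < ?s" "?s \<le> 4" using e(3,4)[of n] nsq_nonneg[OF e(1)[of n]] by auto
  define c where "c = ?a / of_real ?s"
  define x' where "x' = hsub H x (hscale H c (e n))"
  have x'c: "x' \<in> carrier H" using Suc.prems e by (simp add: x'_def)
  have "hinner H x' (e i) = hinner H x (e i)" if "i < n" for i
    using that Suc.prems e by (simp add: x'_def)
  then have 1: "(\<Sum>i<n. (cmod (hinner H x (e i)))\<^sup>2 / 4) \<le> hnsq H x'"
    using Suc.IH[OF x'c] by simp
  have "Re (cnj c * ?a) = (cmod ?a)\<^sup>2 / ?s"
    unfolding c_def cmod_power2 by (simp add: power2_eq_square add_divide_distrib)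
  moreover have "(cmod c)\<^sup>2 * ?s = (cmod ?a)\<^sup>2 / ?s"
    using s by (simp add: c_def norm_divide power_divide power2_eq_square)
  ultimately have "hnsq H x' = hnsq H x - (cmod ?a)\<^sup>2 / ?s"
    using Suc.prems e by (simp add: x'_def nsq_sub nsq_scale)
  moreover have "(cmod ?a)\<^sup>2 / 4 \<le> (cmod ?a)\<^sup>2 / ?s"
    using s by (intro divide_left_mono) auto
  ultimately show ?case using 1 by simp
qed

text \<open>Bessel's inequality bounds \<open>n * (c^2 / 4)\<close> by \<open>hnsq H x\<close> for
  every \<open>n\<close>. Square-summability is used in this form both for the orbits of the
  unipotent group and for the powers of a rational.\<close>

lemma no_infinite_constant:
  fixes f :: "nat \<Rightarrow> rat^2" and h :: "nat \<Rightarrow> rat^2^2"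
  assumes x: "x \<in> carrier H" and h: "\<And>i. det (h i) = 1"
    and inj: "\<And>i j. i \<noteq> j \<Longrightarrow> (f i = f j \<or> f i = - f j) \<Longrightarrow> (h i = h j \<or> h i = - h j) \<Longrightarrow> False"
    and const: "\<And>i. cmod (cf x (f i) (h i)) = c"
  shows "c = 0"
proof (rule ccontr)
  assume "c \<noteq> 0"
  then have c: "c\<^sup>2 > 0" by simp
  have "real n * (c\<^sup>2 / 4) \<le> hnsq H x" for n
  proof -
    have "(\<Sum>i<n. (cmod (cf x (f i) (h i)))\<^sup>2 / 4) \<le> hnsq H x"
      using x h inj by (intro Bessel b_inner_zero) (auto simp: nsq_b)
    then show ?thesis by (simp add: const)
  qed
  moreover obtain n where "hnsq H x / (c\<^sup>2 / 4) < real n" using reals_Archimedean2 by blast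
  then have "hnsq H x < real n * (c\<^sup>2 / 4)" using c by (simp add: field_simps)
  ultimately show False by (meson not_le)
qed

end

subsection \<open>Intermediate von Neumann algebras\<close>

locale intermediate = frame +
  fixes P
  assumes vN_P: "von_neumann_algebra H P"
    and Lam_P: "det g = 1 \<Longrightarrow> Lam g \<in> P"
    and P_M: "P \<subseteq> M"
begin

definition V where "V = (\<lambda>T. T Om) ` P"
definition K where "K = hcl V"

lemma P_bounded: "T \<in> P \<Longrightarrow> T \<in> bounded_ops H"
  using P_M M_bounded by blast

lemma V_carrier: "V \<subseteq> carrier H"
  unfolding V_def using P_bounded by auto

lemma subspc_V: "subspc V"
  unfolding subspc_def
proof (intro conjI ballI allI)
  show "V \<noteq> {}" unfolding V_def using Lam_P[of "mat 1"] by auto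
  show "hadd H x y \<in> V" if xy: "x \<in> V" "y \<in> V" for x y
  proof -
    obtain T S where TS: "T \<in> P" "S \<in> P" "x = T Om" "y = S Om" using xy by (auto simp: V_def)
    have "(\<lambda>z\<in>carrier H. hadd H (T z) (S z)) Om \<in> V"
      unfolding V_def by (rule imageI[OF vN_closed(1)[OF vN_P TS(1,2)]])
    then show ?thesis using TS by simp
  qed
  show "hscale H c x \<in> V" if x: "x \<in> V" for x c
  proof -
    obtain T where T: "T \<in> P" "x = T Om" using x by (auto simp: V_def)
    have "(\<lambda>z\<in>carrier H. hscale H c (T z)) Om \<in> V"
      unfolding V_def by (rule imageI[OF vN_closed(2)[OF vN_P T(1) T(1)]])
    then show ?thesis using T by simp
  qed
qed (rule V_carrier)

lemma subspc_K: "subspc K" and hclosed_K: "hclosed K"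
  unfolding K_def using subspc_hcl[OF subspc_V] hclosed_hcl[OF V_carrier] by auto

lemma K_carrier: "x \<in> K \<Longrightarrow> x \<in> carrier H"
  unfolding K_def hcl_def by blast

lemma V_K: "V \<subseteq> K"
  unfolding K_def by (rule subset_hcl[OF V_carrier])

lemma K_approx:
  assumes "x \<in> K"
  obtains a where "\<And>n. a n \<in> P" "hlim H (\<lambda>n. a n Om) x"
proof -
  obtain X where X: "\<forall>n. X n \<in> V" "hlim H X x" using assms by (auto simp: K_def hcl_def)
  have "\<forall>n. \<exists>T\<in>P. X n = T Om" using X(1) by (auto simp: V_def)
  then obtain a where a: "\<And>n. a n \<in> P" "\<And>n. X n = a n Om" by metis
  have "X = (\<lambda>n. a n Om)" using a(2) by blast
  then show ?thesis using that[of a] a(1) X(2) by simp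
qed

lemma K_limit: "(\<And>n. X n \<in> K) \<Longrightarrow> x \<in> carrier H \<Longrightarrow> hlim H X x \<Longrightarrow> x \<in> K"
  using hclosed_K unfolding hclosed_def by blast

lemma P_adjoint:
  assumes "T \<in> P"
  obtains S where "S \<in> P" "is_adjoint H T S"
  using vN_P assms unfolding von_neumann_algebra_def by blast

lemma P_K:
  assumes T: "T \<in> P" and x: "x \<in> K"
  shows "T x \<in> K"
proof -
  obtain a where a: "\<And>n. a n \<in> P" "hlim H (\<lambda>n. a n Om) x" using K_approx[OF x] by blast
  have ab: "a n \<in> bounded_ops H" for n using P_bounded[OF a(1)] .
  have xc: "x \<in> carrier H" using K_carrier[OF x] .
  have "T (a n Om) \<in> K" for n
  proof -
    have "(\<lambda>z\<in>carrier H. T (a n z)) Om \<in> V"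
      unfolding V_def by (rule imageI[OF vN_closed(3)[OF vN_P T a(1)]])
    then show ?thesis using V_K by auto
  qed
  moreover have "hlim H (\<lambda>n. T (a n Om)) (T x)"
    by (rule hlim_op[OF P_bounded[OF T] xc _ a(2)]) (simp add: ab)
  ultimately show ?thesis using K_limit[of "\<lambda>n. T (a n Om)" "T x"] P_bounded[OF T] xc by simp
qed

lemma Om_K: "Om \<in> K"
proof -
  have "Lam (mat 1) Om = Om"
  proof (rule b_ext)
    show "cf (Lam (mat 1) Om) v g = cf Om v g" if "det g = 1" for v g
      using that by (simp add: cf_Lam) (simp add: mat_1_mx, simp flip: mat_1_mx)
  qed (use Lam_bounded[of "mat 1"] in simp_all)
  moreover have "Lam (mat 1) Om \<in> V" unfolding V_def using Lam_P[of "mat 1"] by simp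
  ultimately show ?thesis using V_K by auto
qed

text \<open>Commuting the translation past \<open>a n\<close> moves it to \<open>Om\<close>, where
  it becomes the left translation \<open>Lam (inv2 g)\<close>, an element of
  \<open>P\<close>.\<close>

lemma Rho_K:
  assumes g: "det g = 1" and x: "x \<in> K"
  shows "Rho g x \<in> K"
proof -
  obtain a where a: "\<And>n. a n \<in> P" "hlim H (\<lambda>n. a n Om) x" using K_approx[OF x] by blast
  have ab: "a n \<in> bounded_ops H" for n using P_bounded[OF a(1)] .
  have xc: "x \<in> carrier H" using K_carrier[OF x] .
  have "Rho g (a n Om) \<in> K" for n
  proof -
    have aM: "a n \<in> M" using a(1) P_M by blast
    have "Rho g (a n Om) = a n (Rho g Om)" using M_Rho[OF aM g Om_closed] by simp
    also have "Rho g Om = Lam (inv2 g) Om" using Lam_Om[OF inv2(1)[OF g]] by simp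
    finally have "Rho g (a n Om) = a n (Lam (inv2 g) Om)" .
    then show ?thesis using P_K Lam_P inv2(1)[OF g] a(1) Om_K by simp
  qed
  moreover have "hlim H (\<lambda>n. Rho g (a n Om)) (Rho g x)"
    by (rule hlim_op[OF Rho_bounded[OF g] xc _ a(2)]) (simp add: ab)
  ultimately show ?thesis using K_limit[of "\<lambda>n. Rho g (a n Om)" "Rho g x"] g xc by simp
qed

text \<open>On the dense orbit \<open>J\<close> is the passage to adjoints, and \<open>P\<close> is
  closed under adjoints.\<close>

lemma J_K:
  assumes x: "x \<in> K"
  shows "J x \<in> K"
proof -
  obtain a where a: "\<And>n. a n \<in> P" "hlim H (\<lambda>n. a n Om) x" using K_approx[OF x] by blast
  have ab: "a n \<in> bounded_ops H" for n using P_bounded[OF a(1)] .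
  have xc: "x \<in> carrier H" using K_carrier[OF x] .
  have "J (a n Om) \<in> K" for n
  proof -
    obtain S where S: "S \<in> P" "is_adjoint H (a n) S" using P_adjoint[OF a(1)] by blast
    have "a n \<in> M" "S \<in> bounded_ops H" using a(1) S(1) P_M P_bounded by blast+
    then have "S Om = J (a n Om)" using adjoint_Om S(2) by blast
    then show ?thesis using P_K[OF S(1) Om_K] by simp
  qed
  moreover have "hlim H (\<lambda>n. J (a n Om)) (J x)"
    by (rule hlim_J[OF xc _ a(2)]) (simp add: ab)
  ultimately show ?thesis using K_limit[of "\<lambda>n. J (a n Om)" "J x"] xc by simp
qed

lemma b_zero_K: "det g = 1 \<Longrightarrow> b 0 g \<in> K"
  using Rho_K[OF inv2(1), of g "b 0 (mat 1)"] Om_K subspc_K inv2(1)[of g]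
  by (simp add: b_eq[of g] b_zero subspc_def)

text \<open>Elements of \<open>M\<close> are determined by their action on the frame, and the frame vectors arise from
  \<open>Om\<close> by operators commuting with \<open>M\<close>.  The isometry \<open>J\<close> turns convergence of \<open>a n Om\<close> into
  convergence of the adjoints.\<close>

lemma in_P_if_orbit_in_K:
  assumes x: "x \<in> M" and xK: "x Om \<in> K"
  shows "x \<in> P"
proof -
  have comm_b: "T (y (b v g)) = y (T (b v g))"
    if T: "T \<in> commutant H P" and y: "y \<in> M" "y Om \<in> K" and g: "det g = 1" for T y v g
  proof (rule b_ext)
    have Tb: "T \<in> bounded_ops H" using T by (rule commutantD_bounded)
    have yb: "y \<in> bounded_ops H" using M_bounded[OF y(1)] .
    show "T (y (b v g)) \<in> carrier H" "y (T (b v g)) \<in> carrier H" using Tb yb g by simp_all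
    obtain y' where y': "y' \<in> bounded_ops H" "is_adjoint H y y'" using adjoint_exists[OF yb] by blast
    obtain y'' where y'': "y'' \<in> M" "is_adjoint H y y''"
      using vN_M y(1) unfolding von_neumann_algebra_def by blast
    have y'M: "y' \<in> M" using adjoint_unique[OF y'(1) M_bounded[OF y''(1)] y'(2) y''(2) yb] y'' by simp
    obtain a where a: "\<And>n. a n \<in> P" "hlim H (\<lambda>n. a n Om) (y Om)" using K_approx[OF y(2)] by blast
    have aM: "a n \<in> M" for n using a(1) P_M by blast
    have ab: "a n \<in> bounded_ops H" for n using M_bounded[OF aM] .
    have "\<forall>n. \<exists>S\<in>P. is_adjoint H (a n) S" using P_adjoint a(1) by metis
    then obtain a' where a': "\<And>n. a' n \<in> P" "\<And>n. is_adjoint H (a n) (a' n)" by metis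
    have a'M: "a' n \<in> M" for n using a'(1) P_M by blast
    have a'b: "a' n \<in> bounded_ops H" for n using M_bounded[OF a'M] .
    have a'Om: "a' n Om = J (a n Om)" for n using adjoint_Om[OF aM a'b a'(2)] .
    have y'Om: "y' Om = J (y Om)" using adjoint_Om[OF y(1) y'] .
    fix w :: "rat^2" and h :: "rat^2^2" assume h: "det h = 1"
    have "hlim H (\<lambda>n. Rho (inv2 g) (R v (a n Om))) (Rho (inv2 g) (R v (y Om)))"
      by (rule hlim_op[OF Rho_bounded[OF inv2(1)[OF g]] _ _ hlim_op[OF R_bounded _ _ a(2)]])
        (simp_all add: ab yb)
    then have "hlim H (\<lambda>n. a n (b v g)) (y (b v g))" using M_b[OF aM g] M_b[OF y(1) g] by simp
    then have "hlim H (\<lambda>n. T (a n (b v g))) (T (y (b v g)))" using hlim_op[OF Tb] ab yb g by simp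
    then have 1: "(\<lambda>n. cf (T (a n (b v g))) w h) \<longlonglongrightarrow> cf (T (y (b v g))) w h"
      by (rule hlim_inner[rotated 3]) (simp_all add: Tb ab yb g h)
    have "hlim H (\<lambda>n. Rho (inv2 h) (R w (a' n Om))) (Rho (inv2 h) (R w (y' Om)))"
      unfolding a'Om y'Om
      by (rule hlim_op[OF Rho_bounded[OF inv2(1)[OF h]] _ _ hlim_op[OF R_bounded _ _ hlim_J[OF _ _ a(2)]]])
        (simp_all add: ab yb)
    then have "hlim H (\<lambda>n. a' n (b w h)) (y' (b w h))" using M_b[OF a'M h] M_b[OF y'M h] by simp
    then have 2: "(\<lambda>n. hinner H (T (b v g)) (a' n (b w h))) \<longlonglongrightarrow> hinner H (T (b v g)) (y' (b w h))"
      by (rule hlim_inner_right[rotated 3]) (simp_all add: Tb a'b y'(1) g h)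
    \<comment> \<open>The \<open>a n\<close> are controlled on frame vectors only, and
      \<open>T (b v g)\<close> need not be one. Moved across as the adjoint \<open>a' n\<close>,
      they act on \<open>b w h\<close>, where convergence is known.\<close>
    have "hinner H (T (b v g)) (a' n (b w h)) = cf (T (a n (b v g))) w h" for n
    proof -
      have "hinner H (T (b v g)) (a' n (b w h)) = cf (a n (T (b v g))) w h"
        using is_adjointD[OF a'(2)] Tb g h by simp
      then show ?thesis using commutantD[OF T a(1), of "b v g"] g by simp
    qed
    then have "cf (T (y (b v g))) w h = hinner H (T (b v g)) (y' (b w h))"
      using LIMSEQ_unique[OF 1] 2 by simp
    then show "cf (T (y (b v g))) w h = cf (y (T (b v g))) w h"
      using is_adjointD[OF y'(2)] Tb g h by simp
  qed
  have xb: "x \<in> bounded_ops H" using M_bounded[OF x] .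
  obtain x' where x': "x' \<in> M" "is_adjoint H x x'"
    using vN_M x unfolding von_neumann_algebra_def by blast
  have x'b: "x' \<in> bounded_ops H" using M_bounded[OF x'(1)] .
  have x'K: "x' Om \<in> K" using adjoint_Om[OF x x'b x'(2)] J_K[OF xK] by simp
  \<comment> \<open>\<open>comm_b\<close> speaks of frame vectors. For arbitrary \<open>z\<close>
    both operators are moved across as adjoints onto a frame vector, and \<open>comm_b\<close> is
    applied to \<open>x'\<close> and \<open>T'\<close>.\<close>
  have "x (T z) = T (x z)" if T: "T \<in> commutant H P" and z: "z \<in> carrier H" for T z
  proof (rule b_ext)
    have Tb: "T \<in> bounded_ops H" using T by (rule commutantD_bounded)
    obtain T' where T': "T' \<in> bounded_ops H" "is_adjoint H T T'" using adjoint_exists[OF Tb] by blast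
    have T'P: "T' \<in> commutant H P"
    proof (rule commutant_adjoint[OF _ _ T T'])
      show "P \<subseteq> bounded_ops H" using P_bounded by blast
      show "\<exists>S\<in>P. is_adjoint H a S" if "a \<in> P" for a using P_adjoint[OF that] by blast
    qed
    fix v :: "rat^2" and g :: "rat^2^2" assume g: "det g = 1"
    have "cf (x (T z)) v g = hinner H z (T' (x' (b v g)))"
      using is_adjointD[OF x'(2)] is_adjointD[OF T'(2)] xb x'b Tb T' z g by simp
    also have "\<dots> = hinner H z (x' (T' (b v g)))" using comm_b[OF T'P x'(1) x'K g] by simp
    also have "\<dots> = cf (T (x z)) v g"
      using is_adjointD[OF x'(2)] is_adjointD[OF T'(2)] xb x'b Tb T' z g by simp
    finally show "cf (x (T z)) v g = cf (T (x z)) v g" .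
  qed (use commutantD_bounded[OF T] z xb in simp_all)
  then have "x \<in> commutant H (commutant H P)" using xb by (intro commutantI)
  then show ?thesis using vN_P unfolding von_neumann_algebra_def by simp
qed

section \<open>The projections \<open>eta v\<close> and the exchange identity\<close>

definition eta where "eta v = proj K (b v (mat 1))"

lemma eta_K: "eta v \<in> K"
  unfolding eta_def by (rule proj_in[OF subspc_K hclosed_K]) simp

lemma eta_carrier [simp, intro]: "eta v \<in> carrier H"
  using eta_K K_carrier by blast

lemma inner_eta: "z \<in> K \<Longrightarrow> hinner H z (eta v) = cf z v (mat 1)"
  unfolding eta_def by (rule proj_inner[OF subspc_K hclosed_K]) auto

lemma eta_inner: "z \<in> K \<Longrightarrow> hinner H (eta v) z = hinner H (b v (mat 1)) z"
  unfolding eta_def by (rule proj_inner'[OF subspc_K hclosed_K]) auto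

lemma etaI: "y \<in> K \<Longrightarrow> (\<And>z. z \<in> K \<Longrightarrow> hinner H z y = cf z v (mat 1)) \<Longrightarrow> eta v = y"
  unfolding eta_def by (rule proj_unique[OF subspc_K hclosed_K]) auto

lemma J_eta: "J (eta v) = eta v"
proof (rule etaI[symmetric])
  show "J (eta v) \<in> K" by (rule J_K[OF eta_K])
  fix z assume z: "z \<in> K"
  have zc: "z \<in> carrier H" using K_carrier[OF z] .
  have "hinner H z (J (eta v)) = hinner H (J (J z)) (J (eta v))" using J_J[OF zc] by simp
  also have "\<dots> = hinner H (b v (mat 1)) (J z)" using zc eta_inner[OF J_K[OF z]] by (simp add: J_inner)
  also have "\<dots> = hinner H (J (J z)) (J (b v (mat 1)))" using zc by (simp add: J_inner)
  also have "J (b v (mat 1)) = b v (mat 1)"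
    using J_b[of "mat 1" v] by (simp add: mat_1_mx) (simp flip: mat_1_mx)
  finally show "hinner H z (J (eta v)) = cf z v (mat 1)" using J_J[OF zc] by simp
qed

text \<open>Conjugation by \<open>k\<close> is unitary, preserves \<open>K\<close>, and sends
  \<open>b v (mat 1)\<close> to \<open>b (k *v v) (mat 1)\<close>; so it carries one projection to
  the other.\<close>

lemma Ad_eta:
  assumes k: "det k = 1"
  shows "Lam k (Rho k (eta v)) = eta (k *v v)"
proof (rule etaI[symmetric])
  note k' = inv2[OF k]
  show "Lam k (Rho k (eta v)) \<in> K" using P_K Lam_P Rho_K eta_K k by simp
  fix z assume z: "z \<in> K"
  have zc: "z \<in> carrier H" using K_carrier[OF z] .
  have *: "hinner H z (Lam k (Rho k y)) = hinner H (Rho (inv2 k) (Lam (inv2 k) z)) y" if "y \<in> carrier H" for y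
    using that zc k k'(1) by (simp add: Lam_inner Rho_inner)
  have "Rho (inv2 k) (Lam (inv2 k) z) \<in> K" using P_K Lam_P Rho_K z k' by simp
  then have "hinner H z (Lam k (Rho k (eta v))) = hinner H z (Lam k (Rho k (b v (mat 1))))"
    by (simp add: * inner_eta)
  also have "Lam k (Rho k (b v (mat 1))) = b (k *v v) (mat 1)"
    using k k' by (simp add: Rho_b Lam_b)
  finally show "hinner H z (Lam k (Rho k (eta v))) = cf z (k *v v) (mat 1)" .
qed

lemma cf_eta_Ad:
  assumes k: "det k = 1" and h: "det h = 1"
  shows "cf (eta (k *v v)) z h = cf (eta v) (inv2 k *v z) (inv2 k ** h ** k)"
  using assms inv2(1)[OF k]
  by (simp add: Ad_eta[symmetric] cf_Lam cf_Rho det_mult_1)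

text \<open>The vectors \<open>b 0 g\<close> lie in \<open>K\<close>, so there \<open>eta v\<close>
  has the coefficients of \<open>b v (mat 1)\<close> itself.\<close>

lemma cf_eta_zero: "v \<noteq> 0 \<Longrightarrow> det g = 1 \<Longrightarrow> cf (eta v) 0 g = 0"
  using eta_inner[OF b_zero_K, of g v] by (simp add: b_inner)

text \<open>Let \<open>a n\<close> in \<open>P\<close> have adjoint \<open>S\<close>. While
  \<open>S\<close> acts on \<open>Rho k (eta w)\<close> the result is in \<open>K\<close>, so
  \<open>b v (mat 1)\<close> may be replaced by \<open>eta v\<close>; after moving back,
  \<open>a n (eta v)\<close> is in \<open>K\<close>, so \<open>eta w\<close> may be replaced by
  \<open>R w Om\<close>. In the limit \<open>a n Om\<close> becomes \<open>eta u\<close> and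
  \<open>S Om\<close> becomes \<open>J (eta u)\<close>, which is again \<open>eta u\<close>.\<close>

lemma exchange:
  assumes k: "det k = 1"
  shows "hinner H (R v (eta u)) (Rho k (eta w)) = hinner H (eta v) (Rho k (R w (eta u)))"
proof -
  obtain a where a: "\<And>n. a n \<in> P" "hlim H (\<lambda>n. a n Om) (eta u)" using K_approx[OF eta_K] by blast
  have ab: "a n \<in> bounded_ops H" for n using P_bounded[OF a(1)] .
  have "(\<lambda>n. hinner H (R v (a n Om)) (Rho k (eta w))) \<longlonglongrightarrow> hinner H (R v (eta u)) (Rho k (eta w))"
    by (rule hlim_inner[OF _ _ _ hlim_op[OF R_bounded _ _ a(2)]]) (simp_all add: ab k)
  moreover have "(\<lambda>n. hinner H (eta v) (Rho k (R w (J (a n Om))))) \<longlonglongrightarrow> hinner H (eta v) (Rho k (R w (J (eta u))))"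
    by (rule hlim_inner_right[OF _ _ _ hlim_op[OF Rho_bounded[OF k] _ _ hlim_op[OF R_bounded _ _ hlim_J[OF _ _ a(2)]]]])
      (simp_all add: ab k)
  moreover have "hinner H (R v (a n Om)) (Rho k (eta w)) = hinner H (eta v) (Rho k (R w (J (a n Om))))" for n
  proof -
    note k' = inv2[OF k]
    obtain S where S: "S \<in> P" "is_adjoint H (a n) S" using P_adjoint[OF a(1)] by blast
    have Sb: "S \<in> bounded_ops H" using P_bounded S(1) by blast
    have SOm: "S Om = J (a n Om)" using adjoint_Om[OF _ Sb S(2)] a(1) P_M by blast
    have aM: "a n \<in> M" "S \<in> M" using a(1) S(1) P_M by blast+
    have "hinner H (R v (a n Om)) (Rho k (eta w)) = hinner H (a n (b v (mat 1))) (Rho k (eta w))"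
      using M_R[OF aM(1), of Om v] by (simp add: R_Om)
    also have "\<dots> = hinner H (b v (mat 1)) (S (Rho k (eta w)))"
      using is_adjointD[OF S(2)] k by simp
    also have "\<dots> = hinner H (eta v) (S (Rho k (eta w)))"
      using eta_inner[OF P_K[OF S(1) Rho_K[OF k eta_K]]] by simp
    also have "\<dots> = hinner H (a n (eta v)) (Rho k (eta w))"
      using is_adjointD[OF S(2)] k by simp
    also have "\<dots> = hinner H (Rho (inv2 k) (a n (eta v))) (eta w)"
      using k k'(1) ab by (simp add: Rho_inner)
    also have "\<dots> = hinner H (Rho (inv2 k) (a n (eta v))) (b w (mat 1))"
      by (rule inner_eta[OF Rho_K[OF k'(1) P_K[OF a(1) eta_K]]])
    also have "\<dots> = hinner H (a n (eta v)) (Rho k (R w Om))"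
      using k k'(1) ab by (simp add: Rho_inner R_Om)
    also have "\<dots> = hinner H (eta v) (S (Rho k (R w Om)))"
      using is_adjointD[OF S(2)] k by simp
    also have "S (Rho k (R w Om)) = Rho k (R w (J (a n Om)))"
      using M_Rho[OF aM(2) k, of "R w Om"] M_R[OF aM(2), of Om w] SOm by simp
    finally show ?thesis .
  qed
  ultimately show ?thesis using LIMSEQ_unique by (simp add: J_eta) blast
qed

end

section \<open>Maximality\<close>

definition up :: "rat \<Rightarrow> rat^2^2" where "up s = mx 1 s 0 1"
definition lo :: "rat \<Rightarrow> rat^2^2" where "lo r = mx 1 0 r 1"

lemma det_up_lo [simp]: "det (up s) = 1" "det (lo r) = 1"
  by (simp_all add: up_def lo_def)

lemma inv2_up_lo [simp]: "inv2 (up s) = up (- s)" "inv2 (lo r) = lo (- r)"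
  by (simp_all add: up_def lo_def)

context intermediate
begin

section \<open>Supports of the projections\<close>

lemma support_eta_e1:
  assumes h: "det h = 1" and nz: "cf (eta (vc 1 0)) z h \<noteq> 0"
  shows "h *v vc 1 0 = vc 1 0 \<or> h *v vc 1 0 = - vc 1 0" and "\<exists>t. t \<noteq> 0 \<and> z = t *s vc 1 0"
proof -
  obtain a b c d where h_mx: "h = mx a b c d" by (rule mx_cases)
  obtain p q where z_vc: "z = vc p q" by (rule vc_cases)
  define f where "f i = up (of_nat i) *v z" for i :: nat
  define g where "g i = up (of_nat i) ** h ** up (- of_nat i)" for i :: nat
  have f_vc: "f i = vc (p + of_nat i * q) q" for i
    by (simp add: f_def z_vc up_def)
  have g_mx: "g i = mx (a + of_nat i * c) (b + of_nat i * (d - a) - of_nat i * (of_nat i * c)) c (d - of_nat i * c)" for i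
    by (simp add: g_def h_mx up_def algebra_simps)
  have g_det: "det (g i) = 1" for i
    using h by (simp add: g_def det_mul)
  have const: "cf (eta (vc 1 0)) (f i) (g i) = cf (eta (vc 1 0)) z h" for i
  proof -
    have "cf (eta (up (of_nat i) *v vc 1 0)) (f i) (g i) = cf (eta (vc 1 0)) z h"
      using g_det[of i] by (subst cf_eta_Ad)
        (simp_all add: f_def g_def z_vc h_mx up_def algebra_simps)
    then show ?thesis by (simp add: up_def)
  qed
  have stab: "q = 0 \<and> c = 0 \<and> a = d"
  proof (rule ccontr)
    assume neg: "\<not> (q = 0 \<and> c = 0 \<and> a = d)"
    have "cmod (cf (eta (vc 1 0)) z h) = 0"
    proof (rule no_infinite_constant[OF eta_carrier, of g f "vc 1 0"])
      fix i j :: nat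
      assume ij: "i \<noteq> j" and F: "f i = f j \<or> f i = - f j" and G: "g i = g j \<or> g i = - g j"
      have det: "a * d - b * c = 1" using h by (simp add: h_mx)
      \<comment> \<open>Some entry is affine in \<open>i\<close> with nonzero slope: the first
        coordinate of \<open>f i\<close> if \<open>q\<close> is nonzero, a diagonal entry of
        \<open>g i\<close> if \<open>c\<close> is, and otherwise the upper right entry. Equality up
        to the sign -1 is excluded by a nonzero entry independent of \<open>i\<close>, namely
        \<open>q\<close>, \<open>c\<close> or \<open>a\<close> respectively.\<close>
      show False
      proof (cases "q = 0")
        case False
        then have "of_nat i * q = of_nat j * q" using F by (auto simp: f_vc)
        then show False using False ij by simp
      next
        case q: True
        show False
        proof (cases "c = 0")
          case False
          then have "of_nat i * c = of_nat j * c" using G by (auto simp: g_mx)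
          then show False using False ij by simp
        next
          case c: True
          then have "a \<noteq> 0" using det by auto
          then have "of_nat i * (d - a) = of_nat j * (d - a)" using G c by (auto simp: g_mx)
          then show False using neg q c ij by simp
        qed
      qed
    qed (use g_det const in simp_all)
    then show False using nz by simp
  qed
  then have "a * a = 1" using h by (simp add: h_mx)
  then have "a = 1 \<or> a = - 1" by (simp add: square_eq_1_iff)
  then show "h *v vc 1 0 = vc 1 0 \<or> h *v vc 1 0 = - vc 1 0"
    using stab by (auto simp: h_mx)
  have "p \<noteq> 0"
    using nz cf_eta_zero[of "vc 1 0" h] h stab z_vc by (auto simp: zero_vc)
  then show "\<exists>t. t \<noteq> 0 \<and> z = t *s vc 1 0"
    using stab z_vc by (intro exI[of _ p]) auto
qed

lemma support_eta:
  assumes w: "w \<noteq> 0" and h: "det h = 1" and nz: "cf (eta w) z h \<noteq> 0"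
  shows "h *v w = w \<or> h *v w = - w" and "\<exists>t. t \<noteq> 0 \<and> z = t *s w"
proof -
  obtain k where k: "det k = 1" "k *v vc 1 0 = w" using transitive_e1[OF w] by blast
  note k' = inv2[OF k(1)]
  let ?h = "inv2 k ** h ** k"
  have h': "det ?h = 1" using k k' h by (simp add: det_mul)
  have nz': "cf (eta (vc 1 0)) (inv2 k *v z) ?h \<noteq> 0"
    using nz cf_eta_Ad[OF k(1) h, of "vc 1 0" z] k(2) by simp
  have "k *v (?h *v vc 1 0) = h *v w"
    using k k' by (simp add: k(2)[symmetric] matrix_vector_mul_assoc matrix_mul_assoc)
  moreover have "k *v (- x) = - (k *v x)" for x
    by (cases k rule: mx_cases; cases x rule: vc_cases) simp
  ultimately show "h *v w = w \<or> h *v w = - w"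
    using support_eta_e1(1)[OF h' nz'] k(2) by metis
  obtain t where t: "t \<noteq> 0" "inv2 k *v z = t *s vc 1 0" using support_eta_e1(2)[OF h' nz'] by blast
  have "z = k *v (t *s vc 1 0)" using t(2) inv2_cancel(1)[OF k(1), of z] by simp
  also have "\<dots> = t *s w" unfolding k(2)[symmetric]
    by (cases k rule: mx_cases) (simp add: algebra_simps)
  finally show "\<exists>t. t \<noteq> 0 \<and> z = t *s w" using t(1) by blast
qed

section \<open>The coefficients of \<open>eta e1\<close> and their relations\<close>

definition C where "C y s = cf (eta (vc 1 0)) (vc y 0) (up s)"

lemma upper_cases:
  assumes "det h = 1" "h *v vc 1 0 = vc 1 0 \<or> h *v vc 1 0 = - vc 1 0"
  obtains s where "h = up s \<or> h = - up s"
proof -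
  obtain a b c d where h: "h = mx a b c d" by (rule mx_cases)
  have "h = up b \<or> h = - up (- b)" using assms by (auto simp: h up_def)
  then show ?thesis using that by blast
qed

lemma lower_cases:
  assumes "det h = 1" "h *v vc 0 1 = vc 0 1 \<or> h *v vc 0 1 = - vc 0 1"
  obtains r where "h = lo r \<or> h = - lo r"
proof -
  obtain a b c d where h: "h = mx a b c d" by (rule mx_cases)
  have "h = lo c \<or> h = - lo (- c)" using assms by (auto simp: h lo_def)
  then show ?thesis using that by blast
qed

lemma cf_eta_e2: "cf (eta (vc 0 1)) (vc 0 x) (lo r) = C x (- r)"
proof -
  \<comment> \<open>The quarter turn takes e1 to e2 and conjugates \<open>up (- r)\<close> into
    \<open>lo r\<close>, whence the sign of \<open>r\<close>.\<close>
  let ?k = "mx 0 (-1) 1 0"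
  have "cf (eta (?k *v vc 1 0)) (vc 0 x) (lo r) = cf (eta (vc 1 0)) (inv2 ?k *v vc 0 x) (inv2 ?k ** lo r ** ?k)"
    by (rule cf_eta_Ad) simp_all
  then show ?thesis by (simp add: C_def lo_def up_def)
qed

text \<open>By transitivity every \<open>eta w\<close> is a conjugate of \<open>eta e1\<close>, and
  conjugation fixes the identity matrix.\<close>

lemma cf_eta_multiple:
  assumes "w \<noteq> 0"
  shows "cf (eta w) (t *s w) (mat 1) = C t 0"
proof -
  obtain k where k: "det k = 1" "k *v vc 1 0 = w" using transitive_e1[OF assms] by blast
  have "k *v (t *s vc 1 0) = t *s w" unfolding k(2)[symmetric]
    by (cases k rule: mx_cases) (simp add: algebra_simps)
  then have "inv2 k *v (t *s w) = t *s vc 1 0" using inv2_cancel(2)[OF k(1)] by metis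
  moreover have "inv2 k ** mat 1 ** k = mat 1" using inv2(3)[OF k(1)] by simp
  moreover have "up 0 = mat 1" by (simp add: up_def mat_1_mx)
  ultimately show ?thesis
    using cf_eta_Ad[OF k(1) det_mat_1, of "vc 1 0" "t *s w"] k(2) by (simp add: C_def)
qed

lemma C_minus: "C (- y) s = C y s"
  using cf_even[of "up s" "vc (- y) 0" "vc y 0" "up s"] by (simp add: C_def)

lemma C_zero: "C 0 s = 0"
  using cf_eta_zero[of "vc 1 0" "up s"] by (simp add: C_def zero_vc)

text \<open>The pairing on the right of \<open>exchange\<close> for the choice \<open>v = e1\<close>, \<open>u = e2\<close>, with \<open>k\<close> and \<open>w\<close> chosen
  such that the supports of the two vectors meet in a single frame vector.\<close>

lemma right_pairing:
  assumes y: "y \<noteq> 0"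
  shows "hinner H (eta (vc 1 0)) (Rho (up (- s) ** lo r) (R (lo (- r) *v vc (- y) x) (eta (vc 0 1))))
    = C y s * cnj (C x (- r)) / 2" (is "hinner H ?x (Rho ?k (R ?w ?e)) = _")
proof -
  have k: "det ?k = 1" by (simp add: det_mul)
  have cf: "cf (Rho ?k (R ?w ?e)) z h = cf ?e (z + h ** ?k *v ?w) (h ** ?k) + cf ?e (z - h ** ?k *v ?w) (h ** ?k)"
    if "det h = 1" for z h
    using that k by (simp add: cf_Rho cf_R det_mult_1)
  have "hinner H ?x (Rho ?k (R ?w ?e)) = cf ?x (vc y 0) (up s) * cnj (cf (Rho ?k (R ?w ?e)) (vc y 0) (up s)) / 2"
  proof (rule single_overlap_inner)
    fix z h assume h: "det h = 1" and nz1: "cf ?x z h \<noteq> 0" and nz2: "cf (Rho ?k (R ?w ?e)) z h \<noteq> 0"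
    obtain s' where s': "h = up s' \<or> h = - up s'"
      using upper_cases[OF h] support_eta_e1(1)[OF h nz1] by blast
    obtain t where t: "z = vc t 0" using support_eta_e1(2)[OF h nz1] by auto
    have hk: "det (h ** ?k) = 1" using h k by (rule det_mult_1)
    have "\<exists>z'. cf ?e z' (h ** ?k) \<noteq> 0 \<and> (z' = z + h ** ?k *v ?w \<or> z' = z - h ** ?k *v ?w)"
      using nz2 unfolding cf[OF h] by (metis add.right_neutral)
    then obtain z' where z': "cf ?e z' (h ** ?k) \<noteq> 0" "z' = z + h ** ?k *v ?w \<or> z' = z - h ** ?k *v ?w"
      by blast
    have e2: "vc 0 1 \<noteq> 0" by simp
    \<comment> \<open>Up to sign \<open>h ** ?k\<close> is \<open>up (s' - s) ** lo r\<close>; it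
      can fix e2 up to sign only if its upper right entry \<open>s' - s\<close> is 0.\<close>
    have "s' = s"
      using support_eta(1)[OF e2 hk z'(1)] s' by (auto simp: up_def lo_def)
    moreover obtain t' where "z' = t' *s vc 0 1" using support_eta(2)[OF e2 hk z'(1)] by blast
    ultimately show "(z = vc y 0 \<or> z = - vc y 0) \<and> (h = up s \<or> h = - up s)"
      using z'(2) s' t by (auto simp: up_def lo_def algebra_simps)
  qed (use k y in auto)
  also have "cf (Rho ?k (R ?w ?e)) (vc y 0) (up s) = C x (- r)"
  proof -
    \<comment> \<open>\<open>R ?w\<close> contributes the two indices \<open>vc 0 x\<close> and
      \<open>vc (2 * y) (- x)\<close>; the second is off the line through e2.\<close>
    have "cf ?e (vc (2 * y) (- x)) (lo r) = 0"
      using support_eta(2)[of "vc 0 1" "lo r" "vc (2 * y) (- x)"] y by force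
    moreover have "up s ** ?k = lo r" by (simp add: up_def lo_def)
    moreover have "lo r *v ?w = vc (- y) x" by (simp add: lo_def)
    ultimately show ?thesis by (simp add: cf cf_eta_e2)
  qed
  finally show ?thesis by (simp add: C_def)
qed

text \<open>For the chosen \<open>k\<close> and \<open>w\<close> the right side of
  \<open>exchange\<close> is the product of the two coefficients, while on the left the supports are
  disjoint: a common \<open>h\<close> would be lower unipotent up to sign and \<open>h ** k\<close>
  would fix \<open>w\<close> up to sign, and the first coordinates then give
  \<open>s * x' = 0\<close> or \<open>2 * y + s * x' = 0\<close>.\<close>

lemma not_both_nonzero:
  assumes x: "C x r \<noteq> 0" and y: "C y s \<noteq> 0" and s: "s \<noteq> 0"
  shows False
proof -
  have "y \<noteq> 0" "x \<noteq> 0" using x y C_zero by auto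
  \<comment> \<open>As \<open>y\<close> is nonzero, at most one of \<open>x\<close> and
    \<open>- x\<close> violates the second condition, and \<open>C\<close> is even.\<close>
  obtain x' where x': "C x' r \<noteq> 0" "2 * y + s * x' \<noteq> 0" "x' \<noteq> 0"
  proof (cases "2 * y + s * x = 0")
    case True
    then have "2 * y + s * (- x) \<noteq> 0" using \<open>y \<noteq> 0\<close> by auto
    then show ?thesis using that[of "- x"] x \<open>x \<noteq> 0\<close> by (simp add: C_minus)
  next
    case False
    then show ?thesis using that[of x] x \<open>x \<noteq> 0\<close> by simp
  qed
  let ?k = "up (- s) ** lo (- r)" and ?w = "lo r *v vc (- y) x'"
  have k: "det ?k = 1" by (simp add: det_mul)
  have w: "?w \<noteq> 0" using \<open>y \<noteq> 0\<close> by (simp add: lo_def)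
  have "hinner H (R (vc 1 0) (eta (vc 0 1))) (Rho ?k (eta ?w)) = C y s * cnj (C x' r) / 2"
    unfolding exchange[OF k] using right_pairing[OF \<open>y \<noteq> 0\<close>, of s "- r" x'] by simp
  moreover have "hinner H (R (vc 1 0) (eta (vc 0 1))) (Rho ?k (eta ?w)) = 0"
  proof (rule disjoint_support_orthogonal)
    fix z h assume h: "det (h :: rat^2^2) = 1"
    have hk: "det (h ** ?k) = 1" using h k by (rule det_mult_1)
    show "cf (R (vc 1 0) (eta (vc 0 1))) z h = 0 \<or> cf (Rho ?k (eta ?w)) z h = 0"
    proof (rule ccontr)
      assume nz: "\<not> ?thesis"
      then have "\<exists>z'. cf (eta (vc 0 1)) z' h \<noteq> 0"
        using h by (simp add: cf_R) (metis add.right_neutral)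
      then obtain q where q: "h = lo q \<or> h = - lo q"
        using lower_cases[OF h] support_eta(1)[OF _ h] by (metis vc_eq_0 zero_neq_one)
      have "h ** ?k *v ?w = ?w \<or> h ** ?k *v ?w = - ?w"
        using support_eta(1)[OF w hk, of z] nz cf_Rho[OF k eta_carrier h, of ?w z] by simp
      then show False using q x' s
        by (auto simp: up_def lo_def algebra_simps)
    qed
  qed (use k in simp_all)
  ultimately show False using y x' by simp
qed

text \<open>This is \<open>exchange\<close> with \<open>k\<close> trivial and
  \<open>w = vc (- y) x\<close>. On the left an index must lie on the line through \<open>w\<close>
  and differ by e1 or its negative from a point of the line through e2. Up to sign this leaves
  \<open>vc (-1) (x / y)\<close>, which is \<open>1 / y\<close> times \<open>w\<close>; hence the
  arguments \<open>x / y\<close> and \<open>1 / y\<close>.\<close>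

lemma multiplicative_relation:
  assumes x: "x \<noteq> 0" and y: "y \<noteq> 0"
  shows "C (x / y) 0 * cnj (C (1 / y) 0) = C y 0 * cnj (C x 0)"
proof -
  have I: "mat 1 = up 0" "mat 1 = lo 0" by (simp_all add: up_def lo_def mat_1_mx)
  let ?w = "vc (- y) x"
  have w: "?w \<noteq> 0" using x by simp
  have right: "hinner H (R (vc 1 0) (eta (vc 0 1))) (Rho (mat 1) (eta ?w)) = C y 0 * cnj (C x 0) / 2"
    unfolding exchange[OF det_mat_1] using right_pairing[OF y, of 0 0 x]
    by (simp flip: I)
  have "hinner H (R (vc 1 0) (eta (vc 0 1))) (Rho (mat 1) (eta ?w))
    = cf (R (vc 1 0) (eta (vc 0 1))) (vc (-1) (x / y)) (mat 1) * cnj (cf (Rho (mat 1) (eta ?w)) (vc (-1) (x / y)) (mat 1)) / 2"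
  proof (rule single_overlap_inner)
    fix z h assume h: "det (h :: rat^2^2) = 1" and nz1: "cf (R (vc 1 0) (eta (vc 0 1))) z h \<noteq> 0"
      and nz2: "cf (Rho (mat 1) (eta ?w)) z h \<noteq> 0"
    have "\<exists>z'. cf (eta (vc 0 1)) z' h \<noteq> 0 \<and> (z' = z + h *v vc 1 0 \<or> z' = z - h *v vc 1 0)"
      using nz1 h by (simp add: cf_R) (metis add.right_neutral)
    then obtain z' where z': "cf (eta (vc 0 1)) z' h \<noteq> 0" "z' = z + h *v vc 1 0 \<or> z' = z - h *v vc 1 0"
      by blast
    have e2: "vc 0 1 \<noteq> 0" by simp
    obtain q where q: "h = lo q \<or> h = - lo q"
      using lower_cases[OF h] support_eta(1)[OF e2 h z'(1)] by blast
    obtain t' where t': "z' = t' *s vc 0 1" using support_eta(2)[OF e2 h z'(1)] by blast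
    have nz3: "cf (eta ?w) z h \<noteq> 0" using nz2 h by (simp add: cf_Rho)
    \<comment> \<open>\<open>lo q\<close> fixes \<open>w\<close> up to sign only for
      \<open>q = 0\<close>, because the first coordinate \<open>- y\<close> is nonzero.\<close>
    have "q = 0" using support_eta(1)[OF w h nz3] q x y by (auto simp: lo_def)
    then have h1: "h = mat 1 \<or> h = - mat 1" using q I by simp
    obtain t where t: "z = t *s ?w" using support_eta(2)[OF w h nz3] by blast
    have "t * y = 1 \<or> t * y = - 1"
      using z'(2) h1 t t' by (auto simp: mat_1_mx)
    then have "t = 1 / y \<or> t = - (1 / y)" using y by (auto simp: field_simps)
    then show "(z = vc (-1) (x / y) \<or> z = - vc (-1) (x / y)) \<and> (h = mat 1 \<or> h = - mat 1)"
      using h1 t y by auto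
  qed (use det_mat_1 in simp_all)
  also have "cf (R (vc 1 0) (eta (vc 0 1))) (vc (-1) (x / y)) (mat 1) = C (x / y) 0"
  proof -
    \<comment> \<open>The other index produced by \<open>R (vc 1 0)\<close>, again off the line
      through e2.\<close>
    have "cf (eta (vc 0 1)) (vc (-2) (x / y)) (lo 0) = 0"
      using support_eta(2)[of "vc 0 1" "lo 0" "vc (-2) (x / y)"] by force
    then show ?thesis using cf_eta_e2[of "x / y" 0] by (simp add: cf_R flip: I)
  qed
  also have "cf (Rho (mat 1) (eta ?w)) (vc (-1) (x / y)) (mat 1) = C (1 / y) 0"
    using cf_eta_multiple[OF w, of "1 / y"] y by (simp add: cf_Rho)
  finally show ?thesis using right by simp
qed

lemma C_support:
  assumes y: "C y 0 \<noteq> 0"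
  shows "y = 1 \<or> y = - 1"
proof (rule ccontr)
  assume neq: "\<not> ?thesis"
  have nz: "C x 0 \<noteq> 0 \<Longrightarrow> x \<noteq> 0" for x using C_zero by auto
  define A where "A x = cmod (C x 0)" for x
  have rel: "A (x / y) * A (1 / y) = A y * A x" if "x \<noteq> 0" "y \<noteq> 0" for x y
    using arg_cong[OF multiplicative_relation[OF that], of cmod] by (simp add: norm_mult A_def)
  have Apos: "A x > 0 \<longleftrightarrow> C x 0 \<noteq> 0" and A0: "A x \<ge> 0" for x by (auto simp: A_def)
  have inv_y: "A (1 / x) > 0 \<and> A x = A 1" if x: "A x > 0" for x
  proof -
    have x0: "x \<noteq> 0" using x Apos nz by blast
    \<comment> \<open>The relation at the pairs \<open>x, x\<close> and \<open>1, x\<close> gives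
      two equations between \<open>A x\<close>, \<open>A (1 / x)\<close> and \<open>A 1\<close>;
      eliminating \<open>A (1 / x)\<close> leaves equality of the cubes of \<open>A x\<close> and
      \<open>A 1\<close>.\<close>
    have 1: "A 1 * A (1 / x) = A x * A x" using rel[OF x0 x0] x0 by simp
    have 2: "A (1 / x) * A (1 / x) = A x * A 1" using rel[of 1 x] x0 by simp
    have p: "A 1 > 0" "A (1 / x) > 0"
      using 1 x A0[of 1] A0[of "1 / x"] by(auto simp: less_le)
    have "A x ^ 3 * A x = A 1 ^ 3 * A x"
    proof -
      have "A x ^ 3 * A x = (A x * A x) * (A x * A x)" by (simp add: power3_eq_cube)
      also have "\<dots> = A 1 * A 1 * (A (1 / x) * A (1 / x))" unfolding 1[symmetric] by (simp add: ac_simps)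
      also have "\<dots> = A 1 ^ 3 * A x" unfolding 2 by (simp add: power3_eq_cube ac_simps)
      finally show ?thesis .
    qed
    then have "A x ^ 3 = A 1 ^ 3" using x by simp
    then have "A x = A 1" using A0 by (simp add: power_eq_iff_eq_base)
    then show ?thesis using p by simp
  qed
  have Ay: "A y > 0" using y Apos by blast
  have y0: "y \<noteq> 0" using nz[OF y] .
  have pow: "A (y ^ n) > 0" for n
  proof (induction n)
    case 0
    then show ?case using inv_y[OF Ay] Ay by simp
  next
    case (Suc n)
    \<comment> \<open>With \<open>1 / y\<close> in place of \<open>y\<close> the quotient in the
      relation becomes a product, which allows induction on the power.\<close>
    have "A (y ^ n / (1 / y)) * A (1 / (1 / y)) = A (1 / y) * A (y ^ n)"
      using y0 by (intro rel) auto
    moreover have "A (1 / y) * A (y ^ n) > 0" using inv_y[OF Ay] Suc by simp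
    ultimately have "A (y ^ n / (1 / y)) * A (1 / (1 / y)) > 0" by simp
    then have "A (y ^ n / (1 / y)) > 0" using A0 by (metis less_eq_real_def mult_eq_0_iff less_irrefl)
    then show ?case by (simp add: mult.commute)
  qed
  \<comment> \<open>All powers of \<open>y\<close> carry coefficients of modulus \<open>A 1\<close>,
    and they are distinct up to sign because \<open>y\<close> is nonzero and its absolute value is
    not 1.\<close>
  have "A 1 = 0"
  proof (rule no_infinite_constant[OF eta_carrier, of "\<lambda>_. up 0" "\<lambda>n. vc (y ^ n) 0" "vc 1 0"])
    show "cmod (cf (eta (vc 1 0)) (vc (y ^ n) 0) (up 0)) = A 1" for n
      using inv_y[OF pow[of n]] by (simp add: A_def C_def)
    fix i j :: nat assume ij: "i \<noteq> j" and "vc (y ^ i) 0 = vc (y ^ j) 0 \<or> vc (y ^ i) 0 = - vc (y ^ j) 0"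
    then have eq: "\<bar>y\<bar> ^ i = \<bar>y\<bar> ^ j" by (auto simp: power_abs[symmetric])
    have "\<bar>y\<bar> \<noteq> 1" using neq by auto
    then show False using eq ij y0
      by (metis abs_ge_zero linorder_neqE_nat nless_le zero_less_abs_iff power_strict_increasing_iff power_strict_decreasing
          linorder_neqE not_less_iff_gr_or_eq)
  qed simp_all
  then show False using inv_y[OF Ay] Ay by simp
qed

section \<open>The two alternatives for an intermediate algebra\<close>

lemma eta_e1_dichotomy:
  "(\<forall>z h. det h = 1 \<longrightarrow> cf (eta (vc 1 0)) z h = 0) \<or> b (vc 1 0) (mat 1) \<in> K"
proof (rule disjCI)
  assume K: "b (vc 1 0) (mat 1) \<notin> K"
  have I: "mat 1 = up 0" by (simp add: up_def mat_1_mx)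
  have cases: "\<exists>y s. cf (eta (vc 1 0)) z h = C y s \<and> (z = vc y 0) \<and> (h = up s \<or> h = - up s)"
    if nz: "det h = 1" "cf (eta (vc 1 0)) z h \<noteq> 0" for z h
  proof -
    obtain s where s: "h = up s \<or> h = - up s"
      using upper_cases[OF nz(1)] support_eta_e1(1)[OF nz] by blast
    obtain y where y: "z = vc y 0" using support_eta_e1(2)[OF nz] by auto
    have "b z h = b (vc y 0) (up s)" using cf_even[OF nz(1)] s y by blast
    then show ?thesis using s y by (auto simp: C_def)
  qed
  show "\<forall>z h. det h = 1 \<longrightarrow> cf (eta (vc 1 0)) z h = 0"
  proof (rule ccontr)
    assume "\<not> ?thesis"
    then obtain x r where x: "C x r \<noteq> 0" using cases by metis
    then have C0: "C y s = 0" if "s \<noteq> 0" for y s using not_both_nonzero that by blast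
    have r: "r = 0" using x C0 by blast
    have x1: "C 1 0 \<noteq> 0" using C_support x r C_minus[of 1 0] by fastforce
    \<comment> \<open>Dividing by the squared length 2 of the frame vector turns the coefficient
      into the scalar factor.\<close>
    define c where "c = C 1 0 / 2"
    have e1: "vc 1 0 \<noteq> - vc 1 0" "vc 1 0 \<noteq> 0" by auto
    have bb: "hinner H (b (vc 1 0) (mat 1)) (b (vc 1 0) (mat 1)) = 2"
      using e1 neg_ne[OF det_mat_1] by (subst b_inner) auto
    have "eta (vc 1 0) = hscale H c (b (vc 1 0) (mat 1))"
    proof (rule b_ext)
      fix z h assume h: "det (h :: rat^2^2) = 1"
      show "cf (eta (vc 1 0)) z h = cf (hscale H c (b (vc 1 0) (mat 1))) z h"
      proof (cases "(vc 1 0 = z \<or> vc 1 0 = - z) \<and> (mat 1 = h \<or> mat 1 = - h)")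
        case True
        then have "b (vc 1 0) (mat 1) = b z h" using cf_even[OF det_mat_1] by blast
        then have "cf (eta (vc 1 0)) z h = C 1 0"
          "hinner H (b (vc 1 0) (mat 1)) (b z h) = 2"
          using bb by (simp_all add: C_def I)
        then show ?thesis using h by (simp add: c_def)
      next
        case False
        have "cf (eta (vc 1 0)) z h = 0"
        proof (rule ccontr)
          assume "cf (eta (vc 1 0)) z h \<noteq> 0"
          then obtain y s where ys: "cf (eta (vc 1 0)) z h = C y s" "z = vc y 0" "h = up s \<or> h = - up s" "C y s \<noteq> 0"
            using cases[OF h, of z] by auto
          then have "s = 0" using C0 by blast
          then have "y = 1 \<or> y = - 1" using C_support ys by blast
          then show False using False ys \<open>s = 0\<close> by (auto simp: I)
        qed
        moreover have "hinner H (b (vc 1 0) (mat 1)) (b z h) = 0"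
          using False h by (intro b_inner_zero) auto
        ultimately show ?thesis using h by simp
      qed
    qed simp_all
    then have "hscale H (1 / c) (hscale H c (b (vc 1 0) (mat 1))) \<in> K"
      using eta_K[of "vc 1 0"] subspc_K by (simp add: subspc_def)
    also have "hscale H (1 / c) (hscale H c (b (vc 1 0) (mat 1))) = b (vc 1 0) (mat 1)"
      using x1 by (intro inner_ext) (simp_all add: c_def)
    finally show False using K by simp
  qed
qed

text \<open>Conjugations and right translations carry the given vector to all frame vectors with
  nonzero first index, and those with index 0 are in \<open>K\<close> anyway. So \<open>x\<close>
  and its projection have the same coefficients.\<close>

lemma K_full:
  assumes "b (vc 1 0) (mat 1) \<in> K" and x: "x \<in> carrier H"
  shows "x \<in> K"
proof -
  have b_K: "b v g \<in> K" if g: "det g = 1" for v g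
  proof (cases "v = 0")
    case True
    then show ?thesis using b_zero_K g by simp
  next
    case False
    obtain k where k: "det k = 1" "k *v vc 1 0 = v" using transitive_e1[OF False] by blast
    have "Lam k (Rho k (b (vc 1 0) (mat 1))) \<in> K"
      using P_K[OF Lam_P[OF k(1)] Rho_K[OF k(1) assms(1)]] .
    also have "Lam k (Rho k (b (vc 1 0) (mat 1))) = b v (mat 1)"
      using k inv2[OF k(1)] by (simp add: Rho_b Lam_b)
    finally show ?thesis using Rho_K[OF inv2(1)[OF g]] b_eq[OF g] by metis
  qed
  have "x = proj K x"
  proof (rule b_ext)
    show "proj K x \<in> carrier H" by (rule proj_carrier[OF subspc_K hclosed_K x])
    show "cf x v g = cf (proj K x) v g" if "det g = 1" for v g
      using proj_inner'[OF subspc_K hclosed_K x b_K[OF that]] by simp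
  qed (rule x)
  then show ?thesis using proj_in[OF subspc_K hclosed_K x] by simp
qed

text \<open>A right translation reduces to \<open>g = mat 1\<close>, where pairing with
  \<open>b w (mat 1)\<close> is pairing with \<open>eta w\<close>, a conjugate of the vanishing
  \<open>eta e1\<close>.\<close>

lemma orbit_perp:
  assumes "\<forall>z h. det h = 1 \<longrightarrow> cf (eta (vc 1 0)) z h = 0"
    and T: "T \<in> P" and w: "w \<noteq> 0" and g: "det g = 1"
  shows "cf (T Om) w g = 0"
proof -
  obtain k where k: "det k = 1" "k *v vc 1 0 = w" using transitive_e1[OF w] by blast
  have "cf (eta w) z h = 0" if "det h = 1" for z h
    using cf_eta_Ad[OF k(1) that, of "vc 1 0" z] k assms(1) inv2(1)[OF k(1)] that by (simp add: det_mul)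
  then have "hnsq H (eta w) = 0" using b_total[OF eta_carrier] by blast
  have TK: "T Om \<in> K" using P_K[OF T Om_K] .
  have "cf (T Om) w g = cf (Rho g (T Om)) w (mat 1)"
    using g inv2(1)[OF g] K_carrier[OF TK] b_eq[OF g, of w] by (simp add: Rho_inner)
  also have "\<dots> = hinner H (Rho g (T Om)) (eta w)"
    using inner_eta[OF Rho_K[OF g TK]] by simp
  also have "\<dots> = 0"
    using nsq_zero_inner[of "eta w" "Rho g (T Om)"] \<open>hnsq H (eta w) = 0\<close> K_carrier[OF TK] g
      cmod_inner_commute[of "eta w" "Rho g (T Om)"] by simp
  finally show ?thesis .
qed

end

context frame
begin

text \<open>\<open>N\<close> is itself intermediate, so the criterion
  \<open>in_P_if_orbit_in_K\<close> applies with \<open>N\<close> as \<open>P\<close>; in the first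
  alternative this puts the elements of \<open>P\<close> into \<open>N\<close>.\<close>

lemma intermediate_N: "intermediate H Om b Lam Rho R J Mul N"
proof
  show "von_neumann_algebra H N" by (rule vN_N)
  show "N \<subseteq> M" by (rule N_subset_M)
  show "Lam g \<in> N" if "det g = 1" for g
    using that vN_generated_superset[of "Lam ` {g. det g = 1}" H] unfolding N_def by blast
qed

text \<open>In the application these are the functions constant along \<open>Y\<close>, a copy of
  the square-summable functions on the group.\<close>

definition fixed_space :: "'h set" where
  "fixed_space = {x \<in> carrier H. \<forall>w g. w \<noteq> 0 \<longrightarrow> det g = 1 \<longrightarrow> cf x w g = 0}"

text \<open>The projection to \<open>fixed_space\<close> commutes with every \<open>Lam g\<close>,
  so all of \<open>N\<close> lies in its commutant; \<open>Om\<close> is fixed by this projection,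
  hence so is \<open>T Om\<close>.\<close>

lemma N_orbit:
  assumes T: "T \<in> N"
  shows "T Om \<in> fixed_space"
proof -
  let ?K = fixed_space
  have sK: "subspc ?K"
    unfolding subspc_def
  proof (intro conjI ballI allI)
    have "hscale H 0 Om \<in> ?K" by (simp add: fixed_space_def)
    then show "?K \<noteq> {}" by blast
  qed (auto simp: fixed_space_def)
  have cK: "hclosed ?K"
    unfolding hclosed_def
  proof (intro allI impI)
    fix X z assume X: "\<forall>n. X n \<in> ?K" and z: "z \<in> carrier H" "hlim H X z"
    have "cf z v g = 0" if "v \<noteq> 0" "det g = 1" for v g
    proof -
      have "(\<lambda>n. cf (X n) v g) \<longlonglongrightarrow> cf z v g"
        using X z that by (intro hlim_inner) (auto simp: fixed_space_def)
      then show ?thesis using X that by (simp add: fixed_space_def LIMSEQ_const_iff)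
    qed
    then show "z \<in> ?K" using z by (simp add: fixed_space_def)
  qed
  have Lam_K: "Lam g x \<in> ?K" if g: "det g = 1" and x: "x \<in> ?K" for g x
  proof -
    have "cf (Lam g x) w h = 0" if "w \<noteq> 0" "det h = 1" for w h
    proof -
      have "inv2 g *v w \<noteq> 0" using inv2_cancel(1)[OF g, of w] that by auto
      moreover have "det (inv2 g ** h) = 1" using inv2(1)[OF g] that by (simp add: det_mul)
      ultimately show ?thesis using x g that by (simp add: cf_Lam fixed_space_def)
    qed
    then show ?thesis using x g by (simp add: fixed_space_def)
  qed
  have pb: "proj ?K \<in> bounded_ops H" by (rule proj_bounded[OF sK cK])
  have "is_adjoint H (proj ?K) (proj ?K)"
    unfolding is_adjoint_def
    using proj_inner[OF sK cK] proj_inner'[OF sK cK] proj_in[OF sK cK] by metis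
  then have "von_neumann_algebra H (commutant H {proj ?K})"
    using pb by (intro vN_commutant) auto
  moreover have "Lam ` {g. det g = 1} \<subseteq> commutant H {proj ?K}"
  proof
    fix S assume "S \<in> Lam ` {g. det g = 1}"
    then obtain g where g: "det g = 1" "S = Lam g" by blast
    note g' = inv2[OF g(1)]
    have "proj ?K (Lam g x) = Lam g (proj ?K x)" if x: "x \<in> carrier H" for x
    proof (rule proj_unique[OF sK cK])
      show "Lam g (proj ?K x) \<in> ?K" by (rule Lam_K[OF g(1) proj_in[OF sK cK x]])
      fix z assume z: "z \<in> ?K"
      have zc: "z \<in> carrier H" using z by (simp add: fixed_space_def)
      have "hinner H z (Lam g y) = hinner H (Lam (inv2 g) z) y" if "y \<in> carrier H" for y
        using Lam_inner[OF g'(1) zc that] by simp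
      then show "hinner H z (Lam g (proj ?K x)) = hinner H z (Lam g x)"
        using x proj_inner[OF sK cK x Lam_K[OF g'(1) z]] proj_carrier[OF sK cK x] by simp
    qed (use g x in simp)
    then show "S \<in> commutant H {proj ?K}"
      using g by (intro commutantI) simp_all
  qed
  ultimately have "N \<subseteq> commutant H {proj ?K}" unfolding N_def by (rule vN_generated_least)
  then have TK: "T \<in> commutant H {proj ?K}" using T by blast
  have "cf Om w g = 0" if "w \<noteq> 0" "det g = 1" for w g
  proof -
    have "2 * cf Om w g = cf (b 0 (mat 1)) w g" using that by (simp add: b_zero)
    also have "\<dots> = 0" using that by (intro b_inner_zero) auto
    finally show ?thesis by simp
  qed
  then have "Om \<in> ?K" by (simp add: fixed_space_def)
  then have "T Om = proj ?K (T Om)"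
    using commutantD[OF TK _ Om_closed] proj_id[OF sK cK] by simp
  then show ?thesis
    using proj_in[OF sK cK, of "T Om"] commutantD_bounded[OF TK] by simp
qed

theorem intermediate_dichotomy:
  assumes "von_neumann_algebra H P" "N \<subseteq> P" "P \<subseteq> M"
  shows "P = N \<or> P = M"
proof -
  have NI: "intermediate H Om b Lam Rho R J Mul N" by (rule intermediate_N)
  have Lam_N: "Lam g \<in> N" if "det g = 1" for g using intermediate.Lam_P[OF NI that] .
  have PI: "intermediate H Om b Lam Rho R J Mul P"
  proof
    show "Lam g \<in> P" if "det g = 1" for g using Lam_N[OF that] assms(2) by blast
  qed (use assms in simp_all)
  have Pb: "T \<in> bounded_ops H" if "T \<in> P" for T using M_bounded assms(3) that by blast
  from intermediate.eta_e1_dichotomy[OF PI] show ?thesis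
  proof
    assume full: "b (vc 1 0) (mat 1) \<in> intermediate.K H Om P"
    have "T \<in> P" if T: "T \<in> M" for T
      using intermediate.in_P_if_orbit_in_K[OF PI T] intermediate.K_full[OF PI full, of "T Om"]
        M_bounded[OF T] by simp
    then show ?thesis using assms(3) by blast
  next
    assume 0: "\<forall>z h. det h = 1 \<longrightarrow> cf (intermediate.eta H Om b P (vc 1 0)) z h = 0"
    let ?K = "intermediate.K H Om N"
    note sK = intermediate.subspc_K[OF NI] and cK = intermediate.hclosed_K[OF NI]
    have perp: "cf y w g = 0" if y: "y \<in> ?K" and w: "w \<noteq> 0" and g: "det g = 1" for y w g
    proof -
      have "hinner H (b w g) y = 0"
      proof (rule inner_hcl_zero[OF intermediate.V_carrier[OF NI]])
        show "y \<in> hcl (intermediate.V Om N)" using y by (simp add: intermediate.K_def[OF NI])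
        fix v assume "v \<in> intermediate.V Om N"
        then obtain T where T: "T \<in> N" "v = T Om" unfolding intermediate.V_def[OF NI] by blast
        have "cf v w g = 0" "v \<in> carrier H" using N_orbit[OF T(1)] T(2) w g unfolding fixed_space_def by auto
        then show "hinner H (b w g) v = 0" using inner_commute[of v "b w g"] g by simp
      qed (use g in simp)
      then show ?thesis using inner_commute[of "b w g" y] intermediate.K_carrier[OF NI y] g by simp
    qed
    have "T \<in> N" if T: "T \<in> P" for T
    proof (rule intermediate.in_P_if_orbit_in_K[OF NI])
      show "T \<in> M" using T assms(3) by blast
      have TOm: "T Om \<in> carrier H" using Pb[OF T] by simp
      have pc: "proj ?K (T Om) \<in> carrier H" by (rule proj_carrier[OF sK cK TOm])
      \<comment> \<open>At first index 0 the projection keeps coefficients because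
        \<open>b 0 g\<close> lies in \<open>?K\<close>; at every other index both sides vanish, by
        \<open>orbit_perp\<close> for \<open>P\<close> and \<open>perp\<close> for
        \<open>N\<close>.\<close>
      have "T Om = proj ?K (T Om)"
      proof (rule b_ext[OF TOm pc])
        fix w g assume g: "det (g :: rat^2^2) = 1"
        show "cf (T Om) w g = cf (proj ?K (T Om)) w g"
        proof (cases "w = 0")
          case True
          then show ?thesis
            using proj_inner'[OF sK cK TOm intermediate.b_zero_K[OF NI g]] by simp
        next
          case False
          then show ?thesis
            using intermediate.orbit_perp[OF PI 0 T False g] perp[OF proj_in[OF sK cK TOm] False g] by simp
        qed
      qed
      then show "T Om \<in> ?K" using proj_in[OF sK cK TOm] by simp
    qed
    then show ?thesis using assms(2) by blast
  qed
qed

theorem maximal_N: "maximal_vN_subalgebra H N M"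
  unfolding maximal_vN_subalgebra_def
proof (intro conjI allI impI)
  show "von_neumann_algebra H N" "von_neumann_algebra H M" by (rule vN_N, rule vN_M)
  \<comment> \<open>Multiplication by \<open>U e1\<close> separates \<open>M\<close> from
    \<open>N\<close>.\<close>
  obtain T where T: "T \<in> Mul" "T Om = b (vc 1 0) (mat 1)" using Mul_Om by blast
  have "T \<in> M" using T(1) vN_generated_superset[of "Mul \<union> Lam ` {g. det g = 1}" H] unfolding M_def by blast
  moreover have "T \<notin> N"
  proof
    assume "T \<in> N"
    then have "cf (T Om) (vc 1 0) (mat 1) = 0" using N_orbit unfolding fixed_space_def by auto
    then show False unfolding T(2) using neg_ne[OF det_mat_1] by (subst (asm) b_inner) auto
  qed
  ultimately show "N \<subset> M" using N_subset_M by blast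
  show "P = N \<or> P = M" if "von_neumann_algebra H P \<and> N \<subseteq> P \<and> P \<subseteq> M" for P
    using intermediate_dichotomy that by blast
qed

end

section \<open>Square-integrable functions modulo null sets\<close>

lemma borel_measurable_cnj [measurable (raw)]: "f \<in> borel_measurable M \<Longrightarrow> (\<lambda>x. cnj (f x)) \<in> borel_measurable M"
  by (rule borel_measurable_continuous_on[OF continuous_on_cnj[OF continuous_on_id]])

lemma square_integrable_measurable [measurable_dest]: "f \<in> square_integrable M \<Longrightarrow> f \<in> borel_measurable M"
  by (simp add: square_integrable_def)

lemma square_integrable_integrable: "f \<in> square_integrable M \<Longrightarrow> integrable M (\<lambda>x. (cmod (f x))\<^sup>2)"
  by (simp add: square_integrable_def)

lemma square_integrable_bound:
  assumes [measurable]: "f \<in> borel_measurable M" and "integrable M h" "AE x in M. (cmod (f x))\<^sup>2 \<le> h x"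
  shows "f \<in> square_integrable M"
  unfolding square_integrable_def
proof (intro CollectI conjI)
  show "integrable M (\<lambda>x. (cmod (f x))\<^sup>2)"
    using assms(2) by (rule Bochner_Integration.integrable_bound) (use assms(3) in \<open>auto elim!: eventually_mono\<close>)
qed (rule assms(1))

lemma cmod_add_square_le: "(cmod (a + b))\<^sup>2 \<le> 2 * (cmod a)\<^sup>2 + 2 * (cmod b)\<^sup>2"
proof -
  have "(cmod (a + b))\<^sup>2 \<le> (cmod a + cmod b)\<^sup>2" by (intro power_mono norm_triangle_ineq) simp
  also have "\<dots> \<le> 2 * (cmod a)\<^sup>2 + 2 * (cmod b)\<^sup>2"
    using sum_squares_bound[of "cmod a" "cmod b"] by (simp add: power2_sum)
  finally show ?thesis .
qed

lemma square_integrable_add: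
  assumes f: "f \<in> square_integrable M" and g: "g \<in> square_integrable M"
  shows "(\<lambda>x. f x + g x) \<in> square_integrable M"
proof (rule square_integrable_bound)
  show "(\<lambda>x. f x + g x) \<in> borel_measurable M" using f g by measurable
  show "integrable M (\<lambda>x. 2 * (cmod (f x))\<^sup>2 + 2 * (cmod (g x))\<^sup>2)"
    using square_integrable_integrable[OF f] square_integrable_integrable[OF g] by simp
qed (simp add: cmod_add_square_le)

lemma square_integrable_scale:
  assumes f: "f \<in> square_integrable M"
  shows "(\<lambda>x. c * f x) \<in> square_integrable M"
proof (rule square_integrable_bound)
  show "(\<lambda>x. c * f x) \<in> borel_measurable M" using f by measurable
  show "integrable M (\<lambda>x. (cmod c)\<^sup>2 * (cmod (f x))\<^sup>2)"
    using f by (auto dest: square_integrable_integrable)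
qed (simp add: norm_mult power_mult_distrib)

lemma square_integrable_diff:
  assumes f: "f \<in> square_integrable M" and g: "g \<in> square_integrable M"
  shows "(\<lambda>x. f x - g x) \<in> square_integrable M"
  using square_integrable_add[OF f square_integrable_scale[OF g, of "-1"]] by simp

lemma square_integrable_cnj:
  assumes f: "f \<in> square_integrable M"
  shows "(\<lambda>x. cnj (f x)) \<in> square_integrable M"
proof (rule square_integrable_bound)
  show "(\<lambda>x. cnj (f x)) \<in> borel_measurable M" using f by measurable
  show "integrable M (\<lambda>x. (cmod (f x))\<^sup>2)" using f by (rule square_integrable_integrable)
qed simp

lemma integrable_inner:
  assumes f: "f \<in> square_integrable M" and g: "g \<in> square_integrable M"
  shows "integrable M (\<lambda>x. f x * cnj (g x))"
proof (rule Bochner_Integration.integrable_bound)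
  show "integrable M (\<lambda>x. (cmod (f x))\<^sup>2 + (cmod (g x))\<^sup>2)"
    using f g by (auto dest: square_integrable_integrable)
  show "(\<lambda>x. f x * cnj (g x)) \<in> borel_measurable M"
    using f[THEN square_integrable_measurable] g[THEN square_integrable_measurable] by measurable
  have "cmod (f x * cnj (g x)) \<le> (cmod (f x))\<^sup>2 + (cmod (g x))\<^sup>2" for x
  proof -
    have "2 * (cmod (f x) * cmod (g x)) \<le> (cmod (f x))\<^sup>2 + (cmod (g x))\<^sup>2"
      using sum_squares_bound[of "cmod (f x)" "cmod (g x)"] by (simp add: mult.assoc)
    moreover have "0 \<le> cmod (f x) * cmod (g x)" by simp
    ultimately show ?thesis unfolding norm_mult complex_mod_cnj by linarith
  qed
  then show "AE x in M. norm (f x * cnj (g x)) \<le> norm ((cmod (f x))\<^sup>2 + (cmod (g x))\<^sup>2)"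
    by (intro AE_I2) (simp add: abs_of_nonneg)
qed

lemma equiv_ae_eq_rel: "equiv (square_integrable M) (ae_eq_rel M)"
proof (rule equivI)
  show "ae_eq_rel M \<subseteq> square_integrable M \<times> square_integrable M" by (auto simp: ae_eq_rel_def)
  show "refl_on (square_integrable M) (ae_eq_rel M)" by (auto simp: ae_eq_rel_def refl_on_def)
  show "sym (ae_eq_rel M)" by (auto simp: ae_eq_rel_def sym_def elim!: eventually_mono)
  show "trans (ae_eq_rel M)"
    unfolding trans_def ae_eq_rel_def by clarsimp
qed

lemma L2_class_eq_iff:
  "f \<in> square_integrable M \<Longrightarrow> g \<in> square_integrable M \<Longrightarrow>
   L2_class M f = L2_class M g \<longleftrightarrow> (AE x in M. f x = g x)"
  unfolding L2_class_def using eq_equiv_class_iff[OF equiv_ae_eq_rel, of f M g] by (auto simp: ae_eq_rel_def)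

lemma L2_class_carrier [simp, intro]: "f \<in> square_integrable M \<Longrightarrow> L2_class M f \<in> carrier (L2 M)"
  by (simp add: L2_def L2_class_def quotientI)

lemma L2_cases:
  assumes "\<xi> \<in> carrier (L2 M)"
  obtains f where "f \<in> square_integrable M" "\<xi> = L2_class M f"
  using assms by (auto simp: L2_def L2_class_def elim!: quotientE)

lemma L2_rep_class:
  assumes "f \<in> square_integrable M"
  shows "L2_rep (L2_class M f) \<in> square_integrable M" "AE x in M. L2_rep (L2_class M f) x = f x"
proof -
  have "f \<in> L2_class M f" using assms by (simp add: L2_class_def ae_eq_rel_def)
  then have "L2_rep (L2_class M f) \<in> L2_class M f" unfolding L2_rep_def
    by (rule someI[where P = "\<lambda>g. g \<in> L2_class M f"])
  then show "L2_rep (L2_class M f) \<in> square_integrable M" "AE x in M. L2_rep (L2_class M f) x = f x"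
    by (auto simp: L2_class_def ae_eq_rel_def elim!: eventually_mono)
qed

lemma L2_rep_carrier:
  assumes "\<xi> \<in> carrier (L2 M)"
  shows "L2_rep \<xi> \<in> square_integrable M" "L2_class M (L2_rep \<xi>) = \<xi>"
proof -
  obtain f where f: "f \<in> square_integrable M" "\<xi> = L2_class M f" using assms by (rule L2_cases)
  show "L2_rep \<xi> \<in> square_integrable M" "L2_class M (L2_rep \<xi>) = \<xi>"
    using L2_rep_class[OF f(1)] f by (simp_all only: L2_class_eq_iff)
qed

lemma L2_add:
  assumes f: "f \<in> square_integrable M" and g: "g \<in> square_integrable M"
  shows "hadd (L2 M) (L2_class M f) (L2_class M g) = L2_class M (\<lambda>x. f x + g x)"
proof -
  have "AE x in M. L2_rep (L2_class M f) x + L2_rep (L2_class M g) x = f x + g x"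
    using L2_rep_class(2)[OF f] L2_rep_class(2)[OF g] by eventually_elim simp
  then show ?thesis
    using L2_rep_class(1)[OF f] L2_rep_class(1)[OF g] f g
    by (simp add: L2_def L2_class_eq_iff square_integrable_add)
qed

lemma L2_scale:
  assumes f: "f \<in> square_integrable M"
  shows "hscale (L2 M) c (L2_class M f) = L2_class M (\<lambda>x. c * f x)"
proof -
  have "AE x in M. c * L2_rep (L2_class M f) x = c * f x"
    using L2_rep_class(2)[OF f] by eventually_elim simp
  then show ?thesis
    using L2_rep_class(1)[OF f] f by (simp add: L2_def L2_class_eq_iff square_integrable_scale)
qed

lemma L2_sub:
  assumes f: "f \<in> square_integrable M" and g: "g \<in> square_integrable M"
  shows "hsub (L2 M) (L2_class M f) (L2_class M g) = L2_class M (\<lambda>x. f x - g x)"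
  unfolding hsub_def L2_scale[OF g] L2_add[OF f square_integrable_scale[OF g]] by simp

lemma L2_inner:
  assumes f: "f \<in> square_integrable M" and g: "g \<in> square_integrable M"
  shows "hinner (L2 M) (L2_class M f) (L2_class M g) = (LINT x|M. f x * cnj (g x))"
proof -
  have "AE x in M. L2_rep (L2_class M f) x * cnj (L2_rep (L2_class M g) x) = f x * cnj (g x)"
    using L2_rep_class(2)[OF f] L2_rep_class(2)[OF g] by eventually_elim simp
  moreover have "(\<lambda>x. L2_rep (L2_class M f) x * cnj (L2_rep (L2_class M g) x)) \<in> borel_measurable M"
    "(\<lambda>x. f x * cnj (g x)) \<in> borel_measurable M"
    using f g L2_rep_class(1)[OF f] L2_rep_class(1)[OF g]
    by (auto dest!: square_integrable_measurable)
  ultimately show ?thesis by (simp add: L2_def) (rule integral_cong_AE)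
qed

lemma L2_hnsq:
  assumes f: "f \<in> square_integrable M"
  shows "hnsq (L2 M) (L2_class M f) = (LINT x|M. (cmod (f x))\<^sup>2)"
proof -
  have "hinner (L2 M) (L2_class M f) (L2_class M f) = (LINT x|M. of_real ((cmod (f x))\<^sup>2))"
    unfolding L2_inner[OF f f] by (intro Bochner_Integration.integral_cong refl) (simp only: complex_norm_square)
  also have "\<dots> = of_real (LINT x|M. (cmod (f x))\<^sup>2)" by (rule integral_complex_of_real)
  finally show ?thesis by (simp add: hnsq_def)
qed

text \<open>A subsequence with rapidly decreasing steps converges almost everywhere, and Fatou's
  lemma carries the Cauchy estimates over to its limit.\<close>

lemma Riesz_Fischer:
  assumes f: "\<And>n. f n \<in> square_integrable M"
    and Cauchy: "\<And>e. 0 < e \<Longrightarrow> \<exists>N. \<forall>m\<ge>N. \<forall>n\<ge>N. (LINT x|M. (cmod (f m x - f n x))\<^sup>2) < e"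
  shows "\<exists>g\<in>square_integrable M. (\<lambda>n. LINT x|M. (cmod (f n x - g x))\<^sup>2) \<longlonglongrightarrow> 0"
proof -
  have [measurable]: "f n \<in> borel_measurable M" for n using f by (rule square_integrable_measurable)
  have int: "integrable M (\<lambda>x. (cmod (f m x - f n x))\<^sup>2)" for m n
    using square_integrable_diff[OF f f] by (rule square_integrable_integrable)
  have nn: "(\<integral>\<^sup>+x. ennreal ((cmod (f m x - f n x))\<^sup>2) \<partial>M) = ennreal (LINT x|M. (cmod (f m x - f n x))\<^sup>2)" for m n
    by (rule nn_integral_eq_integral[OF int]) simp
  \<comment> \<open>The base \<open>1/8\<close> leaves a summable series after multiplication by the
    weight \<open>2 ^ k\<close> below, since the product is \<open>(1/4) ^ k\<close>.\<close>
  obtain N where N: "\<And>k m n. m \<ge> N k \<Longrightarrow> n \<ge> N k \<Longrightarrow> (LINT x|M. (cmod (f m x - f n x))\<^sup>2) < (1/8) ^ k"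
    using Cauchy[of "(1/8) ^ k" for k] by (metis zero_less_divide_1_iff zero_less_numeral zero_less_power)
  \<comment> \<open>The sum puts both \<open>r k\<close> and \<open>r (Suc k)\<close> beyond
    \<open>N k\<close>, which bounds the step \<open>d k\<close>; the summand \<open>k\<close> makes
    \<open>r\<close> unbounded, as the Fatou argument requires.\<close>
  define r where "r k = k + (\<Sum>i\<le>k. N i)" for k
  have r: "r k \<ge> N k" "r (Suc k) \<ge> N k" "r k \<ge> k" for k
  proof -
    have "N k \<le> (\<Sum>i\<le>k. N i)" by (rule member_le_sum) auto
    then show "r k \<ge> N k" "r (Suc k) \<ge> N k" "r k \<ge> k" by (simp_all add: r_def)
  qed
  define d where "d k x = f (r (Suc k)) x - f (r k) x" for k x
  have [measurable]: "d k \<in> borel_measurable M" for k unfolding d_def by measurable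
  have "(\<integral>\<^sup>+x. (\<Sum>k. ennreal (2 ^ k * (cmod (d k x))\<^sup>2)) \<partial>M) = (\<Sum>k. \<integral>\<^sup>+x. ennreal (2 ^ k * (cmod (d k x))\<^sup>2) \<partial>M)"
    by (rule nn_integral_suminf) measurable
  also have "\<dots> \<le> (\<Sum>k. ennreal ((1/4) ^ k))"
  proof (intro suminf_le allI)
    fix k
    have "(\<integral>\<^sup>+x. ennreal (2 ^ k * (cmod (d k x))\<^sup>2) \<partial>M) = ennreal (2 ^ k) * (\<integral>\<^sup>+x. ennreal ((cmod (d k x))\<^sup>2) \<partial>M)"
      by (simp add: ennreal_mult nn_integral_cmult)
    also have "\<dots> \<le> ennreal (2 ^ k) * ennreal ((1/8) ^ k)"
      unfolding d_def nn using N[OF r(2) r(1), of k] by (intro mult_left_mono ennreal_leI) auto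
    also have "\<dots> = ennreal ((1/4) ^ k)"
      by (simp add: ennreal_mult[symmetric] power_mult_distrib[symmetric])
    finally show "(\<integral>\<^sup>+x. ennreal (2 ^ k * (cmod (d k x))\<^sup>2) \<partial>M) \<le> ennreal ((1/4) ^ k)" .
  qed auto
  also have "\<dots> = ennreal (\<Sum>k. (1/4) ^ k)" by (intro suminf_ennreal2) (auto intro: summable_geometric)
  finally have "(\<integral>\<^sup>+x. (\<Sum>k. ennreal (2 ^ k * (cmod (d k x))\<^sup>2)) \<partial>M) \<noteq> \<infinity>"
    by (auto simp: top_unique)
  then have "AE x in M. (\<Sum>k. ennreal (2 ^ k * (cmod (d k x))\<^sup>2)) \<noteq> \<infinity>"
    by (intro nn_integral_PInf_AE) measurable
  then have conv: "AE x in M. convergent (\<lambda>k. f (r k) x)"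
  proof eventually_elim
    fix x assume "(\<Sum>k. ennreal (2 ^ k * (cmod (d k x))\<^sup>2)) \<noteq> \<infinity>"
    then have "summable (\<lambda>k. 2 ^ k * (cmod (d k x))\<^sup>2)"
      by (intro summable_suminf_not_top) auto
    then have "summable (\<lambda>k. 2 ^ k * (cmod (d k x))\<^sup>2 + (1/2) ^ k)"
      by (intro summable_add summable_geometric) auto
    \<comment> \<open>AM-GM: \<open>2 |d| \<le> 2\<^sup>k |d|\<^sup>2 + 2\<^sup>-\<^sup>k\<close>, which avoids Minkowski's inequality\<close>
    then have "summable (\<lambda>k. d k x)"
    proof (rule summable_comparison_test'[where N = 0])
      fix k :: nat
      have "0 \<le> (2 ^ k * cmod (d k x) - 1)\<^sup>2" by simp
      then have "2 * 2 ^ k * cmod (d k x) \<le> 2 ^ k * 2 ^ k * (cmod (d k x))\<^sup>2 + 1"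
        by (simp add: power2_eq_square algebra_simps)
      then have "2 * cmod (d k x) \<le> 2 ^ k * (cmod (d k x))\<^sup>2 + (1/2) ^ k"
        by (simp add: field_simps power_one_over)
      then show "norm (d k x) \<le> 2 ^ k * (cmod (d k x))\<^sup>2 + (1/2) ^ k" using norm_ge_zero[of "d k x"] by linarith
    qed
    then have "convergent (\<lambda>n. \<Sum>k<n. d k x)" by (simp add: summable_iff_convergent)
    moreover have "(\<Sum>k<n. d k x) = f (r n) x - f (r 0) x" for n
      unfolding d_def by (rule sum_lessThan_telescope)
    ultimately have "convergent (\<lambda>n. f (r n) x - f (r 0) x + f (r 0) x)"
      by (intro convergent_add convergent_const) simp
    then show "convergent (\<lambda>k. f (r k) x)" by simp
  qed
  define g where "g x = lim (\<lambda>k. f (r k) x)" for x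
  have [measurable]: "g \<in> borel_measurable M" unfolding g_def by measurable
  have lim: "AE x in M. (\<lambda>k. f (r k) x) \<longlonglongrightarrow> g x"
    using conv by eventually_elim (simp add: g_def convergent_LIMSEQ_iff)
  have Fatou: "(\<integral>\<^sup>+x. ennreal ((cmod (f n x - g x))\<^sup>2) \<partial>M) \<le> ennreal e"
    if e: "0 < e" and n: "\<forall>m\<ge>K. \<forall>n\<ge>K. (LINT x|M. (cmod (f m x - f n x))\<^sup>2) < e" "n \<ge> K" for e K n
  proof -
    have "(\<integral>\<^sup>+x. ennreal ((cmod (f n x - g x))\<^sup>2) \<partial>M)
        = (\<integral>\<^sup>+x. liminf (\<lambda>k. ennreal ((cmod (f n x - f (r k) x))\<^sup>2)) \<partial>M)"
    proof (rule nn_integral_cong_AE)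
      show "AE x in M. ennreal ((cmod (f n x - g x))\<^sup>2) = liminf (\<lambda>k. ennreal ((cmod (f n x - f (r k) x))\<^sup>2))"
        using lim
      proof eventually_elim
        fix x assume "(\<lambda>k. f (r k) x) \<longlonglongrightarrow> g x"
        then have "(\<lambda>k. ennreal ((cmod (f n x - f (r k) x))\<^sup>2)) \<longlonglongrightarrow> ennreal ((cmod (f n x - g x))\<^sup>2)"
          by (intro tendsto_intros)
        then show "ennreal ((cmod (f n x - g x))\<^sup>2) = liminf (\<lambda>k. ennreal ((cmod (f n x - f (r k) x))\<^sup>2))"
          by (rule lim_imp_Liminf[OF sequentially_bot, symmetric])
      qed
    qed
    also have "\<dots> \<le> liminf (\<lambda>k. \<integral>\<^sup>+x. ennreal ((cmod (f n x - f (r k) x))\<^sup>2) \<partial>M)"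
      by (rule nn_integral_liminf) measurable
    also have "\<dots> \<le> ennreal e"
    proof (rule Liminf_le)
      have "(\<integral>\<^sup>+x. ennreal ((cmod (f n x - f (r k) x))\<^sup>2) \<partial>M) \<le> ennreal e" if "k \<ge> K" for k
        unfolding nn using n that r(3)[of k] by (intro ennreal_leI less_imp_le) auto
      then show "\<forall>\<^sub>F k in sequentially. (\<integral>\<^sup>+x. ennreal ((cmod (f n x - f (r k) x))\<^sup>2) \<partial>M) \<le> ennreal e"
        by (auto simp: eventually_sequentially)
    qed simp
    finally show ?thesis .
  qed
  have diff_sq: "(\<lambda>x. f n x - g x) \<in> square_integrable M \<and> (LINT x|M. (cmod (f n x - g x))\<^sup>2) \<le> e"
    if e: "0 < e" and n: "\<forall>m\<ge>K. \<forall>n\<ge>K. (LINT x|M. (cmod (f m x - f n x))\<^sup>2) < e" "n \<ge> K" for e K n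
  proof -
    have F: "(\<integral>\<^sup>+x. ennreal ((cmod (f n x - g x))\<^sup>2) \<partial>M) \<le> ennreal e" by (rule Fatou[OF that])
    have i: "integrable M (\<lambda>x. (cmod (f n x - g x))\<^sup>2)"
    proof (rule integrableI_bounded)
      show "(\<integral>\<^sup>+x. ennreal (norm ((cmod (f n x - g x))\<^sup>2)) \<partial>M) < \<infinity>"
        using F by (simp add: le_less_trans[OF _ ennreal_less_top])
    qed measurable
    moreover have "ennreal (LINT x|M. (cmod (f n x - g x))\<^sup>2) \<le> ennreal e"
      using F nn_integral_eq_integral[OF i] by simp
    ultimately show ?thesis
      using e by (auto simp: square_integrable_def ennreal_le_iff)
  qed
  obtain K where K: "\<forall>m\<ge>K. \<forall>n\<ge>K. (LINT x|M. (cmod (f m x - f n x))\<^sup>2) < 1" using Cauchy[of 1] by auto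
  have "(\<lambda>x. f K x - g x) \<in> square_integrable M" using diff_sq[OF _ K, of K] by simp
  then have "(\<lambda>x. f K x - (f K x - g x)) \<in> square_integrable M"
    by (rule square_integrable_diff[OF f])
  then have "g \<in> square_integrable M" by simp
  moreover have "(\<lambda>n. LINT x|M. (cmod (f n x - g x))\<^sup>2) \<longlonglongrightarrow> 0"
  proof (rule LIMSEQ_I)
    fix e :: real assume e: "0 < e"
    then obtain K where K: "\<forall>m\<ge>K. \<forall>n\<ge>K. (LINT x|M. (cmod (f m x - f n x))\<^sup>2) < e / 2"
      using Cauchy[of "e / 2"] by auto
    show "\<exists>no. \<forall>n\<ge>no. norm ((LINT x|M. (cmod (f n x - g x))\<^sup>2) - 0) < e"
    proof (intro exI allI impI)
      fix n assume "n \<ge> K"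
      then have "(LINT x|M. (cmod (f n x - g x))\<^sup>2) \<le> e / 2" using diff_sq[OF _ K] e by auto
      then show "norm ((LINT x|M. (cmod (f n x - g x))\<^sup>2) - 0) < e"
        using e by (simp add: abs_of_nonneg)
    qed
  qed
  ultimately show ?thesis by blast
qed

theorem hilbert_space_L2: "hilbert_space (L2 M)"
proof
  have "(\<lambda>x. 0) \<in> square_integrable M" by (simp add: square_integrable_def)
  then show "carrier (L2 M) \<noteq> {}" by (metis L2_class_carrier empty_iff)
next
  fix x y assume "x \<in> carrier (L2 M)" "y \<in> carrier (L2 M)"
  then show "hadd (L2 M) x y \<in> carrier (L2 M)"
    by (auto elim!: L2_cases simp: L2_add square_integrable_add)
next
  fix x c assume "x \<in> carrier (L2 M)"
  then show "hscale (L2 M) c x \<in> carrier (L2 M)"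
    by (auto elim!: L2_cases simp: L2_scale square_integrable_scale)
next
  fix x y z assume "x \<in> carrier (L2 M)" "y \<in> carrier (L2 M)" "z \<in> carrier (L2 M)"
  then obtain f g h where fgh: "f \<in> square_integrable M" "x = L2_class M f" "g \<in> square_integrable M"
    "y = L2_class M g" "h \<in> square_integrable M" "z = L2_class M h"
    by (auto elim!: L2_cases)
  then show "hinner (L2 M) (hadd (L2 M) x y) z = hinner (L2 M) x z + hinner (L2 M) y z"
    using Bochner_Integration.integral_add[OF integrable_inner[OF fgh(1,5)] integrable_inner[OF fgh(3,5)]]
    by (simp add: L2_add L2_inner square_integrable_add distrib_right)
next
  fix x y c assume "x \<in> carrier (L2 M)" "y \<in> carrier (L2 M)"
  then obtain f g where "f \<in> square_integrable M" "x = L2_class M f" "g \<in> square_integrable M" "y = L2_class M g"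
    by (auto elim!: L2_cases)
  then show "hinner (L2 M) (hscale (L2 M) c x) y = c * hinner (L2 M) x y"
    by (simp add: L2_scale L2_inner square_integrable_scale mult.assoc)
next
  fix x y assume "x \<in> carrier (L2 M)" "y \<in> carrier (L2 M)"
  then obtain f g where fg: "f \<in> square_integrable M" "g \<in> square_integrable M" "x = L2_class M f" "y = L2_class M g"
    by (auto elim!: L2_cases)
  have "(LINT x|M. g x * cnj (f x)) = (LINT x|M. cnj (f x * cnj (g x)))"
    by (simp add: mult.commute)
  also have "\<dots> = cnj (LINT x|M. f x * cnj (g x))" by (rule Bochner_Integration.integral_cnj)
  finally show "hinner (L2 M) y x = cnj (hinner (L2 M) x y)" using fg by (simp add: L2_inner)
next
  fix x assume "x \<in> carrier (L2 M)"
  then show "0 \<le> hnsq (L2 M) x" by (rule L2_cases) (simp add: L2_hnsq)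
next
  fix x y assume xy: "x \<in> carrier (L2 M)" "y \<in> carrier (L2 M)"
    and eq: "\<And>z. z \<in> carrier (L2 M) \<Longrightarrow> hinner (L2 M) x z = hinner (L2 M) y z"
  then obtain f g where fg: "f \<in> square_integrable M" "g \<in> square_integrable M" "x = L2_class M f" "y = L2_class M g"
    by (auto elim!: L2_cases)
  let ?d = "\<lambda>x. f x - g x"
  have d: "?d \<in> square_integrable M" using fg by (intro square_integrable_diff)
  have "(LINT x|M. f x * cnj (?d x)) = (LINT x|M. g x * cnj (?d x))"
    using eq[of "L2_class M ?d"] fg d by (simp add: L2_inner)
  then have "(LINT x|M. f x * cnj (?d x) - g x * cnj (?d x)) = 0"
    using Bochner_Integration.integral_diff[OF integrable_inner[OF fg(1) d] integrable_inner[OF fg(2) d]] by simp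
  then have "(LINT x|M. ?d x * cnj (?d x)) = 0" by (simp add: algebra_simps)
  then have "hnsq (L2 M) (L2_class M ?d) = 0" using L2_inner[OF d d] by (simp add: hnsq_def)
  then have "(LINT x|M. (cmod (?d x))\<^sup>2) = 0" using L2_hnsq[OF d] by simp
  then have "AE x in M. (cmod (?d x))\<^sup>2 = 0"
    using square_integrable_integrable[OF d] by (subst (asm) integral_nonneg_eq_0_iff_AE) auto
  then show "x = y" using fg by (simp add: L2_class_eq_iff)
next
  fix X :: "nat \<Rightarrow> ('a \<Rightarrow> complex) set"
  assume X: "\<And>n. X n \<in> carrier (L2 M)"
    and C: "\<And>e. 0 < e \<Longrightarrow> \<exists>N. \<forall>m\<ge>N. \<forall>n\<ge>N. hnsq (L2 M) (hsub (L2 M) (X m) (X n)) < e"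
  define f where "f n = L2_rep (X n)" for n
  have f: "f n \<in> square_integrable M" "X n = L2_class M (f n)" for n
    using L2_rep_carrier[OF X] by (simp_all add: f_def)
  have eq: "hnsq (L2 M) (hsub (L2 M) (X n) (L2_class M g)) = (LINT x|M. (cmod (f n x - g x))\<^sup>2)"
    if "g \<in> square_integrable M" for n g
    using that f by (simp add: L2_sub L2_hnsq square_integrable_diff)
  have "\<exists>g\<in>square_integrable M. (\<lambda>n. LINT x|M. (cmod (f n x - g x))\<^sup>2) \<longlonglongrightarrow> 0"
  proof (rule Riesz_Fischer[OF f(1)])
    fix e :: real assume "0 < e"
    then show "\<exists>N. \<forall>m\<ge>N. \<forall>n\<ge>N. (LINT x|M. (cmod (f m x - f n x))\<^sup>2) < e"
      using C eq[OF f(1)] f(2) by metis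
  qed
  then obtain g where g: "g \<in> square_integrable M" "(\<lambda>n. LINT x|M. (cmod (f n x - g x))\<^sup>2) \<longlonglongrightarrow> 0" by blast
  then have "hlim (L2 M) X (L2_class M g)" unfolding hlim_def by (simp add: eq)
  then show "\<exists>x\<in>carrier (L2 M). hlim (L2 M) X x" using g(1) by blast
qed

interpretation L2: hilbert_space "L2 M" for M
  by (rule hilbert_space_L2)

subsection \<open>Multiplication operators and composition operators\<close>

text \<open>The concrete operators are built from these two kinds: left and right translations are
  composition operators, left and right multiplications by functions on \<open>Y\<close> are
  multiplication operators, and \<open>J\<close> is a composition operator followed by
  conjugation.\<close>

definition mult_op :: "'a measure \<Rightarrow> ('a \<Rightarrow> complex) \<Rightarrow> ('a \<Rightarrow> complex) set \<Rightarrow> ('a \<Rightarrow> complex) set" where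
  "mult_op M a = (\<lambda>\<xi>\<in>carrier (L2 M). L2_class M (\<lambda>x. a x * L2_rep \<xi> x))"

definition comp_op :: "'a measure \<Rightarrow> ('a \<Rightarrow> 'a) \<Rightarrow> ('a \<Rightarrow> complex) set \<Rightarrow> ('a \<Rightarrow> complex) set" where
  "comp_op M h = (\<lambda>\<xi>\<in>carrier (L2 M). L2_class M (\<lambda>x. L2_rep \<xi> (h x)))"

definition measure_preserving :: "'a measure \<Rightarrow> ('a \<Rightarrow> 'a) \<Rightarrow> bool" where
  "measure_preserving M h \<longleftrightarrow> h \<in> measurable M M \<and> distr M M h = M"

lemma ess_bounded_cnj: "a \<in> ess_bounded M \<Longrightarrow> (\<lambda>x. cnj (a x)) \<in> ess_bounded M"
  by (auto simp: ess_bounded_def)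

lemma ess_bounded_mult:
  assumes "a \<in> ess_bounded M" "f \<in> square_integrable M"
  shows "(\<lambda>x. a x * f x) \<in> square_integrable M"
proof -
  obtain B where B: "AE x in M. cmod (a x) \<le> B" using assms(1) by (auto simp: ess_bounded_def)
  have "integrable M (\<lambda>x. B\<^sup>2 * (cmod (f x))\<^sup>2)"
    using square_integrable_integrable[OF assms(2)] by simp
  moreover have "AE x in M. (cmod (a x * f x))\<^sup>2 \<le> B\<^sup>2 * (cmod (f x))\<^sup>2"
    using B by eventually_elim (auto simp: norm_mult power_mult_distrib intro!: mult_right_mono power_mono)
  moreover have "(\<lambda>x. a x * f x) \<in> borel_measurable M"
    using assms by (auto simp: ess_bounded_def square_integrable_def)
  ultimately show ?thesis by (rule square_integrable_bound[rotated])
qed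

lemma mult_op_class:
  assumes a: "a \<in> ess_bounded M" and f: "f \<in> square_integrable M"
  shows "mult_op M a (L2_class M f) = L2_class M (\<lambda>x. a x * f x)"
proof -
  have "AE x in M. a x * L2_rep (L2_class M f) x = a x * f x"
    using L2_rep_class(2)[OF f] by eventually_elim simp
  then show ?thesis
    using f L2_rep_class(1)[OF f] a by (simp add: mult_op_def L2_class_eq_iff ess_bounded_mult)
qed

lemma mult_op_bounded:
  assumes a: "a \<in> ess_bounded M"
  shows "mult_op M a \<in> bounded_ops (L2 M)"
proof -
  obtain B where B: "AE x in M. cmod (a x) \<le> B" using assms(1) by (auto simp: ess_bounded_def)
  show ?thesis
  proof (rule L2.bounded_opsI[where B = B])
    show "mult_op M a \<in> carrier (L2 M) \<rightarrow>\<^sub>E carrier (L2 M)"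
      unfolding mult_op_def using ess_bounded_mult[OF a L2_rep_carrier(1)] by auto
  next
    fix x y assume "x \<in> carrier (L2 M)" "y \<in> carrier (L2 M)"
    then obtain f g where "f \<in> square_integrable M" "x = L2_class M f" "g \<in> square_integrable M" "y = L2_class M g"
      by (auto elim!: L2_cases)
    then show "mult_op M a (hadd (L2 M) x y) = hadd (L2 M) (mult_op M a x) (mult_op M a y)"
      by (simp add: a L2_add mult_op_class square_integrable_add ess_bounded_mult distrib_left)
  next
    fix x c assume "x \<in> carrier (L2 M)"
    then show "mult_op M a (hscale (L2 M) c x) = hscale (L2 M) c (mult_op M a x)"
      by (rule L2_cases) (simp add: a L2_scale mult_op_class square_integrable_scale ess_bounded_mult mult.left_commute)
  next
    fix x assume "x \<in> carrier (L2 M)"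
    then obtain f where f: "f \<in> square_integrable M" "x = L2_class M f" by (auto elim: L2_cases)
    have "(LINT x|M. (cmod (a x * f x))\<^sup>2) \<le> (LINT x|M. B\<^sup>2 * (cmod (f x))\<^sup>2)"
    proof (rule integral_mono_AE)
      show "AE x in M. (cmod (a x * f x))\<^sup>2 \<le> B\<^sup>2 * (cmod (f x))\<^sup>2"
        using B by eventually_elim (auto simp: norm_mult power_mult_distrib intro!: mult_right_mono power_mono)
    qed (use f a in \<open>auto intro!: square_integrable_integrable ess_bounded_mult\<close>)
    then show "hnsq (L2 M) (mult_op M a x) \<le> B\<^sup>2 * hnsq (L2 M) x"
      using f a by (simp add: mult_op_class L2_hnsq ess_bounded_mult)
  qed
qed

lemma mult_op_adjoint:
  assumes a: "a \<in> ess_bounded M"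
  shows "is_adjoint (L2 M) (mult_op M a) (mult_op M (\<lambda>x. cnj (a x)))"
  unfolding is_adjoint_def
proof (intro ballI)
  fix x y assume "x \<in> carrier (L2 M)" "y \<in> carrier (L2 M)"
  then obtain f g where "f \<in> square_integrable M" "x = L2_class M f" "g \<in> square_integrable M" "y = L2_class M g"
    by (auto elim!: L2_cases)
  then show "hinner (L2 M) (mult_op M a x) y = hinner (L2 M) x (mult_op M (\<lambda>x. cnj (a x)) y)"
    using a by (simp add: mult_op_class ess_bounded_cnj ess_bounded_mult L2_inner mult.left_commute mult.assoc)
qed

lemma mult_op_commute:
  assumes "a \<in> ess_bounded M" "c \<in> ess_bounded M" "x \<in> carrier (L2 M)"
  shows "mult_op M a (mult_op M c x) = mult_op M c (mult_op M a x)"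
  using assms(3) by (rule L2_cases) (simp add: assms(1,2) mult_op_class ess_bounded_mult mult.left_commute)

lemma measure_preserving_AE:
  assumes h: "measure_preserving M h" and P: "AE x in M. P x"
  shows "AE x in M. P (h x)"
proof -
  have [measurable]: "h \<in> measurable M M" using h by (simp add: measure_preserving_def)
  obtain N where N: "{x \<in> space M. \<not> P x} \<subseteq> N" "N \<in> null_sets M"
    using P by (auto simp: eventually_ae_filter)
  have "h -` N \<inter> space M \<in> null_sets M"
  proof -
    have "emeasure M (h -` N \<inter> space M) = emeasure (distr M M h) N"
      using N(2) by (subst emeasure_distr) auto
    then show ?thesis using N(2) h by (auto simp: measure_preserving_def null_sets_def)
  qed
  moreover have "{x \<in> space M. \<not> P (h x)} \<subseteq> h -` N \<inter> space M"
    using N(1) measurable_space[of h M M] by auto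
  ultimately show ?thesis by (rule AE_I')
qed

lemma measure_preserving_integral:
  fixes f :: "'a \<Rightarrow> 'b::{banach, second_countable_topology}"
  assumes h: "measure_preserving M h" and f: "f \<in> borel_measurable M"
  shows "(LINT x|M. f (h x)) = (LINT x|M. f x)" "integrable M (\<lambda>x. f (h x)) \<longleftrightarrow> integrable M f"
  using integral_distr[of h M M f] integrable_distr_eq[of h M M f] assms
  by (simp_all add: measure_preserving_def)

lemma measure_preserving_square_integrable:
  assumes h: "measure_preserving M h" and f: "f \<in> square_integrable M"
  shows "(\<lambda>x. f (h x)) \<in> square_integrable M"
proof -
  have [measurable]: "h \<in> measurable M M" "f \<in> borel_measurable M"
    using h f by (simp_all add: measure_preserving_def square_integrable_def)
  then show ?thesis
    using measure_preserving_integral(2)[OF h, of "\<lambda>x. (cmod (f x))\<^sup>2"] f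
    by (simp add: square_integrable_def)
qed

lemma measure_preserving_ess_bounded:
  assumes h: "measure_preserving M h" and a: "a \<in> ess_bounded M"
  shows "(\<lambda>x. a (h x)) \<in> ess_bounded M"
proof -
  have [measurable]: "h \<in> measurable M M" "a \<in> borel_measurable M"
    using h a by (simp_all add: measure_preserving_def ess_bounded_def)
  then show ?thesis
    using a measure_preserving_AE[OF h] by (fastforce simp: ess_bounded_def)
qed

lemma comp_op_class:
  assumes h: "measure_preserving M h" and f: "f \<in> square_integrable M"
  shows "comp_op M h (L2_class M f) = L2_class M (\<lambda>x. f (h x))"
  using f L2_rep_class[OF f] h measure_preserving_AE[OF h L2_rep_class(2)[OF f]]
  by (simp add: comp_op_def L2_class_eq_iff measure_preserving_square_integrable)

lemma comp_op_bounded: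
  assumes h: "measure_preserving M h"
  shows "comp_op M h \<in> bounded_ops (L2 M)"
proof (rule L2.bounded_opsI[where B = 1])
  show "comp_op M h \<in> carrier (L2 M) \<rightarrow>\<^sub>E carrier (L2 M)"
    unfolding comp_op_def using measure_preserving_square_integrable[OF h L2_rep_carrier(1)] by auto
next
  fix x y assume "x \<in> carrier (L2 M)" "y \<in> carrier (L2 M)"
  then obtain f g where "f \<in> square_integrable M" "x = L2_class M f" "g \<in> square_integrable M" "y = L2_class M g"
    by (auto elim!: L2_cases)
  then show "comp_op M h (hadd (L2 M) x y) = hadd (L2 M) (comp_op M h x) (comp_op M h y)"
    by (simp add: h L2_add comp_op_class square_integrable_add measure_preserving_square_integrable)
next
  fix x c assume "x \<in> carrier (L2 M)"
  then show "comp_op M h (hscale (L2 M) c x) = hscale (L2 M) c (comp_op M h x)"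
    by (rule L2_cases) (simp add: h L2_scale comp_op_class square_integrable_scale measure_preserving_square_integrable)
next
  fix x assume "x \<in> carrier (L2 M)"
  then obtain f where f: "f \<in> square_integrable M" "x = L2_class M f" by (auto elim: L2_cases)
  have "(\<lambda>x. (cmod (f x))\<^sup>2) \<in> borel_measurable M" using f by measurable
  then show "hnsq (L2 M) (comp_op M h x) \<le> 1\<^sup>2 * hnsq (L2 M) x"
    using f h measure_preserving_integral(1)[OF h, of "\<lambda>x. (cmod (f x))\<^sup>2"]
    by (simp add: comp_op_class L2_hnsq measure_preserving_square_integrable)
qed

lemma comp_op_adjoint:
  assumes h: "measure_preserving M h" and k: "measure_preserving M k"
    and inv: "AE x in M. k (h x) = x"
  shows "is_adjoint (L2 M) (comp_op M h) (comp_op M k)"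
  unfolding is_adjoint_def
proof (intro ballI)
  fix x y assume "x \<in> carrier (L2 M)" "y \<in> carrier (L2 M)"
  then obtain f g where fg: "f \<in> square_integrable M" "g \<in> square_integrable M" "x = L2_class M f" "y = L2_class M g"
    by (auto elim!: L2_cases)
  have hm [measurable]: "h \<in> measurable M M" "k \<in> measurable M M" using h k by (simp_all add: measure_preserving_def)
  have [measurable]: "f \<in> borel_measurable M" "g \<in> borel_measurable M" using fg by (simp_all add: square_integrable_def)
  have "(LINT x|M. f x * cnj (g (k x))) = (LINT x|M. f (h x) * cnj (g (k (h x))))"
    using measure_preserving_integral(1)[OF h, of "\<lambda>x. f x * cnj (g (k x))"] by simp
  also have "\<dots> = (LINT x|M. f (h x) * cnj (g x))"
  proof (rule integral_cong_AE)
    show "AE x in M. f (h x) * cnj (g (k (h x))) = f (h x) * cnj (g x)"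
      using inv by eventually_elim simp
  qed measurable
  finally show "hinner (L2 M) (comp_op M h x) y = hinner (L2 M) x (comp_op M k y)"
    using fg h k by (simp add: comp_op_class L2_inner measure_preserving_square_integrable)
qed

section \<open>Fourier analysis on the dual of the rational plane\<close>

lemma dual_add: "\<phi> \<in> dual_Q2 \<Longrightarrow> \<phi> (v + w) = \<phi> v * \<phi> w"
  and dual_norm: "\<phi> \<in> dual_Q2 \<Longrightarrow> cmod (\<phi> v) = 1"
  by (auto simp: dual_Q2_def)

lemma dual_zero: "\<phi> \<in> dual_Q2 \<Longrightarrow> \<phi> 0 = 1"
  using dual_add[of \<phi> 0 0] dual_norm[of \<phi> 0] by auto

lemma dual_minus: "\<phi> \<in> dual_Q2 \<Longrightarrow> \<phi> (- v) = cnj (\<phi> v)"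
proof -
  assume \<phi>: "\<phi> \<in> dual_Q2"
  have "\<phi> v * \<phi> (- v) = 1" using dual_add[OF \<phi>, of v "- v"] dual_zero[OF \<phi>] by simp
  moreover have "\<phi> v * cnj (\<phi> v) = 1" using dual_norm[OF \<phi>, of v] by (simp add: complex_norm_square[symmetric])
  moreover have "\<phi> v \<noteq> 0" using dual_norm[OF \<phi>, of v] by auto
  ultimately show ?thesis by (metis mult_cancel_left)
qed

text \<open>Tychonoff for a product of circles, in which multiplicativity cuts out a closed
  set.\<close>

lemma compact_dual: "compact dual_Q2"
proof -
  let ?S = "PiE UNIV (\<lambda>_. sphere 0 1) :: (rat^2 \<Rightarrow> complex) set"
  have "compactin (product_topology (\<lambda>_. euclidean) UNIV) ?S"
    by (subst compactin_PiE) auto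
  then have c: "compact ?S" by (simp add: euclidean_product_topology)
  have cl: "closed {\<phi> :: rat^2 \<Rightarrow> complex. \<forall>v w. \<phi> (v + w) = \<phi> v * \<phi> w}"
    by (intro closed_Collect_all closed_Collect_eq continuous_on_mult continuous_on_product_coordinates)
  have eq: "dual_Q2 = ?S \<inter> {\<phi>. \<forall>v w. \<phi> (v + w) = \<phi> v * \<phi> w}"
    by (auto simp: dual_Q2_def)
  show ?thesis unfolding eq using c cl by (rule compact_Int_closed)
qed

text \<open>The trigonometric polynomials. Equalities are required on \<open>dual_Q2\<close> only,
  so membership depends on the restriction to the compact group, and the induction rule replaces
  finite index sets.\<close>

inductive_set trig :: "((rat^2 \<Rightarrow> complex) \<Rightarrow> complex) set" where
  char: "(\<And>\<phi>. \<phi> \<in> dual_Q2 \<Longrightarrow> f \<phi> = c * \<phi> v) \<Longrightarrow> f \<in> trig"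
| add: "f \<in> trig \<Longrightarrow> g \<in> trig \<Longrightarrow> (\<And>\<phi>. \<phi> \<in> dual_Q2 \<Longrightarrow> h \<phi> = f \<phi> + g \<phi>) \<Longrightarrow> h \<in> trig"

lemma trig_mult_char: "f \<in> trig \<Longrightarrow> (\<lambda>\<phi>. f \<phi> * (c * \<phi> v)) \<in> trig"
proof (induction rule: trig.induct)
  case (char f c' w)
  show ?case
    by (rule trig.char[of _ "c' * c" "w + v"]) (simp add: char dual_add)
next
  case (add f g h)
  show ?case by (rule trig.add[OF add.IH]) (simp add: add distrib_right)
qed

lemma trig_mult: "g \<in> trig \<Longrightarrow> f \<in> trig \<Longrightarrow> (\<lambda>\<phi>. f \<phi> * g \<phi>) \<in> trig"
proof (induction rule: trig.induct)
  case (char g c w)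
  have *: "(\<lambda>\<phi>. f \<phi> * (c * \<phi> w)) \<in> trig" using trig_mult_char[OF char.prems] .
  have "(\<lambda>\<phi>. 0 :: complex) \<in> trig" by (rule trig.char[of _ 0 0]) simp
  from trig.add[OF * this] show ?case by (simp add: char)
next
  case (add f' g' h)
  then show ?case by (intro trig.add[OF add.IH(1)[OF add.prems] add.IH(2)[OF add.prems]]) (simp add: distrib_left)
qed

lemma trig_continuous: "f \<in> trig \<Longrightarrow> continuous_on dual_Q2 f"
proof (induction rule: trig.induct)
  case (char f c v)
  have "continuous_on dual_Q2 (\<lambda>\<phi>. c * \<phi> v)"
    by (intro continuous_on_mult continuous_on_const continuous_on_subset[OF continuous_on_product_coordinates]) auto
  then show ?case using char by (simp cong: continuous_on_cong)
next
  case (add f g h)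
  have "continuous_on dual_Q2 (\<lambda>\<phi>. f \<phi> + g \<phi>)" using add.IH by (rule continuous_on_add)
  then show ?case using add.hyps by (simp cong: continuous_on_cong)
qed

text \<open>Real functions enter through their complexification, to suit the real Stone-Weierstrass
  theorem. As \<open>\<phi> (- v)\<close> is the conjugate of \<open>\<phi> v\<close>, real and
  imaginary parts of characters qualify, and they separate points.\<close>

lemma function_ring_trig: "function_ring_on {f. (\<lambda>\<phi>. complex_of_real (f \<phi>)) \<in> trig} dual_Q2"
proof
  show "compact dual_Q2" by (rule compact_dual)
next
  fix f assume "f \<in> {f. (\<lambda>\<phi>. complex_of_real (f \<phi>)) \<in> trig}"
  then have "continuous_on dual_Q2 (\<lambda>\<phi>. Re (complex_of_real (f \<phi>)))"
    by (intro continuous_on_Re trig_continuous) simp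
  then show "continuous_on dual_Q2 f" by simp
next
  fix f g assume fg: "f \<in> {f. (\<lambda>\<phi>. complex_of_real (f \<phi>)) \<in> trig}" "g \<in> {f. (\<lambda>\<phi>. complex_of_real (f \<phi>)) \<in> trig}"
  show "(\<lambda>x. f x + g x) \<in> {f. (\<lambda>\<phi>. complex_of_real (f \<phi>)) \<in> trig}"
    using fg by (auto intro: trig.add)
  show "(\<lambda>x. f x * g x) \<in> {f. (\<lambda>\<phi>. complex_of_real (f \<phi>)) \<in> trig}"
    using fg trig_mult by auto
next
  fix c show "(\<lambda>_. c) \<in> {f. (\<lambda>\<phi>. complex_of_real (f \<phi>)) \<in> trig}"
    by (auto intro: trig.char[of _ "of_real c" 0] simp: dual_zero)
next
  fix x y assume xy: "x \<in> dual_Q2" "y \<in> dual_Q2" "x \<noteq> y"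
  then obtain v where v: "x v \<noteq> y v" by blast
  have Re: "(\<lambda>\<phi>. complex_of_real (Re (\<phi> v))) \<in> trig"
    by (rule trig.add[OF trig.char[of "\<lambda>\<phi>. (1/2) * \<phi> v" "1/2" v] trig.char[of "\<lambda>\<phi>. (1/2) * \<phi> (- v)" "1/2" "- v"]])
      (simp_all add: dual_minus complex_eq_iff)
  have Im: "(\<lambda>\<phi>. complex_of_real (Im (\<phi> v))) \<in> trig"
    by (rule trig.add[OF trig.char[of "\<lambda>\<phi>. (- \<i>/2) * \<phi> v" "- \<i>/2" v] trig.char[of "\<lambda>\<phi>. (\<i>/2) * \<phi> (- v)" "\<i>/2" "- v"]])
      (simp_all add: dual_minus complex_eq_iff)
  show "\<exists>f\<in>{f. (\<lambda>\<phi>. complex_of_real (f \<phi>)) \<in> trig}. f x \<noteq> f y"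
  proof (cases "Re (x v) = Re (y v)")
    case True
    then have "Im (x v) \<noteq> Im (y v)" using v by (simp add: complex_eq_iff)
    then show ?thesis using Im by (intro bexI[of _ "\<lambda>\<phi>. Im (\<phi> v)"]) simp_all
  next
    case False
    then show ?thesis using Re by (intro bexI[of _ "\<lambda>\<phi>. Re (\<phi> v)"]) simp_all
  qed
qed

lemma borel_measurable_dual:
  assumes "sets \<nu> = sets (restrict_space borel dual_Q2)" "continuous_on dual_Q2 f"
  shows "f \<in> borel_measurable \<nu>"
  using borel_measurable_continuous_on_restrict[OF assms(2)] measurable_cong_sets[OF assms(1) refl] by blast

lemma space_dual: "sets \<nu> = sets (restrict_space borel dual_Q2) \<Longrightarrow> space \<nu> = dual_Q2"
  by (drule sets_eq_imp_space_eq) (simp add: space_restrict_space)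

lemma integrable_dual:
  fixes f :: "_ \<Rightarrow> 'b :: {banach, second_countable_topology}"
  assumes "finite_measure \<nu>" "sets \<nu> = sets (restrict_space borel dual_Q2)" "continuous_on dual_Q2 f"
  shows "integrable \<nu> f"
proof -
  interpret finite_measure \<nu> by fact
  have "bounded (f ` dual_Q2)"
    using compact_continuous_image[OF assms(3) compact_dual] by (rule compact_imp_bounded)
  then obtain B where B: "\<And>\<phi>. \<phi> \<in> dual_Q2 \<Longrightarrow> norm (f \<phi>) \<le> B" unfolding bounded_iff by blast
  show ?thesis
    by (rule integrable_const_bound[where B = B])
      (use B space_dual[OF assms(2)] borel_measurable_dual[OF assms(2,3)] in auto)
qed

text \<open>Equality spreads from characters to trigonometric polynomials, to continuous functions
  by uniform approximation, to closed sets by dominated convergence, and to all measurable sets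
  because the closed sets form a generator stable under intersection.\<close>

theorem dual_measure_eqI:
  assumes fin: "finite_measure \<mu>" "finite_measure \<nu>"
    and sets: "sets \<mu> = sets (restrict_space borel dual_Q2)" "sets \<nu> = sets (restrict_space borel dual_Q2)"
    and eq: "\<And>v. (LINT \<phi>|\<mu>. \<phi> v) = (LINT \<phi>|\<nu>. \<phi> v)"
  shows "\<mu> = \<nu>"
proof -
  interpret mu: finite_measure \<mu> by fact
  interpret nu: finite_measure \<nu> by fact
  interpret function_ring_on "{f. (\<lambda>\<phi>. complex_of_real (f \<phi>)) \<in> trig}" dual_Q2 by (rule function_ring_trig)
  note space = space_dual[OF sets(1)] space_dual[OF sets(2)]
  have eq_trig: "(LINT \<phi>|\<mu>. f \<phi>) = (LINT \<phi>|\<nu>. f \<phi>)" if "f \<in> trig" for f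
    using that
  proof (induction rule: trig.induct)
    case (char f c v)
    have "(LINT \<phi>|\<mu>. f \<phi>) = (LINT \<phi>|\<mu>. c * \<phi> v)" "(LINT \<phi>|\<nu>. f \<phi>) = (LINT \<phi>|\<nu>. c * \<phi> v)"
      by (rule Bochner_Integration.integral_cong; simp add: space char)+
    then show ?case by (simp add: eq)
  next
    case (add f g h)
    have "(LINT \<phi>|\<mu>. h \<phi>) = (LINT \<phi>|\<mu>. f \<phi> + g \<phi>)" "(LINT \<phi>|\<nu>. h \<phi>) = (LINT \<phi>|\<nu>. f \<phi> + g \<phi>)"
      by (rule Bochner_Integration.integral_cong; simp add: space add.hyps)+
    moreover have "integrable \<mu> f" "integrable \<mu> g" "integrable \<nu> f" "integrable \<nu> g"
      using integrable_dual fin sets trig_continuous add.hyps(1,2) by blast+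
    ultimately show ?case using add.IH by simp
  qed
  have eq_cont: "(LINT \<phi>|\<mu>. f \<phi>) = (LINT \<phi>|\<nu>. f \<phi>)" if f: "continuous_on dual_Q2 f" for f :: "_ \<Rightarrow> real"
  proof -
    \<comment> \<open>The total mass of both measures: an approximation within \<open>e\<close>
      alters the difference of the integrals by at most \<open>e * m\<close>.\<close>
    define m where "m = measure \<mu> (space \<mu>) + measure \<nu> (space \<nu>)"
    have m: "m \<ge> 0" by (simp add: m_def)
    have "\<bar>(LINT \<phi>|\<mu>. f \<phi>) - (LINT \<phi>|\<nu>. f \<phi>)\<bar> \<le> e * m" if e: "0 < e" for e
    proof -
      obtain g where g: "(\<lambda>\<phi>. complex_of_real (g \<phi>)) \<in> trig" "\<And>\<phi>. \<phi> \<in> dual_Q2 \<Longrightarrow> \<bar>f \<phi> - g \<phi>\<bar> < e"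
        using Stone_Weierstrass_basic[OF f e] by blast
      have gc: "continuous_on dual_Q2 g" using continuous g(1) by blast
      have "complex_of_real (LINT \<phi>|\<mu>. g \<phi>) = complex_of_real (LINT \<phi>|\<nu>. g \<phi>)"
        using eq_trig[OF g(1)] unfolding integral_complex_of_real .
      then have geq: "(LINT \<phi>|\<mu>. g \<phi>) = (LINT \<phi>|\<nu>. g \<phi>)" by simp
      have "\<bar>(LINT \<phi>|\<rho>. f \<phi>) - (LINT \<phi>|\<rho>. g \<phi>)\<bar> \<le> e * measure \<rho> (space \<rho>)"
        if fin: "finite_measure \<rho>" and sets: "sets \<rho> = sets (restrict_space borel dual_Q2)" for \<rho>
      proof -
        interpret finite_measure \<rho> by fact
        have i: "integrable \<rho> f" "integrable \<rho> g" using integrable_dual[OF fin sets] f gc by auto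
        have "\<bar>(LINT \<phi>|\<rho>. f \<phi>) - (LINT \<phi>|\<rho>. g \<phi>)\<bar> = \<bar>LINT \<phi>|\<rho>. f \<phi> - g \<phi>\<bar>" using i by simp
        also have "\<dots> \<le> (LINT \<phi>|\<rho>. \<bar>f \<phi> - g \<phi>\<bar>)" by (rule integral_abs_bound)
        also have "\<dots> \<le> (LINT \<phi>|\<rho>. e)"
          using i g(2) space_dual[OF sets] by (intro integral_mono) (auto intro: less_imp_le)
        finally show ?thesis by (simp add: mult.commute)
      qed
      from this[OF fin(1) sets(1)] this[OF fin(2) sets(2)] show ?thesis
        unfolding m_def distrib_left geq by linarith
    qed
    then have small: "\<bar>(LINT \<phi>|\<mu>. f \<phi>) - (LINT \<phi>|\<nu>. f \<phi>)\<bar> \<le> e * m" if "0 < e" for e using that by blast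
    have "\<bar>(LINT \<phi>|\<mu>. f \<phi>) - (LINT \<phi>|\<nu>. f \<phi>)\<bar> \<le> 0 + d" if "0 < d" for d
    proof -
      have "\<bar>(LINT \<phi>|\<mu>. f \<phi>) - (LINT \<phi>|\<nu>. f \<phi>)\<bar> \<le> d / (m + 1) * m"
        using small[of "d / (m + 1)"] that m by simp
      also have "\<dots> \<le> d" using that m by (simp add: field_simps)
      finally show ?thesis by simp
    qed
    then have "\<bar>(LINT \<phi>|\<mu>. f \<phi>) - (LINT \<phi>|\<nu>. f \<phi>)\<bar> \<le> 0" by (rule field_le_epsilon)
    then show ?thesis by simp
  qed
  have eq_closed: "emeasure \<mu> (dual_Q2 \<inter> F) = emeasure \<nu> (dual_Q2 \<inter> F)" if F: "closed F" for F
  proof (cases "F = {}")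
    case False
    \<comment> \<open>Continuous cutoffs, equal to 1 on \<open>F\<close> and to 0 at distance at
      least \<open>1 / n\<close> from it.\<close>
    define f where "f n \<phi> = max 0 (1 - real n * infdist \<phi> F)" for n and \<phi> :: "rat^2 \<Rightarrow> complex"
    have fc: "continuous_on dual_Q2 (f n)" for n
      unfolding f_def by (intro continuous_intros)
    have lim: "(\<lambda>n. f n \<phi>) \<longlonglongrightarrow> indicator F \<phi>" for \<phi>
    proof (cases "\<phi> \<in> F")
      case True
      then show ?thesis by (simp add: f_def)
    next
      case nF: False
      then have pos: "infdist \<phi> F > 0" using in_closed_iff_infdist_zero[OF F False] infdist_nonneg[of \<phi> F] by auto
      obtain n0 :: nat where n0: "1 / infdist \<phi> F < real n0" using reals_Archimedean2 by blast
      have "f n \<phi> = 0" if "n \<ge> n0" for n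
      proof -
        have "1 < real n0 * infdist \<phi> F" using n0 pos by (simp add: field_simps)
        also have "\<dots> \<le> real n * infdist \<phi> F" using that pos by (intro mult_right_mono) auto
        finally show ?thesis by (simp add: f_def)
      qed
      then have "\<forall>\<^sub>F n in sequentially. f n \<phi> = 0" by (auto simp: eventually_sequentially)
      then show ?thesis using nF by (simp add: tendsto_eventually)
    qed
    have F_sets: "dual_Q2 \<inter> F \<in> sets (restrict_space borel dual_Q2)"
      using F by (auto simp: sets_restrict_space)
    have conv: "(\<lambda>n. LINT \<phi>|\<rho>. f n \<phi>) \<longlonglongrightarrow> measure \<rho> (dual_Q2 \<inter> F)"
      if fin: "finite_measure \<rho>" and sets: "sets \<rho> = sets (restrict_space borel dual_Q2)" for \<rho>
    proof -
      interpret finite_measure \<rho> by fact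
      have "(\<lambda>n. LINT \<phi>|\<rho>. f n \<phi>) \<longlonglongrightarrow> (LINT \<phi>|\<rho>. indicator (dual_Q2 \<inter> F) \<phi>)"
      proof (rule integral_dominated_convergence[where w = "\<lambda>_. 1"])
        show "f n \<in> borel_measurable \<rho>" for n using borel_measurable_dual[OF sets fc] .
        show "indicator (dual_Q2 \<inter> F) \<in> borel_measurable \<rho>" using F_sets sets by simp
        show "AE \<phi> in \<rho>. (\<lambda>n. f n \<phi>) \<longlonglongrightarrow> indicator (dual_Q2 \<inter> F) \<phi>"
          using lim space_dual[OF sets] by (intro AE_I2) (simp add: indicator_def)
        show "AE \<phi> in \<rho>. norm (f n \<phi>) \<le> 1" for n
          by (intro AE_I2) (simp add: f_def infdist_nonneg)
      qed simp
      also have "(LINT \<phi>|\<rho>. indicator (dual_Q2 \<inter> F) \<phi>) = measure \<rho> (dual_Q2 \<inter> F)"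
        using F_sets sets space_dual[OF sets] by (simp add: Int_absorb2 inf.assoc[symmetric])
      finally show ?thesis .
    qed
    have "measure \<mu> (dual_Q2 \<inter> F) = measure \<nu> (dual_Q2 \<inter> F)"
      using conv[OF fin(1) sets(1)] conv[OF fin(2) sets(2)] eq_cont[OF fc] by (simp add: LIMSEQ_unique)
    then show ?thesis by (simp add: mu.emeasure_eq_measure nu.emeasure_eq_measure)
  qed simp
  have gen: "sets (restrict_space borel dual_Q2) = sigma_sets dual_Q2 ((\<inter>) dual_Q2 ` {F. closed F})"
  proof -
    have "sets (restrict_space borel dual_Q2) = (\<inter>) dual_Q2 ` sigma_sets UNIV {F. closed F}"
      by (simp add: sets_restrict_space borel_eq_closed)
    also have "\<dots> = sigma_sets dual_Q2 ((\<inter>) dual_Q2 ` {F. closed F})"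
      using compact_imp_closed[OF compact_dual] by (intro sigma_sets_Int sigma_sets.Basic) auto
    finally show ?thesis .
  qed
  show ?thesis
  proof (rule measure_eqI_generator_eq[where E = "(\<inter>) dual_Q2 ` {F. closed F}" and \<Omega> = dual_Q2 and A = "\<lambda>_. dual_Q2"])
    show "Int_stable ((\<inter>) dual_Q2 ` {F. closed F})"
    proof (rule Int_stableI)
      fix a b assume "a \<in> (\<inter>) dual_Q2 ` {F. closed F}" "b \<in> (\<inter>) dual_Q2 ` {F. closed F}"
      then obtain F G where "closed F" "closed G" "a = dual_Q2 \<inter> F" "b = dual_Q2 \<inter> G" by blast
      then show "a \<inter> b \<in> (\<inter>) dual_Q2 ` {F. closed F}"
        by (intro image_eqI[of _ _ "F \<inter> G"]) auto
    qed
    show "range (\<lambda>_. dual_Q2) \<subseteq> (\<inter>) dual_Q2 ` {F. closed F}"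
      by (auto intro!: image_eqI[of _ _ UNIV])
  qed (use eq_closed sets gen in auto)
qed

subsection \<open>Haar measure\<close>

locale haar =
  fixes \<mu> :: "(rat^2 \<Rightarrow> complex) measure"
  assumes haar: "haar_probability \<mu>"
begin

lemma sets_mu: "sets \<mu> = sets (restrict_space borel dual_Q2)"
  using haar by (simp add: haar_probability_def)

lemma space_mu: "space \<mu> = dual_Q2"
  using space_dual[OF sets_mu] .

sublocale prob_space \<mu>
  using haar by (simp add: haar_probability_def)

lemma continuous_on_eval: "continuous_on dual_Q2 (\<lambda>\<phi>. \<phi> v)"
  by (rule continuous_on_subset[OF continuous_on_product_coordinates]) auto

lemma eval_measurable [measurable]: "(\<lambda>\<phi>. \<phi> v) \<in> borel_measurable \<mu>"
  using borel_measurable_dual[OF sets_mu continuous_on_eval] .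

lemma eval_integrable: "integrable \<mu> (\<lambda>\<phi>. \<phi> v)"
  by (rule integrable_dual[OF finite_measure_axioms sets_mu continuous_on_eval])

lemma measurable_into_mu:
  assumes "\<And>v. (\<lambda>x. h x v) \<in> borel_measurable L" "\<And>x. x \<in> space L \<Longrightarrow> h x \<in> dual_Q2"
  shows "h \<in> measurable L \<mu>"
proof -
  have "h \<in> measurable L borel"
    using measurable_coordinatewise_then_product[of h L] assms(1) by simp
  then have "h \<in> measurable L (restrict_space borel dual_Q2)"
    using assms(2) by (intro measurable_restrict_space2) auto
  then show ?thesis using measurable_cong_sets[OF refl sets_mu] by blast
qed

lemma integral_eval: "(LINT \<phi>|\<mu>. \<phi> v) = of_bool (v = 0)"
proof (cases "v = 0")
  case True
  have "(LINT \<phi>|\<mu>. \<phi> 0) = (LINT \<phi>|\<mu>. 1)"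
    using space_mu by (intro Bochner_Integration.integral_cong) (auto simp: dual_zero)
  then show ?thesis using True prob_space by simp
next
  case False
  then obtain i where i: "v $ i \<noteq> 0" by (auto simp: vec_eq_iff)
  \<comment> \<open>A character with value -1 at \<open>v\<close>; invariance under it makes the
    integral equal to its own negative.\<close>
  define \<psi> where "\<psi> w = cis (pi * of_rat (w $ i / v $ i))" for w :: "rat^2"
  have \<psi>: "\<psi> \<in> dual_Q2"
    by (auto simp: dual_Q2_def \<psi>_def cis_mult distrib_left of_rat_add add_divide_distrib)
  have \<psi>v: "\<psi> v = -1" using i by (simp add: \<psi>_def)
  have m: "(\<lambda>\<phi> v. \<psi> v * \<phi> v) \<in> measurable \<mu> \<mu>"
  proof (rule measurable_into_mu)
    show "(\<lambda>x. \<psi> v * x v) \<in> borel_measurable \<mu>" for v by measurable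
    show "(\<lambda>v. \<psi> v * \<phi> v) \<in> dual_Q2" if "\<phi> \<in> space \<mu>" for \<phi>
      using that \<psi> space_mu by (auto simp: dual_Q2_def norm_mult)
  qed
  have "(LINT \<phi>|\<mu>. \<phi> v) = (LINT \<phi>|distr \<mu> \<mu> (\<lambda>\<phi> v. \<psi> v * \<phi> v). \<phi> v)"
    using haar \<psi> by (simp add: haar_probability_def)
  also have "\<dots> = (LINT \<phi>|\<mu>. \<psi> v * \<phi> v)"
    using m by (subst integral_distr) auto
  also have "\<dots> = - (LINT \<phi>|\<mu>. \<phi> v)" by (simp add: \<psi>v)
  finally show ?thesis using False by simp
qed

text \<open>The integral of a character only records whether its index is 0, so a relabelling of
  indices that respects 0 leaves all of them unchanged. This covers the flip and the action of
  matrices.\<close>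

lemma distr_mu_eq:
  assumes h: "\<And>\<phi>. \<phi> \<in> dual_Q2 \<Longrightarrow> h \<phi> \<in> dual_Q2" "\<And>\<phi> v. h \<phi> v = \<phi> (a v)" "\<And>v. a v = 0 \<longleftrightarrow> v = 0"
  shows "h \<in> measurable \<mu> \<mu>" "distr \<mu> \<mu> h = \<mu>"
proof -
  show m: "h \<in> measurable \<mu> \<mu>"
    using h(1,2) space_mu by (intro measurable_into_mu) auto
  interpret d: prob_space "distr \<mu> \<mu> h" using m by (rule prob_space_distr)
  show "distr \<mu> \<mu> h = \<mu>"
  proof (rule dual_measure_eqI)
    show "(LINT \<phi>|distr \<mu> \<mu> h. \<phi> v) = (LINT \<phi>|\<mu>. \<phi> v)" for v
      using m by (subst integral_distr) (simp_all add: h(2) integral_eval h(3))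
  qed (use sets_mu finite_measure_axioms d.finite_measure_axioms in auto)
qed

text \<open>The positive and the negative part are densities of two finite measures that agree on
  characters, hence everywhere.\<close>

lemma fourier_real_zero:
  fixes f :: "_ \<Rightarrow> real"
  assumes f: "integrable \<mu> f" and 0: "\<And>v. (LINT \<phi>|\<mu>. of_real (f \<phi>) * \<phi> v) = 0"
  shows "AE \<phi> in \<mu>. f \<phi> = 0"
proof -
  have [measurable]: "f \<in> borel_measurable \<mu>" using f by (rule borel_measurable_integrable)
  define p where "p \<phi> = max 0 (f \<phi>)" for \<phi>
  define q where "q \<phi> = max 0 (- f \<phi>)" for \<phi>
  have [measurable]: "p \<in> borel_measurable \<mu>" "q \<in> borel_measurable \<mu>" unfolding p_def q_def by measurable
  have pq: "integrable \<mu> p" "integrable \<mu> q"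
    by (rule Bochner_Integration.integrable_bound[OF f]; auto simp: p_def q_def)+
  have fm: "finite_measure (density \<mu> (\<lambda>\<phi>. ennreal (r \<phi>)))"
    if "integrable \<mu> r" "\<And>\<phi>. 0 \<le> r \<phi>" "r \<in> borel_measurable \<mu>" for r
  proof (rule finite_measureI)
    have "emeasure (density \<mu> (\<lambda>\<phi>. ennreal (r \<phi>))) (space \<mu>) = (\<integral>\<^sup>+\<phi>. ennreal (r \<phi>) * indicator (space \<mu>) \<phi> \<partial>\<mu>)"
      using that(3) by (subst emeasure_density) auto
    also have "\<dots> = (\<integral>\<^sup>+\<phi>. ennreal (r \<phi>) \<partial>\<mu>)" by (intro nn_integral_cong) simp
    also have "\<dots> = ennreal (LINT \<phi>|\<mu>. r \<phi>)" using that by (intro nn_integral_eq_integral) auto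
    finally show "emeasure (density \<mu> (\<lambda>\<phi>. ennreal (r \<phi>))) (space (density \<mu> (\<lambda>\<phi>. ennreal (r \<phi>)))) \<noteq> \<infinity>" by simp
  qed
  have ip: "integrable \<mu> (\<lambda>\<phi>. r \<phi> *\<^sub>R \<phi> v)" if "integrable \<mu> r" for r :: "_ \<Rightarrow> real" and v
  proof (rule Bochner_Integration.integrable_bound[OF that])
    show "(\<lambda>\<phi>. r \<phi> *\<^sub>R \<phi> v) \<in> borel_measurable \<mu>" using that by measurable
    show "AE \<phi> in \<mu>. norm (r \<phi> *\<^sub>R \<phi> v) \<le> norm (r \<phi>)" using space_mu by (intro AE_I2) (auto simp: dual_norm)
  qed
  have "density \<mu> (\<lambda>\<phi>. ennreal (p \<phi>)) = density \<mu> (\<lambda>\<phi>. ennreal (q \<phi>))"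
  proof (rule dual_measure_eqI)
    show "finite_measure (density \<mu> (\<lambda>\<phi>. ennreal (p \<phi>)))" "finite_measure (density \<mu> (\<lambda>\<phi>. ennreal (q \<phi>)))"
      by (rule fm[OF pq(1)]; simp add: p_def) (rule fm[OF pq(2)]; simp add: q_def)
    fix v
    have "(LINT \<phi>|\<mu>. p \<phi> *\<^sub>R \<phi> v) - (LINT \<phi>|\<mu>. q \<phi> *\<^sub>R \<phi> v) = (LINT \<phi>|\<mu>. p \<phi> *\<^sub>R \<phi> v - q \<phi> *\<^sub>R \<phi> v)"
      using ip pq by (subst Bochner_Integration.integral_diff) auto
    also have "\<dots> = (LINT \<phi>|\<mu>. of_real (f \<phi>) * \<phi> v)"
      by (intro Bochner_Integration.integral_cong) (auto simp: p_def q_def max_def scaleR_conv_of_real)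
    finally have "(LINT \<phi>|\<mu>. p \<phi> *\<^sub>R \<phi> v) = (LINT \<phi>|\<mu>. q \<phi> *\<^sub>R \<phi> v)" using 0 by simp
    then show "(LINT \<phi>|density \<mu> (\<lambda>\<phi>. ennreal (p \<phi>)). \<phi> v) = (LINT \<phi>|density \<mu> (\<lambda>\<phi>. ennreal (q \<phi>)). \<phi> v)"
      by (subst (1 2) integral_density) (auto simp: p_def q_def)
  qed (use sets_mu in auto)
  then have "AE \<phi> in \<mu>. ennreal (p \<phi>) = ennreal (q \<phi>)"
    by (subst (asm) density_unique_iff) auto
  then show ?thesis
    by eventually_elim (auto simp: p_def q_def max_def split: if_splits)
qed

text \<open>Conjugating a character negates its index, so the conjugate of \<open>f\<close> also has
  vanishing coefficients, and the real and imaginary parts can be treated separately.\<close>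

lemma fourier_zero:
  assumes f: "integrable \<mu> f" and 0: "\<And>v. (LINT \<phi>|\<mu>. f \<phi> * \<phi> v) = 0"
  shows "AE \<phi> in \<mu>. f \<phi> = 0"
proof -
  have [measurable]: "f \<in> borel_measurable \<mu>" using f by (rule borel_measurable_integrable)
  have ip: "integrable \<mu> (\<lambda>\<phi>. f \<phi> * \<phi> v)" for v
  proof (rule Bochner_Integration.integrable_bound[OF f])
    show "AE \<phi> in \<mu>. norm (f \<phi> * \<phi> v) \<le> norm (f \<phi>)" using space_mu by (intro AE_I2) (auto simp: dual_norm norm_mult)
  qed measurable
  have zc: "(LINT \<phi>|\<mu>. cnj (f \<phi>) * \<phi> v) = 0" for v
  proof -
    have "(LINT \<phi>|\<mu>. cnj (f \<phi>) * \<phi> v) = (LINT \<phi>|\<mu>. cnj (f \<phi> * \<phi> (- v)))"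
      using space_mu by (intro Bochner_Integration.integral_cong) (auto simp: dual_minus)
    also have "\<dots> = 0" by (subst Bochner_Integration.integral_cnj) (simp add: 0)
    finally show ?thesis .
  qed
  have ip': "integrable \<mu> (\<lambda>\<phi>. cnj (f \<phi>) * \<phi> v)" for v
  proof (rule Bochner_Integration.integrable_bound[OF f])
    have "(\<lambda>\<phi>. cnj (f \<phi>)) \<in> borel_measurable \<mu>"
      by (rule borel_measurable_continuous_on[OF continuous_on_cnj[OF continuous_on_id]]) simp
    then show "(\<lambda>\<phi>. cnj (f \<phi>) * \<phi> v) \<in> borel_measurable \<mu>" by measurable
    show "AE \<phi> in \<mu>. norm (cnj (f \<phi>) * \<phi> v) \<le> norm (f \<phi>)" using space_mu by (intro AE_I2) (auto simp: dual_norm norm_mult)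
  qed
  have "AE \<phi> in \<mu>. Re (f \<phi>) = 0"
  proof (rule fourier_real_zero)
    show "integrable \<mu> (\<lambda>\<phi>. Re (f \<phi>))" using f by simp
    fix v
    have "(LINT \<phi>|\<mu>. of_real (Re (f \<phi>)) * \<phi> v) = (LINT \<phi>|\<mu>. (1/2) * (f \<phi> * \<phi> v + cnj (f \<phi>) * \<phi> v))"
      by (intro Bochner_Integration.integral_cong) (auto simp: complex_eq_iff field_simps)
    also have "\<dots> = 0" using ip ip' 0 zc by simp
    finally show "(LINT \<phi>|\<mu>. of_real (Re (f \<phi>)) * \<phi> v) = 0" .
  qed
  moreover have "AE \<phi> in \<mu>. Im (f \<phi>) = 0"
  proof (rule fourier_real_zero)
    show "integrable \<mu> (\<lambda>\<phi>. Im (f \<phi>))" using f by simp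
    fix v
    have "(LINT \<phi>|\<mu>. of_real (Im (f \<phi>)) * \<phi> v) = (LINT \<phi>|\<mu>. (- \<i>/2) * (f \<phi> * \<phi> v - cnj (f \<phi>) * \<phi> v))"
      by (intro Bochner_Integration.integral_cong) (auto simp: complex_eq_iff field_simps)
    also have "\<dots> = 0" using ip ip' 0 zc by simp
    finally show "(LINT \<phi>|\<mu>. of_real (Im (f \<phi>)) * \<phi> v) = 0" .
  qed
  ultimately show ?thesis by eventually_elim (simp add: complex_eq_iff)
qed

end

section \<open>The projective special linear group and its action\<close>

definition cl :: "rat^2^2 \<Rightarrow> (rat^2^2) set" where
  "cl g = {g, - g}"

lemma neg_mult:
  fixes g h :: "rat^2^2"
  shows "- g ** h = - (g ** h)" "g ** - h = - (g ** h)"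
  by (cases g rule: mx_cases, cases h rule: mx_cases, simp)+

lemma inv2_minus: "inv2 (- g) = - inv2 g"
  by (cases g rule: mx_cases) simp

lemma inv2_mult: "inv2 (g ** h) = inv2 h ** inv2 g"
  by (cases g rule: mx_cases, cases h rule: mx_cases) (simp add: algebra_simps)

lemma minus_mv:
  fixes g :: "rat^2^2" and v :: "rat^2"
  shows "- g *v v = - (g *v v)" "g *v - v = - (g *v v)"
  by (cases g rule: mx_cases, cases v rule: vc_cases, simp)+

lemma inv2_mat_1 [simp]: "inv2 (mat 1) = mat 1"
  by (simp add: mat_1_mx)

lemma group_SL2Q: "group SL2Q"
proof (rule groupI)
  fix x assume "x \<in> carrier SL2Q"
  then show "\<exists>y\<in>carrier SL2Q. y \<otimes>\<^bsub>SL2Q\<^esub> x = \<one>\<^bsub>SL2Q\<^esub>"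
    by (intro bexI[of _ "inv2 x"]) (simp_all add: SL2Q_def inv2)
qed (simp_all add: SL2Q_def det_mul matrix_mul_assoc)

lemma inv_SL2Q: "det g = 1 \<Longrightarrow> m_inv SL2Q g = inv2 g"
  by (rule group.inv_equality[OF group_SL2Q]) (simp_all add: SL2Q_def inv2)

lemma normal_center: "{mat 1, - mat 1} \<lhd> SL2Q"
proof -
  interpret group SL2Q by (rule group_SL2Q)
  have "subgroup {mat 1, - mat 1} SL2Q"
  proof (rule subgroupI)
    show "{mat 1, - mat 1} \<subseteq> carrier SL2Q" by (simp add: SL2Q_def det_minus)
    fix a assume "a \<in> {mat 1, - mat 1 :: rat^2^2}"
    then show "inv\<^bsub>SL2Q\<^esub> a \<in> {mat 1, - mat 1}" by (auto simp: inv_SL2Q det_minus inv2_minus)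
  qed (auto simp: SL2Q_def neg_mult)
  moreover have "x \<otimes>\<^bsub>SL2Q\<^esub> h \<otimes>\<^bsub>SL2Q\<^esub> inv\<^bsub>SL2Q\<^esub> x \<in> {mat 1, - mat 1}"
    if "x \<in> carrier SL2Q" "h \<in> {mat 1, - mat 1}" for x h
    using that by (auto simp: SL2Q_def neg_mult inv2 inv_SL2Q[unfolded SL2Q_def])
  ultimately show ?thesis by (simp add: normal_inv_iff)
qed

lemma coset_cl: "det g = 1 \<Longrightarrow> {mat 1, - mat 1} #>\<^bsub>SL2Q\<^esub> g = cl g"
  by (auto simp: r_coset_def SL2Q_def cl_def neg_mult)

lemma carrier_PSL2Q: "carrier PSL2Q = cl ` {g. det g = 1}"
proof -
  have "carrier PSL2Q = (\<lambda>g. {mat 1, - mat 1} #>\<^bsub>SL2Q\<^esub> g) ` {g. det g = 1}"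
    by (auto simp: PSL2Q_def FactGroup_def RCOSETS_def SL2Q_def)
  then show ?thesis using coset_cl by force
qed

lemma cl_carrier [simp, intro]: "det g = 1 \<Longrightarrow> cl g \<in> carrier PSL2Q"
  by (simp add: carrier_PSL2Q)

lemma mult_PSL2Q [simp]: "det g = 1 \<Longrightarrow> det h = 1 \<Longrightarrow> cl g \<otimes>\<^bsub>PSL2Q\<^esub> cl h = cl (g ** h)"
  using normal.rcos_sum[OF normal_center, of g h] coset_cl[of g] coset_cl[of h] coset_cl[of "g ** h"]
  by (simp add: PSL2Q_def FactGroup_def SL2Q_def det_mul)

lemma group_PSL2Q: "group PSL2Q"
  unfolding PSL2Q_def by (rule normal.factorgroup_is_group[OF normal_center])

lemma one_PSL2Q: "\<one>\<^bsub>PSL2Q\<^esub> = cl (mat 1)"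
  by (simp add: PSL2Q_def FactGroup_def cl_def)

lemma inv_PSL2Q [simp]: "det g = 1 \<Longrightarrow> m_inv PSL2Q (cl g) = cl (inv2 g)"
  by (rule group.inv_equality[OF group_PSL2Q]) (simp_all add: inv2 one_PSL2Q)

lemma cl_eq_iff: "cl g = cl h \<longleftrightarrow> g = h \<or> g = - h"
  unfolding cl_def by (auto simp: doubleton_eq_iff)

lemma countable_PSL2Q: "countable (carrier PSL2Q)"
  by (simp add: carrier_PSL2Q)

lemma dual_act_eq: "det g = 1 \<Longrightarrow> dual_act g \<phi> = (\<lambda>v. \<phi> (inv2 g *v v))"
  by (simp add: dual_act_def inv_SL2Q)

definition flip :: "(rat^2 \<Rightarrow> complex) \<Rightarrow> rat^2 \<Rightarrow> complex" where
  "flip \<phi> = (\<lambda>v. \<phi> (- v))"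

lemma flip_flip [simp]: "flip (flip \<phi>) = \<phi>"
  by (simp add: flip_def)

lemma flip_dual: "\<phi> \<in> dual_Q2 \<Longrightarrow> flip \<phi> \<in> dual_Q2"
proof -
  assume \<phi>: "\<phi> \<in> dual_Q2"
  have "flip \<phi> (v + w) = flip \<phi> v * flip \<phi> w" for v w
    using dual_add[OF \<phi>, of "- v" "- w"] by (simp add: flip_def)
  then show ?thesis using dual_norm[OF \<phi>] by (simp add: dual_Q2_def flip_def)
qed

lemma dual_act_dual: "det g = 1 \<Longrightarrow> \<phi> \<in> dual_Q2 \<Longrightarrow> dual_act g \<phi> \<in> dual_Q2"
  by (auto simp: dual_act_eq dual_Q2_def matrix_vector_right_distrib)

lemma Y_proj_eq: "\<phi> \<in> dual_Q2 \<Longrightarrow> Y_proj \<phi> = {\<phi>, flip \<phi>}"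
  by (auto simp: Y_proj_def flip_rel_def flip_def)

lemma Y_space_eq: "Y_space = Y_proj ` dual_Q2"
  by (auto simp: Y_space_def quotient_def Y_proj_def)

lemma Y_proj_flip: "\<phi> \<in> dual_Q2 \<Longrightarrow> Y_proj (flip \<phi>) = Y_proj \<phi>"
  by (auto simp: Y_proj_eq flip_dual)

lemma Y_act_proj:
  assumes g: "det g = 1" and \<phi>: "\<phi> \<in> dual_Q2"
  shows "Y_act (cl g) (Y_proj \<phi>) = Y_proj (dual_act g \<phi>)"
proof -
  have "dual_act (- g) \<psi> = flip (dual_act g \<psi>)" "dual_act g (flip \<psi>) = flip (dual_act g \<psi>)" for \<psi>
    using g by (simp_all add: dual_act_eq det_minus inv2_minus flip_def minus_mv)
  moreover have "Y_act (cl g) (Y_proj \<phi>) = {dual_act g \<phi>, dual_act g (flip \<phi>), dual_act (- g) \<phi>, dual_act (- g) (flip \<phi>)}"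
    unfolding Y_act_def Y_proj_eq[OF \<phi>] cl_def by blast
  ultimately show ?thesis
    using Y_proj_eq[OF dual_act_dual[OF g \<phi>]] by auto
qed

lemma Y_act_mult:
  assumes "det g = 1" "det h = 1" "y \<in> Y_space"
  shows "Y_act (cl g) (Y_act (cl h) y) = Y_act (cl (g ** h)) y"
proof -
  obtain \<phi> where \<phi>: "\<phi> \<in> dual_Q2" "y = Y_proj \<phi>" using assms(3) by (auto simp: Y_space_eq)
  have "dual_act g (dual_act h \<phi>) = dual_act (g ** h) \<phi>"
    using assms by (simp add: dual_act_eq det_mul inv2_mult matrix_vector_mul_assoc)
  then show ?thesis using assms \<phi> by (simp add: Y_act_proj dual_act_dual det_mul)
qed

lemma Y_act_one: "y \<in> Y_space \<Longrightarrow> Y_act (cl (mat 1)) y = y"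
  by (auto simp: Y_space_eq Y_act_proj dual_act_eq)

text \<open>The real part does not depend on the representative, since the other one is the conjugate character.\<close>

definition U :: "rat^2 \<Rightarrow> (rat^2 \<Rightarrow> complex) set \<Rightarrow> complex" where
  "U v y = of_real (2 * Re ((SOME \<phi>. \<phi> \<in> y) v))"

lemma U_proj:
  assumes \<phi>: "\<phi> \<in> dual_Q2"
  shows "U v (Y_proj \<phi>) = \<phi> v + \<phi> (- v)"
proof -
  have "(SOME \<psi>. \<psi> \<in> Y_proj \<phi>) \<in> Y_proj \<phi>"
    by (rule someI[of _ \<phi>]) (simp add: Y_proj_eq[OF \<phi>])
  then have "Re ((SOME \<psi>. \<psi> \<in> Y_proj \<phi>) v) = Re (\<phi> v)"
    unfolding Y_proj_eq[OF \<phi>] using dual_minus[OF \<phi>, of v] by (auto simp: flip_def)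
  then show ?thesis
    using dual_minus[OF \<phi>, of v] by (simp add: U_def complex_eq_iff)
qed

lemma U_act: "det g = 1 \<Longrightarrow> y \<in> Y_space \<Longrightarrow> U v (Y_act (cl g) y) = U (inv2 g *v v) y"
  by (auto simp: Y_space_eq Y_act_proj U_proj dual_act_dual) (simp add: dual_act_eq minus_mv)

lemma U_mult: "y \<in> Y_space \<Longrightarrow> U v y * U w y = U (v + w) y + U (v - w) y"
proof -
  assume "y \<in> Y_space"
  then obtain \<phi> where \<phi>: "\<phi> \<in> dual_Q2" "y = Y_proj \<phi>" by (auto simp: Y_space_eq)
  have "\<phi> (v + w) = \<phi> v * \<phi> w" "\<phi> (- (v + w)) = \<phi> (- v) * \<phi> (- w)"
    "\<phi> (v - w) = \<phi> v * \<phi> (- w)" "\<phi> (- (v - w)) = \<phi> (- v) * \<phi> w"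
    using dual_add[OF \<phi>(1), of v w] dual_add[OF \<phi>(1), of "- v" "- w"]
      dual_add[OF \<phi>(1), of v "- w"] dual_add[OF \<phi>(1), of "- v" w] by simp_all
  then show ?thesis unfolding \<phi>(2) U_proj[OF \<phi>(1)] by (simp add: algebra_simps)
qed

lemma U_zero: "y \<in> Y_space \<Longrightarrow> U 0 y = 2"
  by (auto simp: Y_space_eq U_proj dual_zero)

lemma cnj_U [simp]: "cnj (U v y) = U v y"
  by (simp add: U_def)

lemma norm_U: "y \<in> Y_space \<Longrightarrow> cmod (U v y) \<le> 2"
proof -
  assume "y \<in> Y_space"
  then obtain \<phi> where \<phi>: "\<phi> \<in> dual_Q2" "y = Y_proj \<phi>" by (auto simp: Y_space_eq)
  show ?thesis
    using norm_triangle_ineq[of "\<phi> v" "\<phi> (- v)"] dual_norm[OF \<phi>(1)] by (simp add: \<phi>(2) U_proj[OF \<phi>(1)])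
qed

section \<open>Products with a countable discrete space\<close>

lemma measurable_pair_count_space:
  assumes "countable C" "\<And>s. s \<in> C \<Longrightarrow> (\<lambda>y. f (y, s)) \<in> measurable N K"
  shows "f \<in> measurable (N \<Otimes>\<^sub>M count_space C) K"
proof -
  have "(\<lambda>(s, y). f (y, s)) \<in> measurable (count_space C \<Otimes>\<^sub>M N) K"
    using assms by (intro measurable_pair_measure_countable1) auto
  then have "(\<lambda>(y, s). (case (s, y) of (s, y) \<Rightarrow> f (y, s))) \<in> measurable (N \<Otimes>\<^sub>M count_space C) K"
    using measurable_pair_swap_iff[of "\<lambda>(s, y). f (y, s)" "count_space C" N K] by simp
  then show ?thesis by (simp add: case_prod_beta')
qed

locale discrete_product = N: sigma_finite_measure N for N :: "'a measure" +
  fixes C :: "'c set"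
  assumes countable_C: "countable C"
begin

abbreviation "NC \<equiv> N \<Otimes>\<^sub>M count_space C"

sublocale C: sigma_finite_measure "count_space C"
  using countable_C by (rule sigma_finite_measure_count_space_countable)

sublocale pair_sigma_finite N "count_space C" ..

lemma space_NC: "space NC = space N \<times> C"
  by (simp add: space_pair_measure)

lemma measurable_slice: "s \<in> C \<Longrightarrow> (\<lambda>y. (y, s)) \<in> measurable N NC"
  by measurable

text \<open>One statement for left translation, right translation and the map behind
  \<open>J\<close>: the discrete coordinate is permuted while the map on \<open>N\<close> may vary
  from slice to slice.\<close>

lemma measure_preserving_twist:
  assumes \<beta>: "bij_betw \<beta> C C" and \<theta>: "\<And>s. s \<in> C \<Longrightarrow> measure_preserving N (\<theta> s)"
    and h: "\<And>y s. h (y, s) = (\<theta> s y, \<beta> s)"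
  shows "measure_preserving NC h"
proof -
  have \<theta>m: "\<theta> s \<in> measurable N N" if "s \<in> C" for s using \<theta>[OF that] by (simp add: measure_preserving_def)
  have \<beta>C: "\<beta> s \<in> C" if "s \<in> C" for s using \<beta> that by (auto simp: bij_betw_def)
  have hm: "h \<in> measurable NC NC"
  proof (rule measurable_pair_count_space[OF countable_C])
    fix s assume s: "s \<in> C"
    show "(\<lambda>y. h (y, s)) \<in> measurable N NC"
      unfolding h by (intro measurable_Pair \<theta>m[OF s] measurable_const) (simp add: \<beta>C[OF s])
  qed
  moreover have "distr NC NC h = NC"
  proof (rule measure_eqI)
    fix A assume "A \<in> sets (distr NC NC h)"
    then have A: "A \<in> sets NC" by simp
    have hA: "h -` A \<inter> space NC \<in> sets NC" using hm A by (rule measurable_sets)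
    have "emeasure (distr NC NC h) A = emeasure NC (h -` A \<inter> space NC)"
      using hm A by (rule emeasure_distr)
    also have "\<dots> = (\<integral>\<^sup>+s. emeasure N ((\<lambda>y. (y, s)) -` (h -` A \<inter> space NC)) \<partial>count_space C)"
      by (rule emeasure_pair_measure_alt2[OF hA])
    also have "\<dots> = (\<integral>\<^sup>+s. emeasure N ((\<lambda>y. (y, \<beta> s)) -` A) \<partial>count_space C)"
    proof (rule nn_integral_cong)
      fix s assume "s \<in> space (count_space C)"
      then have s: "s \<in> C" by simp
      have slice: "(\<lambda>y. (y, \<beta> s)) -` A \<in> sets N"
        using A by (rule sets_Pair2)
      have "(\<lambda>y. (y, s)) -` (h -` A \<inter> space NC) = \<theta> s -` ((\<lambda>y. (y, \<beta> s)) -` A) \<inter> space N"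
        using s by (auto simp: h space_NC)
      then show "emeasure N ((\<lambda>y. (y, s)) -` (h -` A \<inter> space NC)) = emeasure N ((\<lambda>y. (y, \<beta> s)) -` A)"
        using emeasure_distr[OF \<theta>m[OF s] slice] \<theta>[OF s] by (simp add: measure_preserving_def)
    qed
    also have "\<dots> = (\<integral>\<^sup>+s. emeasure N ((\<lambda>y. (y, s)) -` A) \<partial>count_space C)"
      by (rule nn_integral_bij_count_space[OF \<beta>])
    also have "\<dots> = emeasure NC A" by (rule emeasure_pair_measure_alt2[OF A, symmetric])
    finally show "emeasure (distr NC NC h) A = emeasure NC A" .
  qed simp
  ultimately show ?thesis by (simp add: measure_preserving_def)
qed

lemma slice_measure:
  assumes p: "p \<in> C"
  shows "density NC (indicator (space N \<times> {p})) = distr N NC (\<lambda>y. (y, p))"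
proof (rule measure_eqI)
  have S: "space N \<times> {p} \<in> sets NC" using p by auto
  fix A assume "A \<in> sets (density NC (indicator (space N \<times> {p})))"
  then have A: "A \<in> sets NC" by simp
  have "emeasure (density NC (indicator (space N \<times> {p}))) A = emeasure NC ((space N \<times> {p}) \<inter> A)"
    using S A by (subst emeasure_density) (auto simp: nn_integral_indicator[symmetric] indicator_inter_arith intro!: nn_integral_cong)
  also have "\<dots> = (\<integral>\<^sup>+s. emeasure N ((\<lambda>y. (y, s)) -` ((space N \<times> {p}) \<inter> A)) \<partial>count_space C)"
    using S A by (intro emeasure_pair_measure_alt2) auto
  also have "\<dots> = (\<integral>\<^sup>+s. emeasure N ((\<lambda>y. (y, p)) -` A \<inter> space N) * indicator {p} s \<partial>count_space C)"
    by (intro nn_integral_cong) (auto simp: indicator_def intro!: arg_cong[where f = "emeasure N"])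
  also have "\<dots> = emeasure N ((\<lambda>y. (y, p)) -` A \<inter> space N)"
    using p by (subst nn_integral_cmult_indicator) auto
  also have "\<dots> = emeasure (distr N NC (\<lambda>y. (y, p))) A"
    using measurable_slice[OF p] A by (rule emeasure_distr[symmetric])
  finally show "emeasure (density NC (indicator (space N \<times> {p}))) A = emeasure (distr N NC (\<lambda>y. (y, p))) A" .
qed simp

text \<open>Frame vectors live on a single slice, so this turns their inner products into integrals
  over \<open>Y\<close>.\<close>

lemma slice_integral:
  fixes f :: "'a \<times> 'c \<Rightarrow> 'b :: {banach, second_countable_topology}"
  assumes p: "p \<in> C" and f: "f \<in> borel_measurable NC" and 0: "\<And>y s. y \<in> space N \<Longrightarrow> s \<in> C \<Longrightarrow> s \<noteq> p \<Longrightarrow> f (y, s) = 0"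
  shows "integrable NC f \<longleftrightarrow> integrable N (\<lambda>y. f (y, p))" "(LINT x|NC. f x) = (LINT y|N. f (y, p))"
proof -
  let ?I = "indicator (space N \<times> {p}) :: _ \<Rightarrow> real"
  have S: "space N \<times> {p} \<in> sets NC" using p by auto
  have I: "?I \<in> borel_measurable NC" using S by simp
  have eq: "?I x *\<^sub>R f x = f x" if "x \<in> space NC" for x
    using that 0 by (cases x) (auto simp: space_NC indicator_def)
  have D: "density NC (\<lambda>x. ennreal (?I x)) = distr N NC (\<lambda>y. (y, p))"
    unfolding slice_measure[OF p, symmetric] by (intro density_cong) (use S in \<open>auto simp: ennreal_indicator\<close>)
  have "integrable NC f \<longleftrightarrow> integrable NC (\<lambda>x. ?I x *\<^sub>R f x)"
    using eq by (intro Bochner_Integration.integrable_cong) auto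
  also have "\<dots> \<longleftrightarrow> integrable (density NC (\<lambda>x. ennreal (?I x))) f"
    using f I by (subst integrable_density) auto
  also have "\<dots> \<longleftrightarrow> integrable N (\<lambda>y. f (y, p))"
    unfolding D using f measurable_slice[OF p] by (subst integrable_distr_eq) auto
  finally show "integrable NC f \<longleftrightarrow> integrable N (\<lambda>y. f (y, p))" .
  have "(LINT x|NC. f x) = (LINT x|NC. ?I x *\<^sub>R f x)"
    using eq by (intro Bochner_Integration.integral_cong) auto
  also have "\<dots> = (LINT x|density NC (\<lambda>x. ennreal (?I x)). f x)"
    using f I by (subst integral_density) auto
  also have "\<dots> = (LINT y|N. f (y, p))"
    unfolding D using f measurable_slice[OF p] by (subst integral_distr) auto
  finally show "(LINT x|NC. f x) = (LINT y|N. f (y, p))" .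
qed

lemma AE_NCI:
  assumes P: "\<And>s. s \<in> C \<Longrightarrow> AE y in N. P (y, s)" and m: "{x \<in> space NC. P x} \<in> sets NC"
  shows "AE x in NC. P x"
proof -
  have A: "{x \<in> space NC. \<not> P x} \<in> sets NC" using sets.Diff[OF sets.top m] by (simp add: set_diff_eq conj_commute cong: conj_cong)
  have "emeasure NC {x \<in> space NC. \<not> P x} = (\<integral>\<^sup>+s. emeasure N ((\<lambda>y. (y, s)) -` {x \<in> space NC. \<not> P x}) \<partial>count_space C)"
    by (rule emeasure_pair_measure_alt2[OF A])
  also have "\<dots> = (\<integral>\<^sup>+s. 0 \<partial>count_space C)"
  proof (rule nn_integral_cong)
    fix s assume "s \<in> space (count_space C)"
    then have s: "s \<in> C" by simp
    have "(\<lambda>y. (y, s)) -` {x \<in> space NC. \<not> P x} = {y \<in> space N. \<not> P (y, s)}"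
      using s by (auto simp: space_NC)
    moreover have "(\<lambda>y. (y, s)) -` {x \<in> space NC. \<not> P x} \<in> sets N" using A by (rule sets_Pair2)
    ultimately show "emeasure N ((\<lambda>y. (y, s)) -` {x \<in> space NC. \<not> P x}) = 0"
      using P[OF s] by (simp add: AE_iff_measurable)
  qed
  finally show ?thesis using A by (intro AE_I[where N = "{x \<in> space NC. \<not> P x}"]) auto
qed

end

section \<open>The quotient of the dual\<close>

context haar
begin

abbreviation "Y \<equiv> Y_measure \<mu>"

text \<open>It makes the family in \<open>Y_measure\<close> equal to the sigma-algebra it generates,
  so measurability on \<open>Y\<close> can be tested after \<open>Y_proj\<close>.\<close>

lemma sigma_algebra_Y: "sigma_algebra Y_space {B. B \<subseteq> Y_space \<and> Y_proj -` B \<inter> space \<mu> \<in> sets \<mu>}"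
  unfolding sigma_algebra_iff2
proof (intro conjI ballI allI impI)
  fix B assume "B \<in> {B. B \<subseteq> Y_space \<and> Y_proj -` B \<inter> space \<mu> \<in> sets \<mu>}"
  then have B: "Y_proj -` B \<inter> space \<mu> \<in> sets \<mu>" by simp
  have "Y_proj -` (Y_space - B) \<inter> space \<mu> = space \<mu> - (Y_proj -` B \<inter> space \<mu>)"
    using space_mu by (auto simp: Y_space_eq)
  then show "Y_space - B \<in> {B. B \<subseteq> Y_space \<and> Y_proj -` B \<inter> space \<mu> \<in> sets \<mu>}" using B by auto
next
  fix A :: "nat \<Rightarrow> _" assume A: "range A \<subseteq> {B. B \<subseteq> Y_space \<and> Y_proj -` B \<inter> space \<mu> \<in> sets \<mu>}"
  have eq: "Y_proj -` (\<Union>i. A i) \<inter> space \<mu> = (\<Union>i. Y_proj -` A i \<inter> space \<mu>)" by auto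
  have "(\<Union>i. Y_proj -` A i \<inter> space \<mu>) \<in> sets \<mu>"
    using A by (intro sets.countable_UN) auto
  then show "(\<Union>i. A i) \<in> {B. B \<subseteq> Y_space \<and> Y_proj -` B \<inter> space \<mu> \<in> sets \<mu>}"
    unfolding mem_Collect_eq eq using A by auto
qed auto

lemma sets_Y: "sets Y = {B. B \<subseteq> Y_space \<and> Y_proj -` B \<inter> space \<mu> \<in> sets \<mu>}"
  unfolding Y_measure_def sets_distr by (rule sigma_algebra.sets_measure_of_eq[OF sigma_algebra_Y])

lemma space_Y: "space Y = Y_space"
  unfolding Y_measure_def space_distr by (rule space_measure_of) auto

lemma measurable_Y_proj: "Y_proj \<in> measurable \<mu> Y"
  by (rule measurableI) (auto simp: space_Y sets_Y Y_space_eq space_mu)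

lemma measurable_from_Y:
  assumes "(\<lambda>\<phi>. f (Y_proj \<phi>)) \<in> measurable \<mu> K"
  shows "f \<in> measurable Y K"
proof (rule measurableI)
  fix y assume "y \<in> space Y"
  then show "f y \<in> space K" using measurable_space[OF assms] by (auto simp: space_Y Y_space_eq space_mu)
next
  fix A assume A: "A \<in> sets K"
  have "Y_proj -` (f -` A \<inter> space Y) \<inter> space \<mu> = (\<lambda>\<phi>. f (Y_proj \<phi>)) -` A \<inter> space \<mu>"
    by (auto simp: space_Y Y_space_eq space_mu)
  then show "f -` A \<inter> space Y \<in> sets Y"
    using measurable_sets[OF assms A] by (auto simp: sets_Y space_Y)
qed

text \<open>The same push-forward with \<open>Y\<close> itself as target space, the form to which
  change of variables along \<open>Y_proj\<close> applies.\<close>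

lemma Y_distr: "Y = distr \<mu> Y Y_proj"
proof -
  have "sets Y = sets (sigma Y_space {B. B \<subseteq> Y_space \<and> Y_proj -` B \<inter> space \<mu> \<in> sets \<mu>})"
    by (simp add: Y_measure_def)
  then show ?thesis unfolding Y_measure_def by (intro distr_cong) auto
qed

lemma Y_integral:
  fixes f :: "_ \<Rightarrow> complex"
  assumes "f \<in> borel_measurable Y"
  shows "(LINT y|Y. f y) = (LINT \<phi>|\<mu>. f (Y_proj \<phi>))" "integrable Y f \<longleftrightarrow> integrable \<mu> (\<lambda>\<phi>. f (Y_proj \<phi>))"
  using integral_distr[OF measurable_Y_proj, of f] integrable_distr_eq[OF measurable_Y_proj, of f] assms Y_distr
  by simp_all

sublocale Y: prob_space Y
  using prob_space_distr[OF measurable_Y_proj] Y_distr by simp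

lemma flip_preserving: "flip \<in> measurable \<mu> \<mu>" "distr \<mu> \<mu> flip = \<mu>"
  using distr_mu_eq[of flip uminus] flip_dual by (simp_all add: flip_def)

lemma dual_act_preserving:
  assumes "det g = 1"
  shows "dual_act g \<in> measurable \<mu> \<mu>" "distr \<mu> \<mu> (dual_act g) = \<mu>"
proof -
  have inj: "inv2 g *v v = 0 \<longleftrightarrow> v = 0" for v
    using inv2_cancel(1)[OF assms, of v] by (metis matrix_vector_mult_0_right)
  show "dual_act g \<in> measurable \<mu> \<mu>" "distr \<mu> \<mu> (dual_act g) = \<mu>"
    using distr_mu_eq[of "dual_act g" "\<lambda>v. inv2 g *v v"] assms dual_act_dual[OF assms] inj
    by (simp_all add: dual_act_eq)
qed

lemma Y_act_preserving:
  assumes g: "det g = 1"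
  shows "measure_preserving Y (Y_act (cl g))"
proof -
  note m = dual_act_preserving[OF g]
  have eq: "Y_act (cl g) (Y_proj \<phi>) = Y_proj (dual_act g \<phi>)" if "\<phi> \<in> space \<mu>" for \<phi>
    using that g by (simp add: space_mu Y_act_proj)
  have "(\<lambda>\<phi>. Y_proj (dual_act g \<phi>)) \<in> measurable \<mu> Y"
    using m(1) measurable_Y_proj by (rule measurable_compose)
  then have "(\<lambda>\<phi>. Y_act (cl g) (Y_proj \<phi>)) \<in> measurable \<mu> Y"
    by (subst measurable_cong[OF eq]) auto
  then have am: "Y_act (cl g) \<in> measurable Y Y" by (rule measurable_from_Y)
  have "distr Y Y (Y_act (cl g)) = distr (distr \<mu> Y Y_proj) Y (Y_act (cl g))" using Y_distr by simp
  also have "\<dots> = distr \<mu> Y (Y_act (cl g) \<circ> Y_proj)" by (rule distr_distr[OF am measurable_Y_proj])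
  also have "\<dots> = distr \<mu> Y (Y_proj \<circ> dual_act g)" by (rule distr_cong) (auto simp: eq)
  also have "\<dots> = distr (distr \<mu> \<mu> (dual_act g)) Y Y_proj" by (rule distr_distr[OF measurable_Y_proj m(1), symmetric])
  also have "\<dots> = Y" using m(2) Y_distr by simp
  finally show ?thesis using am by (simp add: measure_preserving_def)
qed

lemma U_measurable [measurable]: "U v \<in> borel_measurable Y"
proof (rule measurable_from_Y)
  have "(\<lambda>\<phi>. \<phi> v + \<phi> (- v)) \<in> borel_measurable \<mu>" by measurable
  then show "(\<lambda>\<phi>. U v (Y_proj \<phi>)) \<in> borel_measurable \<mu>"
    by (subst measurable_cong[of \<mu> _ "\<lambda>\<phi>. \<phi> v + \<phi> (- v)"]) (auto simp: space_mu U_proj)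
qed

lemma U_integrable: "integrable Y (U v)"
  by (rule Y.integrable_const_bound[where B = 2]) (auto simp: space_Y norm_U)

lemma U_integral: "(LINT y|Y. U v y) = 2 * of_bool (v = 0)"
proof -
  have "(LINT y|Y. U v y) = (LINT \<phi>|\<mu>. U v (Y_proj \<phi>))" by (rule Y_integral) simp
  also have "\<dots> = (LINT \<phi>|\<mu>. \<phi> v + \<phi> (- v))"
    by (intro Bochner_Integration.integral_cong) (auto simp: space_mu U_proj)
  also have "\<dots> = 2 * of_bool (v = 0)"
    by (simp add: eval_integrable integral_eval)
  finally show ?thesis .
qed

lemma U_inner: "(LINT y|Y. U v y * U w y) = 2 * (of_bool (v = w) + of_bool (v = - w))"
proof -
  have "(LINT y|Y. U v y * U w y) = (LINT y|Y. U (v + w) y + U (v - w) y)"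
    by (intro Bochner_Integration.integral_cong) (auto simp: space_Y U_mult)
  also have "\<dots> = 2 * (of_bool (v = w) + of_bool (v = - w))"
    by (simp add: U_integrable U_integral add_eq_0_iff2)
  finally show ?thesis .
qed

text \<open>Pulled back to the dual, \<open>f\<close> is invariant under the flip, so its integrals
  against the characters at \<open>v\<close> and \<open>- v\<close> agree, and each is half the
  integral of \<open>f\<close> against \<open>U v\<close>.\<close>

lemma U_total:
  assumes f: "integrable Y f" and 0: "\<And>v. (LINT y|Y. f y * U v y) = 0"
  shows "AE y in Y. f y = 0"
proof -
  have fm [measurable]: "f \<in> borel_measurable Y" using f by (rule borel_measurable_integrable)
  define F where "F \<phi> = f (Y_proj \<phi>)" for \<phi>
  have F: "integrable \<mu> F" unfolding F_def using Y_integral(2)[OF fm] f by simp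
  have [measurable]: "F \<in> borel_measurable \<mu>" using F by (rule borel_measurable_integrable)
  have ip: "integrable \<mu> (\<lambda>\<phi>. F \<phi> * \<phi> v)" for v
  proof (rule Bochner_Integration.integrable_bound[OF F])
    show "AE \<phi> in \<mu>. norm (F \<phi> * \<phi> v) \<le> norm (F \<phi>)" using space_mu by (intro AE_I2) (auto simp: dual_norm norm_mult)
  qed measurable
  have "(LINT \<phi>|\<mu>. F \<phi> * \<phi> v) = 0" for v
  proof -
    have "(LINT \<phi>|\<mu>. F \<phi> * \<phi> v) = (LINT \<phi>|distr \<mu> \<mu> flip. F \<phi> * \<phi> v)" by (simp add: flip_preserving)
    also have "\<dots> = (LINT \<phi>|\<mu>. F (flip \<phi>) * flip \<phi> v)"
      using flip_preserving(1) by (rule integral_distr) measurable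
    also have "\<dots> = (LINT \<phi>|\<mu>. F \<phi> * \<phi> (- v))"
      by (intro Bochner_Integration.integral_cong refl)
        (simp only: space_mu F_def Y_proj_flip, simp only: flip_def)
    finally have "2 * (LINT \<phi>|\<mu>. F \<phi> * \<phi> v) = (LINT \<phi>|\<mu>. F \<phi> * \<phi> v) + (LINT \<phi>|\<mu>. F \<phi> * \<phi> (- v))" by simp
    also have "\<dots> = (LINT \<phi>|\<mu>. F \<phi> * \<phi> v + F \<phi> * \<phi> (- v))"
      by (rule Bochner_Integration.integral_add[symmetric]) (rule ip)+
    also have "\<dots> = (LINT \<phi>|\<mu>. f (Y_proj \<phi>) * U v (Y_proj \<phi>))"
      by (intro Bochner_Integration.integral_cong) (auto simp: space_mu F_def U_proj distrib_left)
    also have "\<dots> = (LINT y|Y. f y * U v y)"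
      by (rule Y_integral(1)[symmetric]) measurable
    finally show ?thesis using 0 by simp
  qed
  then have "AE \<phi> in \<mu>. F \<phi> = 0" by (rule fourier_zero[OF F])
  then have "AE y in distr \<mu> Y Y_proj. f y = 0"
    unfolding F_def by (subst AE_distr_iff[OF measurable_Y_proj]) measurable
  then show ?thesis by (subst Y_distr)
qed

end

section \<open>The crossed product\<close>

lemma measure_preserving_id: "measure_preserving N (\<lambda>y. y)"
  by (simp add: measure_preserving_def distr_id[unfolded id_def])

lemma bij_PSL2Q:
  assumes "c \<in> carrier PSL2Q"
  shows "bij_betw (\<lambda>s. c \<otimes>\<^bsub>PSL2Q\<^esub> s) (carrier PSL2Q) (carrier PSL2Q)"
    "bij_betw (\<lambda>s. s \<otimes>\<^bsub>PSL2Q\<^esub> c) (carrier PSL2Q) (carrier PSL2Q)"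
    "bij_betw (m_inv PSL2Q) (carrier PSL2Q) (carrier PSL2Q)"
proof -
  interpret group PSL2Q by (rule group_PSL2Q)
  show "bij_betw (\<lambda>s. c \<otimes>\<^bsub>PSL2Q\<^esub> s) (carrier PSL2Q) (carrier PSL2Q)"
    using assms by (intro bij_betw_byWitness[of _ "\<lambda>s. inv\<^bsub>PSL2Q\<^esub> c \<otimes>\<^bsub>PSL2Q\<^esub> s"]) (auto simp: m_assoc[symmetric])
  show "bij_betw (\<lambda>s. s \<otimes>\<^bsub>PSL2Q\<^esub> c) (carrier PSL2Q) (carrier PSL2Q)"
    using assms by (intro bij_betw_byWitness[of _ "\<lambda>s. s \<otimes>\<^bsub>PSL2Q\<^esub> inv\<^bsub>PSL2Q\<^esub> c"]) (auto simp: m_assoc)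
  show "bij_betw (m_inv PSL2Q) (carrier PSL2Q) (carrier PSL2Q)"
    by (intro bij_betw_byWitness[of _ "m_inv PSL2Q"]) auto
qed

context haar
begin

sublocale D: discrete_product Y "carrier PSL2Q"
  by unfold_locales (rule countable_PSL2Q)

abbreviation "X \<equiv> Y \<Otimes>\<^sub>M count_space (carrier PSL2Q)"

lemma crossed_space_eq: "crossed_space PSL2Q Y = L2 X"
  by (simp add: crossed_space_def)

lemma space_X: "x \<in> space X \<longleftrightarrow> (\<exists>y g. x = (y, cl g) \<and> y \<in> Y_space \<and> det g = 1)"
  unfolding D.space_NC by (auto simp: space_Y carrier_PSL2Q)

lemma class_eqI:
  assumes "F \<in> square_integrable X" "F' \<in> square_integrable X"
    and "\<And>y g. y \<in> Y_space \<Longrightarrow> det g = 1 \<Longrightarrow> F (y, cl g) = F' (y, cl g)"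
  shows "L2_class X F = L2_class X F'"
  unfolding L2_class_eq_iff[OF assms(1,2)] using assms(3) by (intro AE_I2) (auto simp: space_X)

section \<open>The concrete frame vectors and operators\<close>

definition on_slice :: "(rat^2^2) set \<Rightarrow> ((rat^2 \<Rightarrow> complex) set \<Rightarrow> complex) \<Rightarrow> _ \<Rightarrow> complex" where
  "on_slice p f = (\<lambda>(y, s). if s = p then f y else 0)"

lemma on_slice_measurable:
  assumes "f \<in> borel_measurable Y"
  shows "on_slice p f \<in> borel_measurable X"
  using assms by (intro measurable_pair_count_space countable_PSL2Q) (simp add: on_slice_def)

lemma on_slice_square_integrable:
  assumes p: "p \<in> carrier PSL2Q" and f: "f \<in> borel_measurable Y" "\<And>y. y \<in> Y_space \<Longrightarrow> cmod (f y) \<le> B"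
  shows "on_slice p f \<in> square_integrable X"
proof -
  note m [measurable] = on_slice_measurable[OF f(1)]
  have [measurable]: "f \<in> borel_measurable Y" by (rule f)
  have "integrable X (\<lambda>x. (cmod (on_slice p f x))\<^sup>2) \<longleftrightarrow> integrable Y (\<lambda>y. (cmod (on_slice p f (y, p)))\<^sup>2)"
  proof (rule D.slice_integral(1)[OF p])
    show "(\<lambda>x. (cmod (on_slice p f x))\<^sup>2) \<in> borel_measurable X" by measurable
  qed (simp add: on_slice_def)
  moreover have "integrable Y (\<lambda>y. (cmod (on_slice p f (y, p)))\<^sup>2)"
  proof (rule Y.integrable_const_bound[where B = "B\<^sup>2"])
    show "AE y in Y. norm ((cmod (on_slice p f (y, p)))\<^sup>2) \<le> B\<^sup>2"
      using f(2) by (intro AE_I2) (auto simp: on_slice_def space_Y intro!: power_mono)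
    show "(\<lambda>y. (cmod (on_slice p f (y, p)))\<^sup>2) \<in> borel_measurable Y" unfolding on_slice_def by simp
  qed
  ultimately show ?thesis using m by (simp add: square_integrable_def)
qed

text \<open>In the crossed product \<open>U v\<close> acts on slice \<open>s\<close> by its value at
  \<open>Y_act s y\<close>; for \<open>s = cl g\<close> this value is
  \<open>U (inv2 g *v v) y\<close>, by \<open>U_act\<close>.\<close>

definition bfun :: "rat^2 \<Rightarrow> rat^2^2 \<Rightarrow> _ \<Rightarrow> complex" where
  "bfun v g = on_slice (cl g) (U (inv2 g *v v))"

lemma bfun_apply: "bfun v g (y, s) = (if s = cl g then U (inv2 g *v v) y else 0)"
  by (simp add: bfun_def on_slice_def)

lemma bfun_sq: "det g = 1 \<Longrightarrow> bfun v g \<in> square_integrable X"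
  unfolding bfun_def using norm_U by (intro on_slice_square_integrable) auto

lemma bfun_integral:
  assumes g: "det g = 1" and F: "F \<in> borel_measurable X"
  shows "(LINT x|X. F x * cnj (bfun v g x)) = (LINT y|Y. F (y, cl g) * U (inv2 g *v v) y)"
proof -
  have "(\<lambda>x. F x * cnj (bfun v g x)) \<in> borel_measurable X"
    using F bfun_sq[OF g, of v] by measurable
  then have "(LINT x|X. F x * cnj (bfun v g x)) = (LINT y|Y. F (y, cl g) * cnj (bfun v g (y, cl g)))"
    using g by (intro D.slice_integral(2)) (auto simp: bfun_apply)
  then show ?thesis by (simp add: bfun_apply)
qed

text \<open>\<open>hR g\<close> also moves \<open>Y\<close>: the factors \<open>cl g\<close> and
  \<open>cl (inv2 g)\<close> cancel in \<open>Y_act s y\<close>, so right translation commutes with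
  the twisted multiplications. \<open>hJ\<close> realises taking adjoints: up to conjugation, the
  value on slice \<open>s\<close> is read off the inverse slice at the point moved by
  \<open>s\<close>.\<close>

definition hL where "hL g = (\<lambda>(y, s). (y, m_inv PSL2Q (cl g) \<otimes>\<^bsub>PSL2Q\<^esub> s))"
definition hR where "hR g = (\<lambda>(y, s). (Y_act (cl (inv2 g)) y, s \<otimes>\<^bsub>PSL2Q\<^esub> cl g))"
definition hJ where "hJ = (\<lambda>(y, s). (Y_act s y, m_inv PSL2Q s))"

lemma hL_apply: "det g = 1 \<Longrightarrow> det k = 1 \<Longrightarrow> hL g (y, cl k) = (y, cl (inv2 g ** k))"
  and hR_apply: "det g = 1 \<Longrightarrow> det k = 1 \<Longrightarrow> hR g (y, cl k) = (Y_act (cl (inv2 g)) y, cl (k ** g))"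
  and hJ_apply: "det k = 1 \<Longrightarrow> hJ (y, cl k) = (Y_act (cl k) y, cl (inv2 k))"
  by (simp_all add: hL_def hR_def hJ_def inv2(1))

lemma hL_preserving: "det g = 1 \<Longrightarrow> measure_preserving X (hL g)"
  by (rule D.measure_preserving_twist[OF bij_PSL2Q(1)[of "cl (inv2 g)"] measure_preserving_id])
    (simp_all add: hL_def inv2(1))

lemma hR_preserving: "det g = 1 \<Longrightarrow> measure_preserving X (hR g)"
  by (rule D.measure_preserving_twist[OF bij_PSL2Q(2)[of "cl g"] Y_act_preserving[of "inv2 g"]])
    (simp_all add: hR_def inv2(1))

lemma hJ_preserving: "measure_preserving X hJ"
proof (rule D.measure_preserving_twist[where \<beta> = "m_inv PSL2Q" and \<theta> = Y_act])
  show "bij_betw (m_inv PSL2Q) (carrier PSL2Q) (carrier PSL2Q)"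
    by (rule bij_PSL2Q(3)[of "cl (mat 1)"]) simp
  show "measure_preserving Y (Y_act s)" if "s \<in> carrier PSL2Q" for s
    using that Y_act_preserving by (auto simp: carrier_PSL2Q)
qed (simp_all add: hJ_def)

definition Om where "Om = L2_class X (on_slice (cl (mat 1)) (\<lambda>_. 1))"
definition b where "b v g = L2_class X (bfun v g)"
definition Lam where "Lam g = comp_op X (hL g)"
definition Rho where "Rho g = comp_op X (hR g)"
text \<open>The function is evaluated at \<open>y\<close>, whereas \<open>crossed_mult\<close>
  evaluates at \<open>Y_act s y\<close>; without the twist by \<open>s\<close> it is right
  multiplication and commutes with left translations.\<close>

definition R where "R w = mult_op X (\<lambda>(y, s). U w y)"
definition J where "J \<xi> = L2_class X (\<lambda>x. cnj (L2_rep (comp_op X hJ \<xi>) x))"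
definition Mul where "Mul = crossed_mult PSL2Q Y_act Y ` ess_bounded Y"

lemma one_slice_sq: "on_slice (cl (mat 1)) (\<lambda>_. 1) \<in> square_integrable X"
  by (rule on_slice_square_integrable[where B = 1]) auto

lemma Lam_eq: "Lam g = crossed_translation PSL2Q Y (cl g)"
  unfolding Lam_def comp_op_def crossed_translation_def crossed_space_eq
  by (simp add: hL_def case_prod_beta')

lemma Lam_image: "Lam ` {g. det g = 1} = crossed_translation PSL2Q Y ` carrier PSL2Q"
  unfolding carrier_PSL2Q image_image Lam_eq ..

lemma crossed_mult_eq: "crossed_mult PSL2Q Y_act Y f = mult_op X (\<lambda>(y, s). f (Y_act s y))"
  unfolding mult_op_def crossed_mult_def crossed_space_eq by (simp add: case_prod_beta')

lemma ess_bounded_crossed: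
  assumes f: "f \<in> ess_bounded Y"
  shows "(\<lambda>(y, s). f (Y_act s y)) \<in> ess_bounded X"
proof -
  have e: "(\<lambda>y. f (Y_act s y)) \<in> ess_bounded Y" if "s \<in> carrier PSL2Q" for s
    using that Y_act_preserving measure_preserving_ess_bounded[OF _ f] by (auto simp: carrier_PSL2Q)
  have m: "(\<lambda>(y, s). f (Y_act s y)) \<in> borel_measurable X"
    using e by (intro measurable_pair_count_space countable_PSL2Q) (auto simp: ess_bounded_def)
  obtain B where B: "AE y in Y. cmod (f y) \<le> B" using f by (auto simp: ess_bounded_def)
  have "AE x in X. cmod (case x of (y, s) \<Rightarrow> f (Y_act s y)) \<le> B"
  proof (rule D.AE_NCI)
    fix s assume "s \<in> carrier PSL2Q"
    then obtain g where g: "det g = 1" "s = cl g" by (auto simp: carrier_PSL2Q)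
    show "AE y in Y. cmod (case (y, s) of (y, s) \<Rightarrow> f (Y_act s y)) \<le> B"
      using measure_preserving_AE[OF Y_act_preserving[OF g(1)] B] by (simp add: g)
  next
    show "{x \<in> space X. cmod (case x of (y, s) \<Rightarrow> f (Y_act s y)) \<le> B} \<in> sets X"
      using m by measurable
  qed
  then show ?thesis using m by (auto simp: ess_bounded_def)
qed

lemma ess_bounded_U: "(\<lambda>(y, s). U w y) \<in> ess_bounded X"
proof -
  have "(\<lambda>(y, s). U w y) \<in> borel_measurable X" by measurable
  moreover have "AE x in X. cmod (case x of (y, s) \<Rightarrow> U w y) \<le> 2"
    by (intro AE_I2) (auto simp: space_X norm_U)
  ultimately show ?thesis by (auto simp: ess_bounded_def)
qed

lemma U_ess_bounded: "U w \<in> ess_bounded Y"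
  unfolding ess_bounded_def using norm_U by (auto simp: space_Y intro!: exI[of _ 2] AE_I2)

lemma comp_commute_mult:
  assumes h: "measure_preserving X h" and a: "a \<in> ess_bounded X" and \<xi>: "\<xi> \<in> carrier (L2 X)"
    and inv: "\<And>y g. y \<in> Y_space \<Longrightarrow> det g = 1 \<Longrightarrow> a (h (y, cl g)) = a (y, cl g)"
  shows "comp_op X h (mult_op X a \<xi>) = mult_op X a (comp_op X h \<xi>)"
  using \<xi>
proof (rule L2_cases)
  fix f assume f: "f \<in> square_integrable X" "\<xi> = L2_class X f"
  note ah = measure_preserving_ess_bounded[OF h a] and fh = measure_preserving_square_integrable[OF h f(1)]
  show ?thesis
    unfolding f(2) mult_op_class[OF a f(1)] comp_op_class[OF h f(1)] comp_op_class[OF h ess_bounded_mult[OF a f(1)]]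
      mult_op_class[OF a fh]
    by (rule class_eqI[OF ess_bounded_mult[OF ah fh] ess_bounded_mult[OF a fh]]) (simp add: inv)
qed

lemma comp_commute_comp:
  assumes h: "measure_preserving X h" and k: "measure_preserving X k" and \<xi>: "\<xi> \<in> carrier (L2 X)"
    and eq: "\<And>y g. y \<in> Y_space \<Longrightarrow> det g = 1 \<Longrightarrow> k (h (y, cl g)) = h (k (y, cl g))"
  shows "comp_op X h (comp_op X k \<xi>) = comp_op X k (comp_op X h \<xi>)"
  using \<xi>
proof (rule L2_cases)
  fix f assume f: "f \<in> square_integrable X" "\<xi> = L2_class X f"
  note fh = measure_preserving_square_integrable[OF h f(1)] and fk = measure_preserving_square_integrable[OF k f(1)]
  show ?thesis
    unfolding f(2) comp_op_class[OF h f(1)] comp_op_class[OF k f(1)] comp_op_class[OF h fk] comp_op_class[OF k fh]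
    by (rule class_eqI[OF measure_preserving_square_integrable[OF h fk] measure_preserving_square_integrable[OF k fh]])
      (simp add: eq)
qed

lemma J_class:
  assumes f: "f \<in> square_integrable X"
  shows "J (L2_class X f) = L2_class X (\<lambda>x. cnj (f (hJ x)))"
proof -
  note fh = measure_preserving_square_integrable[OF hJ_preserving f]
  have "AE x in X. cnj (L2_rep (L2_class X (\<lambda>x. f (hJ x))) x) = cnj (f (hJ x))"
    using L2_rep_class(2)[OF fh] by eventually_elim simp
  then show ?thesis
    unfolding J_def comp_op_class[OF hJ_preserving f]
    by (subst L2_class_eq_iff[OF square_integrable_cnj[OF L2_rep_class(1)[OF fh]] square_integrable_cnj[OF fh]])
qed

lemma frame_bounded:
  "det g = 1 \<Longrightarrow> Lam g \<in> bounded_ops (L2 X)" "det g = 1 \<Longrightarrow> Rho g \<in> bounded_ops (L2 X)"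
  "R w \<in> bounded_ops (L2 X)" "Mul \<subseteq> bounded_ops (L2 X)"
  unfolding Lam_def Rho_def R_def Mul_def
  by (auto simp: crossed_mult_eq intro!: comp_op_bounded mult_op_bounded hL_preserving hR_preserving
      ess_bounded_U ess_bounded_crossed)

lemma frame_adjoint:
  assumes g: "det g = 1"
  shows "is_adjoint (L2 X) (Lam g) (Lam (inv2 g))" "is_adjoint (L2 X) (Rho g) (Rho (inv2 g))"
proof -
  note g' = inv2[OF g]
  show "is_adjoint (L2 X) (Lam g) (Lam (inv2 g))"
    unfolding Lam_def
  proof (rule comp_op_adjoint[OF hL_preserving[OF g] hL_preserving[OF g'(1)]])
    show "AE x in X. hL (inv2 g) (hL g x) = x"
      by (intro AE_I2) (auto simp: space_X hL_apply g g' det_mul inv2_cancel[OF g])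
  qed
  show "is_adjoint (L2 X) (Rho g) (Rho (inv2 g))"
    unfolding Rho_def
  proof (rule comp_op_adjoint[OF hR_preserving[OF g] hR_preserving[OF g'(1)]])
    show "AE x in X. hR (inv2 g) (hR g x) = x"
      by (intro AE_I2) (auto simp: space_X hR_apply g g' det_mul inv2_cancel[OF g] Y_act_mult Y_act_one)
  qed
qed

lemma cl_mult_left_eq_iff: "det g = 1 \<Longrightarrow> det k = 1 \<Longrightarrow> cl (inv2 g ** k) = cl h \<longleftrightarrow> cl k = cl (g ** h)"
  unfolding cl_eq_iff using inv2_cancel(3,4)[of g] by (metis neg_mult(2))

lemma cl_mult_right_eq_iff: "det g = 1 \<Longrightarrow> det k = 1 \<Longrightarrow> cl (k ** g) = cl h \<longleftrightarrow> cl k = cl (h ** inv2 g)"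
  unfolding cl_eq_iff using inv2_cancel(5,6)[of g] by (metis neg_mult(1))

lemma cl_inv2_eq_iff: "cl (inv2 k) = cl g \<longleftrightarrow> cl k = cl (inv2 g)"
  unfolding cl_eq_iff by (metis inv2_inv2 inv2_minus)

lemma Lam_b:
  assumes g: "det g = 1" and h: "det h = 1"
  shows "Lam g (b v h) = b (g *v v) (g ** h)"
  unfolding Lam_def b_def comp_op_class[OF hL_preserving[OF g] bfun_sq[OF h]]
proof (rule class_eqI)
  fix y k assume "y \<in> Y_space" and k: "det (k :: rat^2^2) = 1"
  have "inv2 (g ** h) *v (g *v v) = inv2 h *v v"
    by (simp add: inv2_mult matrix_vector_mul_assoc[symmetric] inv2_cancel[OF g])
  then show "bfun v h (hL g (y, cl k)) = bfun (g *v v) (g ** h) (y, cl k)"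
    using cl_mult_left_eq_iff[OF g k, of h] by (simp add: hL_apply[OF g k] bfun_apply)
qed (use g h in \<open>auto intro!: measure_preserving_square_integrable hL_preserving bfun_sq simp: det_mul\<close>)

lemma Rho_b:
  assumes g: "det g = 1" and h: "det h = 1"
  shows "Rho g (b v h) = b v (h ** inv2 g)"
  unfolding Rho_def b_def comp_op_class[OF hR_preserving[OF g] bfun_sq[OF h]]
proof (rule class_eqI)
  fix y k assume y: "y \<in> Y_space" and k: "det (k :: rat^2^2) = 1"
  have "U (inv2 h *v v) (Y_act (cl (inv2 g)) y) = U (inv2 (h ** inv2 g) *v v) y"
    by (simp add: U_act[OF inv2(1)[OF g] y] inv2_mult matrix_vector_mul_assoc)
  then show "bfun v h (hR g (y, cl k)) = bfun v (h ** inv2 g) (y, cl k)"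
    using cl_mult_right_eq_iff[OF g k, of h] by (simp add: hR_apply[OF g k] bfun_apply)
qed (use g h in \<open>auto intro!: measure_preserving_square_integrable hR_preserving bfun_sq simp: det_mul inv2(1)\<close>)

lemma R_b:
  assumes g: "det g = 1"
  shows "R w (b v g) = hadd (L2 X) (b (v + g *v w) g) (b (v - g *v w) g)"
  unfolding R_def b_def mult_op_class[OF ess_bounded_U bfun_sq[OF g]] L2_add[OF bfun_sq[OF g] bfun_sq[OF g]]
proof (rule class_eqI)
  fix y k assume y: "y \<in> Y_space" and k: "det (k :: rat^2^2) = 1"
  have "U w y * U (inv2 g *v v) y = U (inv2 g *v v + w) y + U (inv2 g *v v - w) y"
    using U_mult[OF y, of "inv2 g *v v" w] by (simp add: mult.commute)
  moreover have "inv2 g *v (v + g *v w) = inv2 g *v v + w" "inv2 g *v (v - g *v w) = inv2 g *v v - w"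
    using inv2_cancel(2)[OF g, of w] by (simp_all add: matrix_vector_right_distrib matrix_vector_mult_diff_distrib)
  ultimately show "(case (y, cl k) of (y, s) \<Rightarrow> U w y) * bfun v g (y, cl k)
      = bfun (v + g *v w) g (y, cl k) + bfun (v - g *v w) g (y, cl k)"
    by (simp add: bfun_apply)
qed (intro ess_bounded_mult ess_bounded_U square_integrable_add bfun_sq g)+

lemma J_b:
  assumes g: "det g = 1"
  shows "J (b v g) = b (inv2 g *v v) (inv2 g)"
  unfolding b_def J_class[OF bfun_sq[OF g]]
proof (rule class_eqI)
  fix y k assume y: "y \<in> Y_space" and k: "det (k :: rat^2^2) = 1"
  have "U (inv2 g *v v) (Y_act (cl k) y) = U v y" if "cl k = cl (inv2 g)"
    using U_act[OF inv2(1)[OF g] y] that inv2_cancel(1)[OF g] by simp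
  then show "cnj (bfun v g (hJ (y, cl k))) = bfun (inv2 g *v v) (inv2 g) (y, cl k)"
    using k g by (simp add: hJ_apply bfun_apply cl_inv2_eq_iff inv2_cancel)
qed (intro square_integrable_cnj measure_preserving_square_integrable[OF hJ_preserving] bfun_sq g inv2(1))+

lemma J_inner:
  assumes "\<xi> \<in> carrier (L2 X)" "\<eta> \<in> carrier (L2 X)"
  shows "hinner (L2 X) (J \<xi>) (J \<eta>) = hinner (L2 X) \<eta> \<xi>"
proof -
  obtain f where f: "f \<in> square_integrable X" "\<xi> = L2_class X f" using assms(1) by (rule L2_cases)
  obtain e where e: "e \<in> square_integrable X" "\<eta> = L2_class X e" using assms(2) by (rule L2_cases)
  note fh = square_integrable_cnj[OF measure_preserving_square_integrable[OF hJ_preserving f(1)]]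
  note eh = square_integrable_cnj[OF measure_preserving_square_integrable[OF hJ_preserving e(1)]]
  have m: "(\<lambda>x. e x * cnj (f x)) \<in> borel_measurable X"
    using integrable_inner[OF e(1) f(1)] by (rule borel_measurable_integrable)
  have "hinner (L2 X) (J \<xi>) (J \<eta>) = (LINT x|X. e (hJ x) * cnj (f (hJ x)))"
    unfolding f(2) e(2) J_class[OF f(1)] J_class[OF e(1)] L2_inner[OF fh eh] by (simp add: mult.commute)
  also have "\<dots> = (LINT x|X. e x * cnj (f x))"
    using measure_preserving_integral(1)[OF hJ_preserving m] .
  also have "\<dots> = hinner (L2 X) \<eta> \<xi>" unfolding f(2) e(2) L2_inner[OF e(1) f(1)] ..
  finally show ?thesis .
qed

lemma b_inner:
  assumes g: "det g = 1" and h: "det h = 1"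
  shows "hinner (L2 X) (b v g) (b w h) =
    2 * (of_bool (v = w) + of_bool (v = - w)) * (of_bool (g = h) + of_bool (g = - h))"
proof -
  have bm: "bfun v g \<in> borel_measurable X" using bfun_sq[OF g] by (rule square_integrable_measurable)
  have I: "hinner (L2 X) (b v g) (b w h) = (LINT y|Y. bfun v g (y, cl h) * U (inv2 h *v w) y)"
    unfolding b_def L2_inner[OF bfun_sq[OF g] bfun_sq[OF h]] by (rule bfun_integral[OF h bm])
  show ?thesis
  proof (cases "g = h \<or> g = - h")
    case False
    then have "cl g \<noteq> cl h" by (simp add: cl_eq_iff)
    then show ?thesis using False unfolding I bfun_apply by auto
  next
    case True
    then have cl: "cl h = cl g" by (auto simp: cl_eq_iff)
    have ne: "h \<noteq> - h" by (rule neg_ne[OF h])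
    have inj: "inv2 h *v a = inv2 h *v c \<longleftrightarrow> a = c" for a c
      using inv2_cancel(1)[OF h] by metis
    have "hinner (L2 X) (b v g) (b w h) = 2 * (of_bool (inv2 g *v v = inv2 h *v w) + of_bool (inv2 g *v v = - (inv2 h *v w)))"
      unfolding I bfun_apply cl by (simp add: U_inner)
    also have "of_bool (inv2 g *v v = inv2 h *v w) + of_bool (inv2 g *v v = - (inv2 h *v w)) = (of_bool (v = w) + of_bool (v = - w) :: complex)"
      using True inj by (auto simp: inv2_minus minus_mv(1) minus_mv(2)[symmetric] minus_equation_iff)
    finally have "hinner (L2 X) (b v g) (b w h) = 2 * (of_bool (v = w) + of_bool (v = - w))" .
    moreover have "(of_bool (g = h) + of_bool (g = - h) :: complex) = 1" using True ne by auto
    ultimately show ?thesis by (simp only: mult_1_right)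
  qed
qed

text \<open>Slice by slice: over the probability space \<open>Y\<close> square-integrability gives
  integrability, so \<open>U_total\<close> applies, with the index \<open>g *v v\<close> undoing the
  twist in \<open>bfun\<close>; there are countably many slices.\<close>

lemma b_total:
  assumes \<xi>: "\<xi> \<in> carrier (L2 X)" and 0: "\<And>v g. det g = 1 \<Longrightarrow> hinner (L2 X) \<xi> (b v g) = 0"
  shows "hnsq (L2 X) \<xi> = 0"
proof -
  obtain f where f: "f \<in> square_integrable X" "\<xi> = L2_class X f" using \<xi> by (rule L2_cases)
  have fm [measurable]: "f \<in> borel_measurable X" using f(1) by (rule square_integrable_measurable)
  have "AE y in Y. f (y, s) = 0" if s: "s \<in> carrier PSL2Q" for s
  proof -
    obtain g where g: "det g = 1" "s = cl g" using s by (auto simp: carrier_PSL2Q)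
    have [measurable]: "(\<lambda>y. f (y, s)) \<in> borel_measurable Y"
      using measurable_compose[OF D.measurable_slice[OF s] fm] .
    have "on_slice s (\<lambda>y. f (y, s)) \<in> square_integrable X"
    proof (rule square_integrable_bound[OF on_slice_measurable square_integrable_integrable[OF f(1)]])
      show "AE x in X. (cmod (on_slice s (\<lambda>y. f (y, s)) x))\<^sup>2 \<le> (cmod (f x))\<^sup>2"
        by (intro AE_I2) (auto simp: on_slice_def split: prod.split)
    qed measurable
    then have "integrable X (\<lambda>x. (cmod (on_slice s (\<lambda>y. f (y, s)) x))\<^sup>2)" by (rule square_integrable_integrable)
    moreover have "integrable X (\<lambda>x. (cmod (on_slice s (\<lambda>y. f (y, s)) x))\<^sup>2)
      \<longleftrightarrow> integrable Y (\<lambda>y. (cmod (on_slice s (\<lambda>y. f (y, s)) (y, s)))\<^sup>2)"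
    proof (rule D.slice_integral(1)[OF s])
      have "on_slice s (\<lambda>y. f (y, s)) \<in> borel_measurable X" by (rule on_slice_measurable) measurable
      then show "(\<lambda>x. (cmod (on_slice s (\<lambda>y. f (y, s)) x))\<^sup>2) \<in> borel_measurable X" by measurable
    qed (simp add: on_slice_def)
    ultimately have i2: "integrable Y (\<lambda>y. (cmod (f (y, s)))\<^sup>2)" by (simp add: on_slice_def)
    have i: "integrable Y (\<lambda>y. f (y, s))"
    proof (rule Bochner_Integration.integrable_bound)
      show "integrable Y (\<lambda>y. 1 + (cmod (f (y, s)))\<^sup>2)" using i2 by simp
      have "cmod z \<le> 1 + (cmod z)\<^sup>2" for z
      proof -
        have "0 \<le> (cmod z - 1)\<^sup>2 + (cmod z)\<^sup>2 + 1" by simp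
        then show ?thesis by (simp add: power2_diff)
      qed
      then show "AE y in Y. norm (f (y, s)) \<le> norm (1 + (cmod (f (y, s)))\<^sup>2)"
        by (intro AE_I2) (simp add: abs_of_nonneg)
    qed measurable
    show ?thesis
    proof (rule U_total[OF i])
      fix v
      have "hinner (L2 X) \<xi> (b (g *v v) g) = (LINT y|Y. f (y, cl g) * U (inv2 g *v (g *v v)) y)"
        unfolding f(2) b_def L2_inner[OF f(1) bfun_sq[OF g(1)]] by (rule bfun_integral[OF g(1) fm])
      then show "(LINT y|Y. f (y, s) * U v y) = 0"
        using 0[OF g(1), of "g *v v"] inv2_cancel(2)[OF g(1), of v] g(2) by simp
    qed
  qed
  then have "AE x in X. f x = 0"
    by (intro D.AE_NCI) (auto, measurable)
  then have "(LINT x|X. (cmod (f x))\<^sup>2) = (LINT x|X. 0)"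
    by (intro integral_cong_AE) (auto elim!: eventually_mono)
  then show ?thesis unfolding f(2) L2_hnsq[OF f(1)] by simp
qed

lemma b_zero: "b 0 (mat 1) = hscale (L2 X) 2 Om"
  unfolding b_def Om_def L2_scale[OF one_slice_sq]
  by (rule class_eqI[OF bfun_sq square_integrable_scale[OF one_slice_sq]]) (auto simp: bfun_apply on_slice_def U_zero)

lemma R_Om: "R w Om = b w (mat 1)"
  unfolding R_def b_def Om_def mult_op_class[OF ess_bounded_U one_slice_sq]
  by (rule class_eqI[OF ess_bounded_mult[OF ess_bounded_U one_slice_sq] bfun_sq]) (auto simp: bfun_apply on_slice_def)

lemma Lam_Om:
  assumes g: "det g = 1"
  shows "Lam g Om = Rho (inv2 g) Om"
  unfolding Lam_def Rho_def Om_def comp_op_class[OF hL_preserving[OF g] one_slice_sq]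
    comp_op_class[OF hR_preserving[OF inv2(1)[OF g]] one_slice_sq]
proof (rule class_eqI)
  fix y k assume "y \<in> Y_space" "det (k :: rat^2^2) = 1"
  then show "on_slice (cl (mat 1)) (\<lambda>_. 1) (hL g (y, cl k)) = on_slice (cl (mat 1)) (\<lambda>_. 1) (hR (inv2 g) (y, cl k))"
    using g inv2(1)[OF g] cl_mult_left_eq_iff[OF g, of k "mat 1"] cl_mult_right_eq_iff[OF inv2(1)[OF g], of k "mat 1"]
    by (simp add: hL_apply hR_apply on_slice_def)
qed (rule measure_preserving_square_integrable[OF hL_preserving[OF g] one_slice_sq]
    measure_preserving_square_integrable[OF hR_preserving[OF inv2(1)[OF g]] one_slice_sq])+

lemma Mul_Om: "\<exists>T\<in>Mul. T Om = b w (mat 1)"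
proof
  note e = ess_bounded_crossed[OF U_ess_bounded]
  show "crossed_mult PSL2Q Y_act Y (U w) Om = b w (mat 1)"
    unfolding crossed_mult_eq b_def Om_def mult_op_class[OF e one_slice_sq]
    by (rule class_eqI[OF ess_bounded_mult[OF e one_slice_sq] bfun_sq])
      (auto simp: bfun_apply on_slice_def Y_act_one)
  show "crossed_mult PSL2Q Y_act Y (U w) \<in> Mul" unfolding Mul_def using U_ess_bounded by blast
qed

lemma frame_crossed: "frame (L2 X) Om b Lam Rho R J Mul"
proof (intro frame.intro hilbert_space_L2 frame_axioms.intro)
  show "Om \<in> carrier (L2 X)" unfolding Om_def using one_slice_sq by (rule L2_class_carrier)
  show "b v g \<in> carrier (L2 X)" if "det g = 1" for v g unfolding b_def using bfun_sq[OF that] by (rule L2_class_carrier)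
  show "is_adjoint (L2 X) (R w) (R w)" for w
    using mult_op_adjoint[OF ess_bounded_U[of w]] unfolding R_def by (simp add: case_prod_beta')
  show "J \<xi> \<in> carrier (L2 X)" if "\<xi> \<in> carrier (L2 X)" for \<xi>
    using that
  proof (rule L2_cases)
    fix f assume "f \<in> square_integrable X" "\<xi> = L2_class X f"
    then show ?thesis
      using square_integrable_cnj[OF measure_preserving_square_integrable[OF hJ_preserving]] by (simp add: J_class)
  qed
  show "Lam g (Rho h \<xi>) = Rho h (Lam g \<xi>)" if "det g = 1" "det h = 1" "\<xi> \<in> carrier (L2 X)" for g h \<xi>
    unfolding Lam_def Rho_def using that inv2(1)
    by (intro comp_commute_comp hL_preserving hR_preserving) (auto simp: hL_apply hR_apply det_mul matrix_mul_assoc)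
  show "Lam g (R w \<xi>) = R w (Lam g \<xi>)" if "det g = 1" "\<xi> \<in> carrier (L2 X)" for g w \<xi>
    unfolding Lam_def R_def using that
    by (intro comp_commute_mult hL_preserving ess_bounded_U) (auto simp: hL_apply)
  show "T (Rho h \<xi>) = Rho h (T \<xi>)" if T: "T \<in> Mul" and h: "det h = 1" and \<xi>: "\<xi> \<in> carrier (L2 X)" for T h \<xi>
  proof -
    obtain f where f: "f \<in> ess_bounded Y" "T = mult_op X (\<lambda>(y, s). f (Y_act s y))"
      using T unfolding Mul_def crossed_mult_eq by blast
    have "comp_op X (hR h) (mult_op X (\<lambda>(y, s). f (Y_act s y)) \<xi>) = mult_op X (\<lambda>(y, s). f (Y_act s y)) (comp_op X (hR h) \<xi>)"
      using h inv2(1)[OF h] \<xi>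
      by (intro comp_commute_mult hR_preserving ess_bounded_crossed f(1))
        (auto simp: hR_apply Y_act_mult det_mul inv2_cancel)
    then show ?thesis unfolding f(2) Rho_def by simp
  qed
  show "T (R w \<xi>) = R w (T \<xi>)" if T: "T \<in> Mul" and \<xi>: "\<xi> \<in> carrier (L2 X)" for T w \<xi>
  proof -
    obtain f where f: "f \<in> ess_bounded Y" "T = mult_op X (\<lambda>(y, s). f (Y_act s y))"
      using T unfolding Mul_def crossed_mult_eq by blast
    show ?thesis unfolding f(2) R_def by (rule mult_op_commute[OF ess_bounded_crossed[OF f(1)] ess_bounded_U \<xi>])
  qed
qed ((rule b_inner b_total b_zero frame_bounded frame_adjoint Lam_b Rho_b R_b R_Om Lam_Om J_inner J_b Mul_Om;
    assumption?)+)

lemma frame_N: "frame.N (L2 X) Lam = group_vN PSL2Q Y"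
  unfolding frame.N_def[OF frame_crossed] group_vN_def Lam_image crossed_space_eq ..

lemma frame_M: "frame.M (L2 X) Lam Mul = crossed_product PSL2Q Y_act Y"
  unfolding frame.M_def[OF frame_crossed] by (simp only: crossed_product_def Lam_image Mul_def crossed_space_eq)

end

theorem theorem3p2:
  fixes \<mu> :: "(rat^2 \<Rightarrow> complex) measure"
  assumes "haar_probability \<mu>"
  shows "(\<forall>P. von_neumann_algebra (crossed_space PSL2Q (Y_measure \<mu>)) P \<and>
              group_vN PSL2Q (Y_measure \<mu>) \<subseteq> P \<and>
              P \<subseteq> crossed_product PSL2Q Y_act (Y_measure \<mu>) \<longrightarrow>
              P = group_vN PSL2Q (Y_measure \<mu>) \<or>
              P = crossed_product PSL2Q Y_act (Y_measure \<mu>)) \<and>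
         maximal_vN_subalgebra (crossed_space PSL2Q (Y_measure \<mu>))
           (group_vN PSL2Q (Y_measure \<mu>))
           (crossed_product PSL2Q Y_act (Y_measure \<mu>))"
proof -
  interpret haar \<mu> using assms by (rule haar.intro)
  have "maximal_vN_subalgebra (crossed_space PSL2Q Y) (group_vN PSL2Q Y) (crossed_product PSL2Q Y_act Y)"
    using frame.maximal_N[OF frame_crossed] unfolding frame_N frame_M crossed_space_eq .
  then show ?thesis unfolding maximal_vN_subalgebra_def by blast
qed

end
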